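(* Let $q>2$. Then $\underline{VSP}(T_{cw,q})$ is a point. The unique ideal $I$ is as follows: for all $s,t,u$ with $s+t+u=d$, the annihilator of $I_{stu}$ in $S^sA\otimes S^tB\otimes S^uC$ is $$L^{d}\oplus L^{d-1}\cdot M\oplus L^{d-2}\cdot Q,$$ where $L^d$, $L^{d-1}\cdot M$ and $L^{d-2}\cdot Q$ are the subspaces of $S^sA\otimes S^tB\otimes S^uC$ defined in the context.
   Context: All vector spaces are over $\mathbb{C}$. The border rank $\underline{\mathbf{R}}(T)$ of $T\in A\otimes B\otimes C$ is the smallest $r$ such that $T$ is a limit of sums of $r$ rank one tensors $a\otimes b\otimes c$. With bases $a_0,\dots,a_q$; $b_0,\dots,b_q$; $c_0,\dots,c_q$ of three copies $A,B,C$ of $\mathbb{C}^{q+1}$, $$T_{cw,q}=\sum_{j=1}^q \left(a_0\otimes b_j\otimes c_j+a_j\otimes b_0\otimes c_j+a_j\otimes b_j\otimes c_0\right).$$ Identify $A=B=C=W$ via $a_i=b_i=c_i=e_i$, let $L=\langle e_0\rangle$, $M=\langle e_1,\dots,e_q\rangle$ and $Q=\sum_{\alpha=1}^q e_\alpha\otimes e_\alpha$. For $s+t+u=d$ regard $S^dW\subset S^sW\otimes S^tW\otimes S^uW\subset W^{\otimes d}$ (symmetric tensors). Inside $S^sA\otimes S^tB\otimes S^uC=S^sW\otimes S^tW\otimes S^uW$: - $L^d$ is the line spanned by $e_0^{\otimes d}=a_0^s\otimes b_0^t\otimes c_0^u$; - $L^{d-1}\cdot M$ is spanned, for $\alpha=1,\dots,q$,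 by the sum over the $d$ positions of the tensor having $e_\alpha$ in that position and $e_0$ in all the others, i.e. $a_0^{s-1}\cdot a_\alpha\otimes b_0^t\otimes c_0^u+a_0^s\otimes b_0^{t-1}\cdot b_\alpha\otimes c_0^u+a_0^s\otimes b_0^t\otimes c_0^{u-1}\cdot c_\alpha$; - $L^{d-2}\cdot Q$ is the line spanned by the sum over $\alpha=1,\dots,q$ and over all pairs of distinct positions of the tensor having $e_\alpha$ in these two positions and $e_0$ in all the others. Summands with negative exponents are absent. Definition of $\underline{VSP}(T)$. Let $T\in A\otimes B\otimes C$ and $r=\underline{\mathbf{R}}(T)$. Consider $\mathbb{Z}^{\oplus 3}$-graded ideals $I\subset Sym(A^* )\otimes Sym(B^* )\otimes Sym(C^* )$, with graded components $I_{stu}\subset S^sA^*\otimes S^tB^*\otimes S^uC^*$. Then $\underline{VSP}(T)$ is the set of such ideals $I$ arising from a border rank $r$ decomposition of $T$, that is: $I_{111}\subset T^\perp$, and $I$ is in the closure (in the multigraded Hilbert scheme, equivalently each $I_{stu}$ is a limit in the corresponding Grassmannian, simultaneously for all $(s,t,u)$) of the set of ideals of $r$ distinct points of $\mathbb{P}A\times\mathbb{P}B\times\mathbb{P}C$ whose component in each degree $(s,t,u)$ has codimension $\min\{r,\dim(S^sA^*\otimes S^tB^*\otimes S^uC^* )\}$. *)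

theory Defs
  imports "HOL-Analysis.Analysis" "HOL-Library.Poly_Mapping" "HOL-Library.Multiset"
begin

section \<open>Complex vector spaces of finitely supported functions\<close>

definition pm_scale :: "complex \<Rightarrow> ('x \<Rightarrow>\<^sub>0 complex) \<Rightarrow> ('x \<Rightarrow>\<^sub>0 complex)" where
  "pm_scale c p = Poly_Mapping.map ((*) c) p"

lemma lookup_pm_scale [simp]:
  "Poly_Mapping.lookup (pm_scale c p) x = c * Poly_Mapping.lookup p x"
  by (simp add: pm_scale_def map.rep_eq when_def)

global_interpretation pm: vector_space pm_scale
  by unfold_locales (simp_all add: poly_mapping_eq_iff fun_eq_iff lookup_add algebra_simps)

text \<open>
  Convergence in the Grassmannian, for subspaces of a finite-dimensional space of finitely
  supported functions: the Grassmannian carries the quotient topology of the space of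
  linearly independent \<open>k\<close>-frames, so \<open>U n\<close> tends to \<open>V\<close> iff suitable frames of
  \<open>U n\<close> tend to a frame of \<open>V\<close>.
\<close>

definition frame_of :: "nat \<Rightarrow> (nat \<Rightarrow> 'x \<Rightarrow>\<^sub>0 complex) \<Rightarrow> ('x \<Rightarrow>\<^sub>0 complex) set \<Rightarrow> bool" where
  "frame_of k v U \<longleftrightarrow>
     inj_on v {..<k} \<and> pm.independent (v ` {..<k}) \<and> pm.span (v ` {..<k}) = U"

definition grassmann_tendsto ::
  "(nat \<Rightarrow> ('x \<Rightarrow>\<^sub>0 complex) set) \<Rightarrow> ('x \<Rightarrow>\<^sub>0 complex) set \<Rightarrow> bool" where
  "grassmann_tendsto U V \<longleftrightarrow>
     (\<exists>k v w. (\<forall>n. frame_of k (v n) (U n)) \<and> frame_of k w V \<and>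
        (\<forall>i<k. \<forall>x. (\<lambda>n. Poly_Mapping.lookup (v n i) x)
                       \<longlonglongrightarrow> Poly_Mapping.lookup (w i) x))"

section \<open>Tensors of order three and border rank\<close>

definition tensor3 ::
  "complex ^ 'a \<Rightarrow> complex ^ 'b \<Rightarrow> complex ^ 'c \<Rightarrow> complex ^ 'c ^ 'b ^ 'a" where
  "tensor3 a b c = (\<chi> i j k. a $ i * b $ j * c $ k)"

definition rank_one_tensors :: "(complex ^ 'c ^ 'b ^ 'a) set" where
  "rank_one_tensors = {tensor3 a b c | a b c. a \<noteq> 0 \<and> b \<noteq> 0 \<and> c \<noteq> 0}"

definition sums_of_rank_one :: "nat \<Rightarrow> (complex ^ 'c ^ 'b ^ 'a) set" where
  "sums_of_rank_one r = {\<Sum>i<r. S i | S. \<forall>i<r. S i \<in> rank_one_tensors}"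

definition border_rank :: "complex ^ 'c ^ 'b ^ 'a \<Rightarrow> nat" where
  "border_rank T = (LEAST r. T \<in> closure (sums_of_rank_one r))"

text \<open>
  The index type \<^typ>\<open>'q option\<close> labels the basis of a space of dimension \<open>q + 1\<close>, where
  \<open>q = CARD('q)\<close>: \<^const>\<open>None\<close> is the index \<open>0\<close>, and the \<open>Some j\<close> are the indices \<open>1, \<dots>, q\<close>.
\<close>

definition T_cw :: "complex ^ ('q::finite) option ^ 'q option ^ 'q option" where
  "T_cw = (\<Sum>j\<in>UNIV.
     tensor3 (axis None 1) (axis (Some j) 1) (axis (Some j) 1) +
     tensor3 (axis (Some j) 1) (axis None 1) (axis (Some j) 1) +
     tensor3 (axis (Some j) 1) (axis (Some j) 1) (axis None 1))"

section \<open>The trigraded polynomial ring\<close>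

text \<open>
  \<open>Sym(A*) \<otimes> Sym(B*) \<otimes> Sym(C*)\<close> is the polynomial ring in the coordinate functions of
  \<open>A = complex ^ 'a\<close>, \<open>B = complex ^ 'b\<close> and \<open>C = complex ^ 'c\<close>; its multiplication is the
  convolution product of \<^type>\<open>poly_mapping\<close>.
  Components of the grading by triples of integers with a negative entry vanish, so
  only degrees in the natural numbers are used.
\<close>

type_synonym ('a, 'b, 'c) monom3 = "('a + 'b + 'c) \<Rightarrow>\<^sub>0 nat"
type_synonym ('a, 'b, 'c) poly3 = "('a, 'b, 'c) monom3 \<Rightarrow>\<^sub>0 complex"

definition multideg :: "('a::finite, 'b::finite, 'c::finite) monom3 \<Rightarrow> nat \<times> nat \<times> nat" where
  "multideg m =
     ((\<Sum>i\<in>UNIV. Poly_Mapping.lookup m (Inl i)),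
      (\<Sum>j\<in>UNIV. Poly_Mapping.lookup m (Inr (Inl j))),
      (\<Sum>k\<in>UNIV. Poly_Mapping.lookup m (Inr (Inr k))))"

definition polys_of_deg ::
  "nat \<Rightarrow> nat \<Rightarrow> nat \<Rightarrow> ('a::finite, 'b::finite, 'c::finite) poly3 set" where
  "polys_of_deg s t u = {p. \<forall>m\<in>Poly_Mapping.keys p. multideg m = (s, t, u)}"

definition component ::
  "nat \<Rightarrow> nat \<Rightarrow> nat \<Rightarrow> ('a::finite, 'b::finite, 'c::finite) poly3 \<Rightarrow> ('a, 'b, 'c) poly3" where
  "component s t u p =
     (\<Sum>m\<in>{m \<in> Poly_Mapping.keys p. multideg m = (s, t, u)}.
        Poly_Mapping.single m (Poly_Mapping.lookup p m))"

definition graded_ideal :: "('a::finite, 'b::finite, 'c::finite) poly3 set \<Rightarrow> bool" where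
  "graded_ideal I \<longleftrightarrow>
     0 \<in> I \<and> (\<forall>p\<in>I. \<forall>p'\<in>I. p + p' \<in> I) \<and> (\<forall>f. \<forall>p\<in>I. f * p \<in> I) \<and>
     (\<forall>p\<in>I. \<forall>s t u. component s t u p \<in> I)"

definition ideal_part ::
  "('a::finite, 'b::finite, 'c::finite) poly3 set \<Rightarrow> nat \<Rightarrow> nat \<Rightarrow> nat \<Rightarrow> ('a, 'b, 'c) poly3 set" where
  "ideal_part I s t u = I \<inter> polys_of_deg s t u"

definition eval3 ::
  "('a, 'b, 'c) poly3 \<Rightarrow> complex ^ 'a \<Rightarrow> complex ^ 'b \<Rightarrow> complex ^ 'c \<Rightarrow> complex" where
  "eval3 p a b c =
     (\<Sum>m\<in>Poly_Mapping.keys p. Poly_Mapping.lookup p m *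
        (\<Prod>x\<in>Poly_Mapping.keys m.
           (case x of Inl i \<Rightarrow> a $ i | Inr (Inl j) \<Rightarrow> b $ j | Inr (Inr k) \<Rightarrow> c $ k)
             ^ Poly_Mapping.lookup m x))"

section \<open>Ideals of points and border rank decompositions\<close>

definition proj_space :: "(complex ^ 'n) set set" where
  "proj_space = {l. vec.subspace l \<and> vec.dim l = 1}"

text \<open>
  The multihomogeneous ideal of a set of points: a polynomial that vanishes on the products
  \<open>P \<times> Q \<times> R\<close> of the corresponding lines has all its multihomogeneous components vanishing there.
\<close>

definition ideal_of_points ::
  "((complex ^ 'a) set \<times> (complex ^ 'b) set \<times> (complex ^ 'c) set) set
     \<Rightarrow> ('a, 'b, 'c) poly3 set" where
  "ideal_of_points Z =
     {p. \<forall>(P, Q, R)\<in>Z. \<forall>a\<in>P. \<forall>b\<in>Q. \<forall>c\<in>R. eval3 p a b c = 0}"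

definition has_generic_hilbert_function ::
  "nat \<Rightarrow> ('a::finite, 'b::finite, 'c::finite) poly3 set \<Rightarrow> bool" where
  "has_generic_hilbert_function r I \<longleftrightarrow>
     (\<forall>s t u. pm.dim (ideal_part I s t u)
              + min r (pm.dim (polys_of_deg s t u :: ('a, 'b, 'c) poly3 set))
            = pm.dim (polys_of_deg s t u :: ('a, 'b, 'c) poly3 set))"

definition generic_point_ideals ::
  "nat \<Rightarrow> ('a::finite, 'b::finite, 'c::finite) poly3 set set" where
  "generic_point_ideals r =
     {ideal_of_points Z | Z.
        Z \<subseteq> proj_space \<times> proj_space \<times> proj_space \<and> finite Z \<and> card Z = r \<and>
        has_generic_hilbert_function r (ideal_of_points Z)}"

definition word_monom :: "'a list \<Rightarrow> 'b list \<Rightarrow> 'c list \<Rightarrow> ('a, 'b, 'c) monom3" where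
  "word_monom xs ys zs =
     (\<Sum>i\<leftarrow>xs. Poly_Mapping.single (Inl i) 1) +
     (\<Sum>j\<leftarrow>ys. Poly_Mapping.single (Inr (Inl j)) 1) +
     (\<Sum>k\<leftarrow>zs. Poly_Mapping.single (Inr (Inr k)) 1)"

definition tensor_perp ::
  "complex ^ 'c::finite ^ 'b::finite ^ 'a::finite \<Rightarrow> ('a, 'b, 'c) poly3 set" where
  "tensor_perp T =
     {p \<in> polys_of_deg 1 1 1.
        (\<Sum>i\<in>UNIV. \<Sum>j\<in>UNIV. \<Sum>k\<in>UNIV.
           Poly_Mapping.lookup p (word_monom [i] [j] [k]) * T $ i $ j $ k) = 0}"

text \<open>
  Points in the closure of a set in the product of (countably many) Grassmannians are limits
  of sequences, since that product is metrizable.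
\<close>

definition VSP :: "complex ^ 'c::finite ^ 'b::finite ^ 'a::finite \<Rightarrow> ('a, 'b, 'c) poly3 set set" where
  "VSP T =
     {I. graded_ideal I \<and> ideal_part I 1 1 1 \<subseteq> tensor_perp T \<and>
         (\<exists>J. (\<forall>n. J n \<in> generic_point_ideals (border_rank T)) \<and>
              (\<forall>s t u. grassmann_tendsto (\<lambda>n. ideal_part (J n) s t u) (ideal_part I s t u)))}"

section \<open>Partially symmetric tensors\<close>

text \<open>
  For \<open>W = complex ^ 'w\<close>, a tensor in \<open>W\<close> to the tensor power \<open>d\<close> is a function on words of
  length \<open>d\<close> over \<open>'w\<close>: \<open>Poly_Mapping.single w 1\<close> stands for
  \<open>e (w ! 0) \<otimes> \<dots> \<otimes> e (w ! (d - 1))\<close>.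
  The space \<open>S^s W \<otimes> S^t W \<otimes> S^u W\<close> consists of the tensors that are invariant
  under permutations of the first \<open>s\<close>, of the next \<open>t\<close> and of the last \<open>u\<close> positions.
\<close>

type_synonym 'w tensor = "'w list \<Rightarrow>\<^sub>0 complex"

definition part_sym_tensors :: "nat \<Rightarrow> nat \<Rightarrow> nat \<Rightarrow> 'w tensor set" where
  "part_sym_tensors s t u =
     {\<tau>. (\<forall>w\<in>Poly_Mapping.keys \<tau>. length w = s + t + u) \<and>
         (\<forall>xs ys zs xs' ys' zs'.
            length xs = s \<and> length ys = t \<and> length zs = u \<and>
            mset xs' = mset xs \<and> mset ys' = mset ys \<and> mset zs' = mset zs \<longrightarrow>
            Poly_Mapping.lookup \<tau> (xs' @ ys' @ zs') = Poly_Mapping.lookup \<tau> (xs @ ys @ zs))}"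

text \<open>
  The polarization turns a polynomial of multidegree \<open>(s, t, u)\<close> into the partially symmetric
  tensor it stands for: the coefficient of each monomial is divided evenly among the words
  with that monomial. The pairing with tensors is the usual contraction.
\<close>

definition polarize :: "('a, 'b, 'c) poly3 \<Rightarrow> 'a list \<Rightarrow> 'b list \<Rightarrow> 'c list \<Rightarrow> complex" where
  "polarize p xs ys zs =
     Poly_Mapping.lookup p (word_monom xs ys zs) /
     of_nat (card {xs'. mset xs' = mset xs} * card {ys'. mset ys' = mset ys}
             * card {zs'. mset zs' = mset zs})"

definition pairing ::
  "nat \<Rightarrow> nat \<Rightarrow> nat \<Rightarrow> ('w::finite, 'w, 'w) poly3 \<Rightarrow> 'w tensor \<Rightarrow> complex" where
  "pairing s t u p \<tau> =
     (\<Sum>xs | length xs = s. \<Sum>ys | length ys = t. \<Sum>zs | length zs = u.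
        polarize p xs ys zs * Poly_Mapping.lookup \<tau> (xs @ ys @ zs))"

definition annihilator ::
  "('w::finite, 'w, 'w) poly3 set \<Rightarrow> nat \<Rightarrow> nat \<Rightarrow> nat \<Rightarrow> 'w tensor set" where
  "annihilator I s t u =
     {\<tau> \<in> part_sym_tensors s t u. \<forall>p\<in>ideal_part I s t u. pairing s t u p \<tau> = 0}"

text \<open>
  For \<open>d\<close> too small for an exponent \<open>d - 1\<close> or \<open>d - 2\<close> to make sense, the sums below are
  empty, so that \<open>space_LM d\<close>, respectively \<open>space_LQ d\<close>, is the zero space.
\<close>

definition space_L :: "nat \<Rightarrow> 'q option tensor set" where
  "space_L d = pm.span {Poly_Mapping.single (replicate d None) 1}"

definition space_LM :: "nat \<Rightarrow> 'q option tensor set" where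
  "space_LM d =
     pm.span {\<Sum>k<d. Poly_Mapping.single ((replicate d None)[k := Some \<alpha>]) 1 | \<alpha>. True}"

definition space_LQ :: "nat \<Rightarrow> ('q::finite) option tensor set" where
  "space_LQ d =
     pm.span {\<Sum>\<alpha>\<in>UNIV. \<Sum>(k, l)\<in>{(k, l). k < l \<and> l < d}.
        Poly_Mapping.single ((replicate d None)[k := Some \<alpha>, l := Some \<alpha>]) 1}"

definition is_direct_sum3 ::
  "'x::ab_group_add set \<Rightarrow> 'x set \<Rightarrow> 'x set \<Rightarrow> 'x set \<Rightarrow> bool" where
  "is_direct_sum3 V U1 U2 U3 \<longleftrightarrow>
     V = {x + y + z | x y z. x \<in> U1 \<and> y \<in> U2 \<and> z \<in> U3} \<and>
     (\<forall>x\<in>U1. \<forall>y\<in>U2. \<forall>z\<in>U3. x + y + z = 0 \<longrightarrow> x = 0 \<and> y = 0 \<and> z = 0)"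

end

theory Submission
  imports Defs
begin

text \<open>
  Write \<open>q\<close> for \<open>CARD('q)\<close>, \<open>r = q + 2\<close> and \<open>T\<close> for \<open>T_cw\<close>. The unique point of \<open>VSP T\<close> is the ideal
  \<open>cw_ideal\<close>. Identify the three factors and put the coordinate with index 0 equal to 1; a
  multihomogeneous polynomial then becomes a polynomial in \<open>q\<close> variables, and it belongs to
  \<open>cw_ideal\<close> iff its value, its first derivatives and its Laplacian vanish at the origin. These
  functionals see of a monomial only the multiset of its nonzero letters, on which they are the
  functions \<open>cw_weight\<close>; read as tensors, they are the spanning vectors of \<open>L\<^sup>d\<close>, \<open>L\<^sup>d\<^sup>-\<^sup>1 M\<close> and
  \<open>L\<^sup>d\<^sup>-\<^sup>2 Q\<close> (\<open>lookup_cw_tensor\<close>), so that the description of the annihilator is a double dual.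

  \<^emph>\<open>Uniqueness.\<close> Of a point \<open>I\<close> of \<open>VSP T\<close> only two properties matter: \<open>I\<close> in degree \<open>(1,1,1)\<close>
  is contained in \<open>T\<^sup>\<bottom>\<close>, and all components have codimension \<open>min r dim\<close>, which passes from the
  ideals of points to their limit. Let \<open>E\<close> be the annihilator of \<open>I\<close> in degree \<open>(1,1,0)\<close>. It has
  dimension \<open>q + 2\<close> and contains the \<open>q + 1\<close> independent slices of \<open>T\<close>, so one further matrix
  \<open>X\<close> spans it together with them. The annihilator in degree \<open>(2,1,0)\<close> has dimension
  \<open>q + 2\<close> as well, and consists of tensors that are symmetric in the first two arguments and have
  all their slices in \<open>E\<close>. Such a tensor is determined by \<open>q + 2\<close> of its coordinates,
  so by the dimension these coordinates take arbitrary values; feeding in unit vectors kills all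
  entries of \<open>X\<close> except the one at \<open>(0,0)\<close> (\<open>prolongation_forces_corner\<close>; this is where \<open>q > 2\<close>
  enters). Hence \<open>I\<close> contains the quadrics of \<open>cw_ideal\<close> that involve two different factors
  (\<open>quadrics_in_ideal\<close>). Modulo these, letters can be moved freely between the factors, and every
  monomial reduces to a multiple of one of \<open>q + 2\<close> normal monomials
  (\<open>normal_form_mod_ideal\<close>), so in degrees that involve two factors \<open>I\<close> contains \<open>cw_ideal\<close> and agrees
  with it by dimension. A degree that involves one factor only is reached by multiplication with a
  variable of index 0 from another factor (\<open>var_None_colon\<close>).

  \<^emph>\<open>Existence.\<close> Take on the diagonal the \<open>q + 2\<close> points whose affine coordinates are \<open>0\<close>,
  \<open>\<epsilon> e\<^sub>j\<close> and \<open>\<epsilon>\<^sup>2 (1, \<dots>, 1)\<close>. Suitable divided differences of their evaluations tend to the value,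
  the derivatives and the Laplacian at the origin, and are for each \<open>\<epsilon>\<close> dual to the same
  normal monomials. Kernels of functionals with a common dual set of monomials have explicit frames that
  depend continuously on the functionals (\<open>grassmann_tendsto_weight_kernel\<close>).

  \<^emph>\<open>The border rank is \<open>q + 2\<close>.\<close> The divided difference that tends to the Laplacian, applied to the rank
  one tensors of the points above, approximates \<open>T\<close>. Conversely, the slices of a tensor of rank at most
  \<open>q + 1\<close> are diagonal in suitable coordinates as soon as one is invertible, hence satisfy
  \<open>X P\<^sup>-\<^sup>1 Y = Y P\<^sup>-\<^sup>1 X\<close> for invertible \<open>P\<close>; this persists in limits and fails for \<open>T\<close>
  (\<open>closure_slices_commute\<close>).
\<close>

section \<open>Weights and kernels in spaces of finitely supported functions\<close>

abbreviation (input) "lookup \<equiv> Poly_Mapping.lookup"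
abbreviation (input) "keys \<equiv> Poly_Mapping.keys"

abbreviation unit_pm :: "'x \<Rightarrow> 'x \<Rightarrow>\<^sub>0 complex" where
  "unit_pm m \<equiv> Poly_Mapping.single m 1"

text \<open>
  The linear functional with value \<open>g m\<close> at the basis vector \<open>m\<close>. All functionals below have this
  form, so that functionals are handled through their weights \<open>g\<close>.
\<close>

definition wsum :: "('x \<Rightarrow>\<^sub>0 complex) \<Rightarrow> ('x \<Rightarrow> complex) \<Rightarrow> complex" where
  "wsum p g = (\<Sum>m\<in>keys p. lookup p m * g m)"

lemma wsum_superset:
  assumes "finite S" "keys p \<subseteq> S"
  shows "wsum p g = (\<Sum>m\<in>S. lookup p m * g m)"
  unfolding wsum_def by (rule sum.mono_neutral_left) (use assms in \<open>auto simp: in_keys_iff\<close>)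

lemma wsum_0 [simp]: "wsum 0 g = 0"
  by (simp add: wsum_def)

lemma wsum_add: "wsum (p + p') g = wsum p g + wsum p' g"
proof -
  let ?S = "keys p \<union> keys p'"
  have "wsum (p + p') g = (\<Sum>m\<in>?S. lookup (p + p') m * g m)"
    by (rule wsum_superset) (auto dest: keys_add[THEN subsetD])
  moreover have "wsum p g = (\<Sum>m\<in>?S. lookup p m * g m)"
    by (rule wsum_superset) auto
  moreover have "wsum p' g = (\<Sum>m\<in>?S. lookup p' m * g m)"
    by (rule wsum_superset) auto
  ultimately show ?thesis
    by (simp add: lookup_add algebra_simps sum.distrib)
qed

lemma keys_pm_scale: "keys (pm_scale c p) \<subseteq> keys p"
  by (auto simp: in_keys_iff)

lemma wsum_scale: "wsum (pm_scale c p) g = c * wsum p g"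
proof -
  have "wsum (pm_scale c p) g = (\<Sum>m\<in>keys p. lookup (pm_scale c p) m * g m)"
    by (rule wsum_superset) (auto dest: keys_pm_scale[THEN subsetD])
  thus ?thesis by (simp add: wsum_def sum_distrib_left mult.assoc)
qed

lemma pm_scale_minus_one: "pm_scale (-1) p = - p"
  by (simp add: poly_mapping_eq_iff fun_eq_iff)

lemma wsum_diff: "wsum (p - p') g = wsum p g - wsum p' g"
  using wsum_add[of p "pm_scale (-1) p'" g] wsum_scale[of "-1" p' g] by (simp add: pm_scale_minus_one)

lemma wsum_sum: "wsum (sum f A) g = (\<Sum>a\<in>A. wsum (f a) g)"
  by (induction A rule: infinite_finite_induct) (auto simp: wsum_add)

lemma wsum_single [simp]: "wsum (Poly_Mapping.single m c) g = c * g m"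
  by (simp add: wsum_def)

lemma wsum_weight_add: "wsum p (\<lambda>m. g m + h m) = wsum p g + wsum p h"
  by (simp add: wsum_def algebra_simps sum.distrib)

lemma wsum_weight_scale: "wsum p (\<lambda>m. c * g m) = c * wsum p g"
  by (simp add: wsum_def sum_distrib_left algebra_simps)

lemma wsum_weight_sum: "wsum p (\<lambda>m. \<Sum>a\<in>A. g a m) = (\<Sum>a\<in>A. wsum p (g a))"
  by (simp add: wsum_def sum_distrib_left sum.swap[of _ A])

lemma wsum_weight_cong:
  "(\<And>m. m \<in> keys p \<Longrightarrow> g m = h m) \<Longrightarrow> wsum p g = wsum p h"
  by (simp add: wsum_def)

definition supp_in :: "'x set \<Rightarrow> ('x \<Rightarrow>\<^sub>0 complex) set" where
  "supp_in S = {p. keys p \<subseteq> S}"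

lemma pm_expand:
  assumes "finite S" "p \<in> supp_in S"
  shows "p = (\<Sum>m\<in>S. pm_scale (lookup p m) (unit_pm m))"
proof (rule poly_mapping_eqI)
  fix x
  have "lookup p x = 0" if "x \<notin> S"
    using assms that by (auto simp: supp_in_def in_keys_iff)
  thus "lookup p x = lookup (\<Sum>m\<in>S. pm_scale (lookup p m) (unit_pm m)) x"
    using assms(1) by (auto simp: lookup_sum lookup_single when_def sum.delta if_distrib[of "(*) _"] cong: if_cong)
qed

lemma subspace_supp_in: "pm.subspace (supp_in S)"
  unfolding pm.subspace_def supp_in_def
  by (auto dest: keys_add[THEN subsetD] keys_pm_scale[THEN subsetD])

lemma unit_in_supp_in [simp]: "unit_pm m \<in> supp_in S \<longleftrightarrow> m \<in> S"
  by (simp add: supp_in_def)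

text \<open>
  The functionals with weights \<open>c i\<close> are dual to the basis vectors \<open>nm i\<close>. Their kernel is then a
  complement of these basis vectors, and \<open>kernel_vec\<close> is the projection to the kernel along them,
  evaluated at a basis vector.
\<close>

definition dual_system :: "'i set \<Rightarrow> 'x set \<Rightarrow> ('i \<Rightarrow> 'x) \<Rightarrow> ('i \<Rightarrow> 'x \<Rightarrow> complex) \<Rightarrow> bool" where
  "dual_system A S nm c \<longleftrightarrow> finite A \<and> nm ` A \<subseteq> S \<and>
     (\<forall>i\<in>A. \<forall>j\<in>A. c i (nm j) = of_bool (i = j))"

definition weight_kernel :: "'i set \<Rightarrow> 'x set \<Rightarrow> ('i \<Rightarrow> 'x \<Rightarrow> complex) \<Rightarrow> ('x \<Rightarrow>\<^sub>0 complex) set" where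
  "weight_kernel A S c = {p \<in> supp_in S. \<forall>i\<in>A. wsum p (c i) = 0}"

definition kernel_vec :: "'i set \<Rightarrow> ('i \<Rightarrow> 'x) \<Rightarrow> ('i \<Rightarrow> 'x \<Rightarrow> complex) \<Rightarrow> 'x \<Rightarrow> 'x \<Rightarrow>\<^sub>0 complex" where
  "kernel_vec A nm c m = unit_pm m - (\<Sum>i\<in>A. pm_scale (c i m) (unit_pm (nm i)))"

lemma dual_system_inj: "dual_system A S nm c \<Longrightarrow> inj_on nm A"
  unfolding dual_system_def inj_on_def by (metis of_bool_eq_iff)

lemma subspace_weight_kernel: "pm.subspace (weight_kernel A S c)"
  using subspace_supp_in[of S]
  unfolding pm.subspace_def weight_kernel_def by (auto simp: wsum_add wsum_scale)

lemma lookup_kernel_vec: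
  assumes "x \<notin> nm ` A"
  shows "lookup (kernel_vec A nm c m) x = of_bool (m = x)"
proof -
  have "(\<Sum>i\<in>A. c i m * (1 when nm i = x)) = 0"
    by (rule sum.neutral) (use assms in auto)
  thus ?thesis
    by (simp add: kernel_vec_def lookup_minus lookup_sum lookup_single when_def of_bool_def)
qed

lemma kernel_vec_in_kernel:
  assumes "dual_system A S nm c" "m \<in> S"
  shows "kernel_vec A nm c m \<in> weight_kernel A S c"
proof -
  have "kernel_vec A nm c m \<in> supp_in S"
    unfolding kernel_vec_def using assms
    by (intro pm.subspace_diff pm.subspace_sum pm.subspace_scale subspace_supp_in)
       (auto simp: dual_system_def)
  moreover have "wsum (kernel_vec A nm c m) (c i) = 0" if "i \<in> A" for i
  proof -
    have "(\<Sum>j\<in>A. c j m * c i (nm j)) = (\<Sum>j\<in>A. if j = i then c i m else 0)"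
      using assms that by (intro sum.cong) (auto simp: dual_system_def)
    also have "\<dots> = c i m"
      using assms that by (simp add: dual_system_def)
    finally show ?thesis
      by (simp add: kernel_vec_def wsum_diff wsum_sum wsum_scale)
  qed
  ultimately show ?thesis by (simp add: weight_kernel_def)
qed

lemma kernel_vec_expansion:
  assumes ds: "dual_system A S nm c" and S: "finite S" and p: "p \<in> weight_kernel A S c"
  shows "p = (\<Sum>m\<in>S. pm_scale (lookup p m) (kernel_vec A nm c m))"
proof -
  have p': "p \<in> supp_in S" "\<And>i. i \<in> A \<Longrightarrow> wsum p (c i) = 0"
    using p by (auto simp: weight_kernel_def)
  have "(\<Sum>m\<in>S. pm_scale (lookup p m) (kernel_vec A nm c m)) =
        p - (\<Sum>m\<in>S. \<Sum>i\<in>A. pm_scale (lookup p m * c i m) (unit_pm (nm i)))"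
    by (subst (2) pm_expand[OF S p'(1)])
       (simp add: kernel_vec_def pm.scale_right_diff_distrib sum_subtractf pm.scale_sum_right)
  also have "(\<Sum>m\<in>S. \<Sum>i\<in>A. pm_scale (lookup p m * c i m) (unit_pm (nm i))) =
             (\<Sum>i\<in>A. pm_scale (\<Sum>m\<in>S. lookup p m * c i m) (unit_pm (nm i)))"
    by (subst sum.swap) (simp add: pm.scale_sum_left)
  also have "\<dots> = 0"
  proof (rule sum.neutral, rule ballI)
    fix i assume "i \<in> A"
    hence "(\<Sum>m\<in>S. lookup p m * c i m) = 0"
      using p' wsum_superset[OF S, of p "c i"] by (simp add: supp_in_def)
    thus "pm_scale (\<Sum>m\<in>S. lookup p m * c i m) (unit_pm (nm i)) = 0" by simp
  qed
  finally show ?thesis by simp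
qed

lemma kernel_vec_nm:
  assumes "dual_system A S nm c" "j \<in> A"
  shows "kernel_vec A nm c (nm j) = 0"
proof -
  have "(\<Sum>i\<in>A. pm_scale (c i (nm j)) (unit_pm (nm i))) =
        (\<Sum>i\<in>A. if i = j then unit_pm (nm j) else 0)"
    using assms by (intro sum.cong) (auto simp: dual_system_def)
  also have "\<dots> = unit_pm (nm j)"
    using assms by (simp add: dual_system_def)
  finally show ?thesis by (simp add: kernel_vec_def)
qed

text \<open>
  The projections of the remaining basis vectors form a frame of the kernel: their coordinates outside
  of \<open>nm ` A\<close> are those of unit vectors, and the coordinates inside are values of the weights up to
  sign. In particular the frame varies continuously with the weights.
\<close>

lemma frame_of_weight_kernel:
  assumes ds: "dual_system A S nm c" and S: "finite S"
    and f: "bij_betw f {..<k} (S - nm ` A)"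
  shows "frame_of k (\<lambda>n. kernel_vec A nm c (f n)) (weight_kernel A S c)"
proof -
  let ?v = "\<lambda>n. kernel_vec A nm c (f n)"
  have fS: "f n \<in> S" "f n \<notin> nm ` A" if "n < k" for n
    using f that by (auto simp: bij_betw_def)
  have finj: "f i = f j \<longleftrightarrow> i = j" if "i < k" "j < k" for i j
    using f that by (auto simp: bij_betw_def inj_on_def)
  have lk: "lookup (?v i) (f j) = of_bool (i = j)" if "i < k" "j < k" for i j
    using fS that finj by (simp add: lookup_kernel_vec)
  have inj: "inj_on ?v {..<k}"
  proof (rule inj_onI)
    fix i j assume ij: "i \<in> {..<k}" "j \<in> {..<k}" "?v i = ?v j"
    hence "lookup (?v i) (f j) = lookup (?v j) (f j)" by simp
    with ij show "i = j" using lk[of i j] lk[of j j] by (simp split: if_splits)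
  qed
  have ind: "pm.independent (?v ` {..<k})"
  proof (rule pm.independent_if_scalars_zero)
    fix g x assume s: "(\<Sum>x\<in>?v ` {..<k}. pm_scale (g x) x) = 0" and x: "x \<in> ?v ` {..<k}"
    then obtain j where j: "j < k" "x = ?v j" by auto
    have "0 = lookup (\<Sum>i<k. pm_scale (g (?v i)) (?v i)) (f j)"
      using s by (simp add: sum.reindex[OF inj])
    also have "\<dots> = (\<Sum>i<k. if i = j then g (?v i) else 0)"
      using j by (auto simp: lookup_sum lk intro!: sum.cong)
    also have "\<dots> = g (?v j)" using j by simp
    finally show "g x = 0" using j by simp
  qed auto
  have "pm.span (?v ` {..<k}) = weight_kernel A S c"
  proof
    show "pm.span (?v ` {..<k}) \<subseteq> weight_kernel A S c"
      by (rule pm.span_minimal[OF _ subspace_weight_kernel])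
         (use kernel_vec_in_kernel[OF ds] fS in auto)
    show "weight_kernel A S c \<subseteq> pm.span (?v ` {..<k})"
    proof
      fix p assume p: "p \<in> weight_kernel A S c"
      have "kernel_vec A nm c m \<in> pm.span (?v ` {..<k})" if "m \<in> S" for m
      proof (cases "m \<in> nm ` A")
        case True
        thus ?thesis using kernel_vec_nm[OF ds] pm.span_zero by auto
      next
        case False
        hence "m \<in> f ` {..<k}" using that f by (auto simp: bij_betw_def)
        thus ?thesis by (auto intro: pm.span_base)
      qed
      thus "p \<in> pm.span (?v ` {..<k})"
        by (subst kernel_vec_expansion[OF ds S p]) (intro pm.span_sum pm.span_scale)
    qed
  qed
  with inj ind show ?thesis unfolding frame_of_def by blast
qed

lemma frame_of_dim: "frame_of k v U \<Longrightarrow> pm.dim U = k"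
  unfolding frame_of_def using pm.dim_span_eq_card_independent card_image by fastforce

lemma card_dual_complement:
  assumes "dual_system A S nm c" "finite S"
  shows "card (S - nm ` A) + card A = card S"
proof -
  have "card (nm ` A) = card A" by (rule card_image[OF dual_system_inj[OF assms(1)]])
  moreover have "nm ` A \<subseteq> S" using assms by (simp add: dual_system_def)
  ultimately show ?thesis
    using assms by (metis card_Diff_subset card_mono finite_subset le_add_diff_inverse2)
qed

lemma dim_weight_kernel:
  assumes "dual_system A S nm c" "finite S"
  shows "pm.dim (weight_kernel A S c) + card A = card S"
proof -
  obtain f where "bij_betw f {..<card (S - nm ` A)} (S - nm ` A)"
    using assms(2) by (metis ex_bij_betw_nat_finite finite_Diff lessThan_atLeast0)
  from frame_of_dim[OF frame_of_weight_kernel[OF assms this]] card_dual_complement[OF assms]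
  show ?thesis by simp
qed

lemma dim_supp_in: "finite S \<Longrightarrow> pm.dim (supp_in S) = card S"
  using dim_weight_kernel[of "{}" S undefined undefined]
  by (simp add: dual_system_def weight_kernel_def)

lemma grassmann_tendsto_weight_kernel:
  assumes ds: "\<And>n. dual_system A S nm (c n)" "dual_system A S nm c'" and S: "finite S"
    and lim: "\<And>i m. i \<in> A \<Longrightarrow> m \<in> S \<Longrightarrow> (\<lambda>n. c n i m) \<longlonglongrightarrow> c' i m"
  shows "grassmann_tendsto (\<lambda>n. weight_kernel A S (c n)) (weight_kernel A S c')"
proof -
  obtain f where f: "bij_betw f {..<card (S - nm ` A)} (S - nm ` A)"
    using assms(3) by (metis ex_bij_betw_nat_finite finite_Diff lessThan_atLeast0)
  have "(\<lambda>n. lookup (kernel_vec A nm (c n) (f i)) x)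
          \<longlonglongrightarrow> lookup (kernel_vec A nm c' (f i)) x" if "i < card (S - nm ` A)" for i x
  proof -
    have "f i \<in> S" using f that by (auto simp: bij_betw_def)
    thus ?thesis
      by (auto simp: kernel_vec_def lookup_minus lookup_sum intro!: tendsto_intros lim)
  qed
  moreover have "frame_of (card (S - nm ` A)) (\<lambda>i. kernel_vec A nm (c n) (f i)) (weight_kernel A S (c n))" for n
    by (rule frame_of_weight_kernel[OF ds(1) S f])
  moreover have "frame_of (card (S - nm ` A)) (\<lambda>i. kernel_vec A nm c' (f i)) (weight_kernel A S c')"
    by (rule frame_of_weight_kernel[OF ds(2) S f])
  ultimately show ?thesis unfolding grassmann_tendsto_def
    by (intro exI[of _ "card (S - nm ` A)"] exI[of _ "\<lambda>n i. kernel_vec A nm (c n) (f i)"]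
        exI[of _ "\<lambda>i. kernel_vec A nm c' (f i)"]) auto
qed

lemma grassmann_tendsto_dim:
  assumes "grassmann_tendsto U V"
  shows "pm.dim (U n) = pm.dim V"
  using assms unfolding grassmann_tendsto_def by (metis frame_of_dim)

text \<open>
  By Steinitz exchange, a basis of \<open>U\<close> together with the unit vectors of \<open>N0\<close> extends by further unit
  vectors to a basis of the whole space; the weights are the coordinates along the unit vectors of this
  basis. Prescribing \<open>N0\<close> serves to choose functionals that are already known on the quotient as part
  of the dual system.
\<close>

lemma subspace_as_weight_kernel:
  assumes S: "finite S" and U: "pm.subspace U" "U \<subseteq> supp_in S"
    and N0: "N0 \<subseteq> S" "\<And>p. p \<in> U \<Longrightarrow> p \<in> supp_in N0 \<Longrightarrow> p = 0"
  obtains N c where "N0 \<subseteq> N" "N \<subseteq> S" "pm.dim U + card N = card S"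
    "dual_system N S id c" "U = weight_kernel N S c"
proof -
  obtain B where B: "B \<subseteq> U" "pm.independent B" "pm.span B = U"
  proof -
    obtain B where "B \<subseteq> U" "pm.independent B" "U \<subseteq> pm.span B"
      using pm.maximal_independent_subset by blast
    thus ?thesis using that pm.span_minimal[OF _ U(1)] by blast
  qed
  have fN0: "finite N0" using N0(1) S finite_subset by blast
  have inj: "inj_on unit_pm T" for T :: "'a set"
    by (rule inj_onI) (metis lookup_single_eq lookup_single_not_eq zero_neq_one)
  have span_units: "pm.span (unit_pm ` T) = supp_in T" if "finite T" for T :: "'a set"
  proof
    show "pm.span (unit_pm ` T) \<subseteq> supp_in T"
      by (rule pm.span_minimal[OF _ subspace_supp_in]) auto
    show "supp_in T \<subseteq> pm.span (unit_pm ` T)"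
      by (rule subsetI, subst pm_expand[OF that]) (auto intro!: pm.span_sum pm.span_scale intro: pm.span_base)
  qed
  have fB: "finite B"
    using pm.independent_span_bound[of "unit_pm ` S" B] S B U(2) span_units[OF S] by auto
  have B0: "pm.independent (B \<union> unit_pm ` N0) \<and> B \<inter> unit_pm ` N0 = {}"
  proof
    show disj: "B \<inter> unit_pm ` N0 = {}"
    proof (rule ccontr)
      assume "B \<inter> unit_pm ` N0 \<noteq> {}"
      then obtain m where "m \<in> N0" "unit_pm m \<in> B" by auto
      with N0(2)[of "unit_pm m"] B(1) have "unit_pm m = (0 :: 'a \<Rightarrow>\<^sub>0 complex)" by auto
      hence "lookup (unit_pm m :: 'a \<Rightarrow>\<^sub>0 complex) m = 0" by (metis lookup_zero)
      thus False by simp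
    qed
    show "pm.independent (B \<union> unit_pm ` N0)"
    proof (rule pm.independent_if_scalars_zero)
      fix g x assume s: "(\<Sum>x\<in>B \<union> unit_pm ` N0. pm_scale (g x) x) = 0"
        and x: "x \<in> B \<union> unit_pm ` N0"
      let ?b = "\<Sum>x\<in>B. pm_scale (g x) x" and ?n = "\<Sum>m\<in>N0. pm_scale (g (unit_pm m)) (unit_pm m)"
      have bn: "?b + ?n = 0"
        using s disj fB fN0 by (simp add: sum.union_disjoint sum.reindex[OF inj])
      hence "?b = - ?n" by (simp add: eq_neg_iff_add_eq_0)
      moreover have "?n \<in> supp_in N0"
        by (intro pm.subspace_sum pm.subspace_scale subspace_supp_in) auto
      ultimately have "?b \<in> supp_in N0" by (simp add: supp_in_def)
      moreover have "?b \<in> U"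
        using B(1) U(1) by (intro pm.subspace_sum pm.subspace_scale) auto
      ultimately have b0: "?b = 0" using N0(2) by blast
      with bn have n0: "?n = 0" by simp
      show "g x = 0"
      proof (cases "x \<in> B")
        case True
        show ?thesis
          using pm.independentD[OF B(2) fB subset_refl b0 True] .
      next
        case False
        then obtain m where m: "m \<in> N0" "x = unit_pm m" using x by auto
        have "0 = lookup ?n m" using n0 by simp
        also have "\<dots> = (\<Sum>m'\<in>N0. if m' = m then g x else 0)"
          using m by (auto simp: lookup_sum lookup_single when_def intro!: sum.cong)
        also have "\<dots> = g x" using m fN0 by simp
        finally show ?thesis by simp
      qed
    qed (use fB fN0 in auto)
  qed
  obtain B' where B': "B \<union> unit_pm ` N0 \<subseteq> B'" "B' \<subseteq> B \<union> unit_pm ` S"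
      "pm.independent B'" "B \<union> unit_pm ` S \<subseteq> pm.span B'"
    by (rule pm.maximal_independent_subset_extend[of "B \<union> unit_pm ` N0" "B \<union> unit_pm ` S"])
       (use B0 N0 in auto)
  have spB': "pm.span B' = supp_in S"
  proof
    show "pm.span B' \<subseteq> supp_in S"
    proof (rule pm.span_minimal[OF _ subspace_supp_in])
      have "unit_pm ` S \<subseteq> supp_in S" by auto
      thus "B' \<subseteq> supp_in S" using B'(2) B(1) U(2) by blast
    qed
    show "supp_in S \<subseteq> pm.span B'"
      using B'(4) span_units[OF S] pm.span_minimal[of "unit_pm ` S" "pm.span B'"] pm.subspace_span
      by blast
  qed
  define N where "N = {m \<in> S. unit_pm m \<in> B' - B}"
  have N: "N0 \<subseteq> N" "N \<subseteq> S" using B'(1) N0(1) B0 unfolding N_def by blast+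
  have fN: "finite N" using N S finite_subset by blast
  have B'eq: "B' = B \<union> unit_pm ` N" "B \<inter> unit_pm ` N = {}"
    using B'(1,2) unfolding N_def by blast+
  have fB': "finite B'" using B'eq fB fN by simp
  have dim: "pm.dim U + card N = card S"
  proof -
    have "card S = pm.dim (pm.span B')" using spB' dim_supp_in[OF S] by simp
    also have "\<dots> = card B'" using B'(3) by (rule pm.dim_span_eq_card_independent)
    also have "\<dots> = card B + card N"
      using B'eq fB fN card_image[OF inj] by (simp add: card_Un_disjoint)
    also have "card B = pm.dim U"
      using B pm.dim_span_eq_card_independent by metis
    finally show ?thesis by simp
  qed
  define c where "c = (\<lambda>n m. pm.representation B' (unit_pm m) (unit_pm n))"
  have rep: "pm.representation B' p (unit_pm n) = wsum p (c n)" if "p \<in> supp_in S" for p n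
  proof -
    have "pm.representation B' p = pm.representation B' (\<Sum>m\<in>S. pm_scale (lookup p m) (unit_pm m))"
      using pm_expand[OF S that] by simp
    also have "\<dots> = (\<lambda>b. \<Sum>m\<in>S. lookup p m * pm.representation B' (unit_pm m) b)"
    proof -
      have u: "unit_pm m \<in> pm.span B'" if "m \<in> S" for m using that spB' by simp
      hence "pm_scale a (unit_pm m) \<in> pm.span B'" if "m \<in> S" for a m
        using that by (intro pm.span_scale)
      hence "pm.representation B' (\<Sum>m\<in>S. pm_scale (lookup p m) (unit_pm m)) =
          (\<lambda>b. \<Sum>m\<in>S. pm.representation B' (pm_scale (lookup p m) (unit_pm m)) b)"
        by (rule pm.representation_sum[OF B'(3)])
      also have "\<dots> = (\<lambda>b. \<Sum>m\<in>S. lookup p m * pm.representation B' (unit_pm m) b)"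
        by (intro ext sum.cong refl) (simp add: pm.representation_scale[OF B'(3) u])
      finally show ?thesis .
    qed
    finally show ?thesis
      using that wsum_superset[OF S, of p "c n"] by (simp add: c_def supp_in_def)
  qed
  have ds: "dual_system N S id c"
    unfolding dual_system_def
  proof (intro conjI ballI)
    fix i j assume ij: "i \<in> N" "j \<in> N"
    hence "unit_pm j \<in> B'" using B'eq by auto
    hence "pm.representation B' (unit_pm j) = (\<lambda>v. if v = unit_pm j then 1 else 0)"
      by (rule pm.representation_basis[OF B'(3)])
    moreover have "unit_pm i = unit_pm j \<longleftrightarrow> i = j" using inj[of UNIV] unfolding inj_on_def by blast
    ultimately show "c i (id j) = of_bool (i = j)"
      by (simp only: c_def id_apply of_bool_def)
  qed (use fN N in auto)
  have "U = weight_kernel N S c"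
  proof (intro equalityI subsetI)
    fix p assume p: "p \<in> U"
    have "wsum p (c n) = 0" if "n \<in> N" for n
    proof -
      have "pm.representation B' p = pm.representation B p"
        by (rule pm.representation_extend[OF B'(3)]) (use B'(1) B(3) p in blast)+
      moreover have "unit_pm n \<notin> B" using that by (auto simp: N_def)
      hence "pm.representation B p (unit_pm n) = 0"
        using pm.representation_ne_zero by blast
      ultimately show ?thesis using rep[of p n] p U(2) by (metis subsetD)
    qed
    thus "p \<in> weight_kernel N S c" using p U(2) by (auto simp: weight_kernel_def)
  next
    fix p assume p: "p \<in> weight_kernel N S c"
    hence pS: "p \<in> supp_in S" by (simp add: weight_kernel_def)
    have "p = (\<Sum>b\<in>B'. pm_scale (pm.representation B' p b) b)"
      using pm.sum_representation_eq[OF B'(3), of p B'] fB' spB' pS by simp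
    also have "\<dots> = (\<Sum>b\<in>B. pm_scale (pm.representation B' p b) b) +
        (\<Sum>n\<in>N. pm_scale (pm.representation B' p (unit_pm n)) (unit_pm n))"
      unfolding B'eq(1) using B'eq(2) fB fN by (simp add: sum.union_disjoint sum.reindex[OF inj])
    also have "(\<Sum>n\<in>N. pm_scale (pm.representation B' p (unit_pm n)) (unit_pm n)) = 0"
      using p by (intro sum.neutral) (simp add: rep[OF pS] weight_kernel_def)
    finally have "p = (\<Sum>b\<in>B. pm_scale (pm.representation B' p b) b)" by simp
    moreover have "\<dots> \<in> U" using B(1) U(1) by (intro pm.subspace_sum pm.subspace_scale) auto
    ultimately show "p \<in> U" by simp
  qed
  with N dim ds that show ?thesis by blast
qed

lemma subspace_dim_eq:
  assumes "finite S" "pm.subspace U" "pm.subspace V" "U \<subseteq> V" "V \<subseteq> supp_in S" "pm.dim U = pm.dim V"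
  shows "U = V"
proof -
  obtain B where B: "B \<subseteq> U" "pm.independent B" "U \<subseteq> pm.span B" "card B = pm.dim U"
    using pm.basis_exists by blast
  obtain B' where B': "B \<subseteq> B'" "B' \<subseteq> V" "pm.independent B'" "V \<subseteq> pm.span B'"
    using pm.maximal_independent_subset_extend[of B V] B(1,2) assms(4) by blast
  have "finite B'"
  proof -
    have "B' \<subseteq> pm.span (unit_pm ` S)"
    proof
      fix p assume "p \<in> B'"
      hence "p \<in> supp_in S" using B'(2) assms(5) by auto
      thus "p \<in> pm.span (unit_pm ` S)"
        by (subst pm_expand[OF assms(1)]) (auto intro!: pm.span_sum pm.span_scale intro: pm.span_base)
    qed
    thus ?thesis using pm.independent_span_bound[of "unit_pm ` S" B'] B'(3) assms(1) by auto
  qed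
  moreover have "card B' = pm.dim V" using B' pm.basis_card_eq_dim by blast
  ultimately have "B = B'" using B(4) assms(6) B'(1) by (metis card_subset_eq)
  hence "V \<subseteq> pm.span U" using B'(4) B(1) pm.span_mono by blast
  thus ?thesis using assms by (metis pm.span_eq_iff subset_antisym)
qed

section \<open>Monomials as words\<close>

type_synonym 'q cw_monom = "('q option, 'q option, 'q option) monom3"
type_synonym 'q cw_poly = "('q option, 'q option, 'q option) poly3"
type_synonym 'q cw_space = "complex ^ 'q option ^ 'q option ^ 'q option"

lemma sum_UNIV_option: "(\<Sum>k\<in>UNIV. f k) = f None + (\<Sum>a\<in>UNIV. f (Some a))"
  for f :: "'a::finite option \<Rightarrow> 'b::comm_monoid_add"
  by (simp add: UNIV_option_conv sum.reindex)

lemma ex_third_letter: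
  assumes "CARD('q::finite) > 2"
  shows "\<exists>c::'q. c \<noteq> a \<and> c \<noteq> b"
proof (rule ccontr)
  assume "\<not> ?thesis"
  hence "UNIV \<subseteq> {a, b}" by auto
  hence "CARD('q) \<le> card {a, b}" by (intro card_mono) auto
  also have "\<dots> \<le> 2" by (simp add: card_insert_if)
  finally show False using assms by simp
qed

definition var :: "nat \<Rightarrow> 'w \<Rightarrow> 'w + 'w + 'w" where
  "var b i = (if b = 0 then Inl i else if b = 1 then Inr (Inl i) else Inr (Inr i))"

abbreviation var_monom :: "nat \<Rightarrow> 'w \<Rightarrow> ('w, 'w, 'w) monom3" where
  "var_monom b i \<equiv> Poly_Mapping.single (var b i) 1"

definition letter :: "'w + 'w + 'w \<Rightarrow> 'w" where
  "letter v = (case v of Inl i \<Rightarrow> i | Inr (Inl i) \<Rightarrow> i | Inr (Inr i) \<Rightarrow> i)"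

lemma letter_var [simp]: "letter (var b i) = i"
  by (simp add: letter_def var_def)

text \<open>
  The monomial that arises when the three factors are identified.
\<close>

definition letters :: "('w::finite, 'w, 'w) monom3 \<Rightarrow> 'w multiset" where
  "letters m = (\<Sum>v\<in>UNIV. replicate_mset (lookup m v) (letter v))"

lemma letters_0 [simp]: "letters 0 = {#}"
  by (simp add: letters_def)

lemma letters_add [simp]: "letters (m + m') = letters m + letters m'"
proof -
  have "replicate_mset (a + b) x = replicate_mset a x + replicate_mset b x" for a b and x :: 'a
    by (rule multiset_eqI) simp
  thus ?thesis by (simp add: letters_def lookup_add sum.distrib)
qed

lemma letters_single [simp]: "letters (Poly_Mapping.single v 1) = {#letter v#}"
proof -
  have "letters (Poly_Mapping.single v 1) = (\<Sum>v'\<in>UNIV. if v' = v then {#letter v#} else {#})"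
    unfolding letters_def by (intro sum.cong) (auto simp: lookup_single when_def)
  thus ?thesis by simp
qed

lemmas letters_single_Suc_0 [simp] = letters_single[unfolded One_nat_def]

lemma letters_word_monom [simp]: "letters (word_monom xs ys zs) = mset (xs @ ys @ zs)"
proof -
  have "letters (\<Sum>i\<leftarrow>xs. Poly_Mapping.single (f i) 1) = mset xs"
    if "\<And>i. letter (f i) = i" for f and xs :: "'a list"
    using that by (induction xs) auto
  thus ?thesis by (simp add: word_monom_def letter_def)
qed

lemma lookup_word_monom [simp]:
  "lookup (word_monom xs ys zs) (Inl i) = count (mset xs) i"
  "lookup (word_monom xs ys zs) (Inr (Inl j)) = count (mset ys) j"
  "lookup (word_monom xs ys zs) (Inr (Inr k)) = count (mset zs) k"
proof -
  have *: "lookup (\<Sum>i\<leftarrow>xs. Poly_Mapping.single (f i) (1::nat)) (f i) = count (mset xs) i"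
    if "inj f" for f :: "'x \<Rightarrow> 'a + 'b + 'c" and xs i
    using that by (induction xs) (auto simp: lookup_add lookup_single when_def inj_eq)
  have **: "lookup (\<Sum>i\<leftarrow>xs. Poly_Mapping.single (f i) (1::nat)) v = 0"
    if "v \<notin> range f" for f :: "'x \<Rightarrow> 'a + 'b + 'c" and xs v
    using that by (induction xs) (auto simp: lookup_add lookup_single when_def)
  show "lookup (word_monom xs ys zs) (Inl i) = count (mset xs) i"
    using *[of Inl xs i] **[of "Inl i" "\<lambda>j. Inr (Inl j)" ys] **[of "Inl i" "\<lambda>j. Inr (Inr j)" zs]
    by (simp add: word_monom_def lookup_add image_def)
  show "lookup (word_monom xs ys zs) (Inr (Inl j)) = count (mset ys) j"
    using *[of "\<lambda>j. Inr (Inl j)" ys j] **[of "Inr (Inl j)" Inl xs] **[of "Inr (Inl j)" "\<lambda>j. Inr (Inr j)" zs]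
    by (simp add: word_monom_def lookup_add image_def inj_def)
  show "lookup (word_monom xs ys zs) (Inr (Inr k)) = count (mset zs) k"
    using *[of "\<lambda>j. Inr (Inr j)" zs k] **[of "Inr (Inr k)" Inl xs] **[of "Inr (Inr k)" "\<lambda>j. Inr (Inl j)" ys]
    by (simp add: word_monom_def lookup_add image_def inj_def)
qed

lemma word_monom_eq_iff:
  "word_monom xs ys zs = word_monom xs' ys' zs' \<longleftrightarrow>
     mset xs = mset xs' \<and> mset ys = mset ys' \<and> mset zs = mset zs'" (is "?l \<longleftrightarrow> ?r")
proof
  assume ?l
  thus ?r by (metis lookup_word_monom multiset_eqI)
next
  assume ?r
  thus ?l by (intro poly_mapping_eqI, rename_tac v, case_tac v rule: sum.exhaust)
      (auto split: sum.splits, case_tac x2, auto)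
qed

lemma sum_count_mset: "(\<Sum>i\<in>(UNIV::'a::finite set). count M i) = size M"
  using size_multiset_overloaded_eq[of M] sum.mono_neutral_left[of UNIV "set_mset M" "count M"]
  by (simp add: not_in_iff)

lemma multideg_word_monom [simp]:
  "multideg (word_monom xs ys zs) = (length xs, length ys, length zs)"
  by (simp add: multideg_def sum_count_mset)

lemma ex_list_count:
  fixes f :: "'a::finite \<Rightarrow> nat"
  obtains xs where "\<And>i. count (mset xs) i = f i" "length xs = (\<Sum>i\<in>UNIV. f i)"
proof -
  have *: "count (\<Sum>i\<in>UNIV. replicate_mset (f i) i) j = f j" for j
    by (simp add: count_sum sum.delta)
  obtain xs where "mset xs = (\<Sum>i\<in>UNIV. replicate_mset (f i) i)" using ex_mset by blast
  with * have "\<And>i. count (mset xs) i = f i" by simp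
  moreover from this have "length xs = (\<Sum>i\<in>UNIV. f i)"
    using sum_count_mset[of "mset xs"] by simp
  ultimately show ?thesis using that by blast
qed

lemma monom_as_word:
  assumes "multideg m = (s, t, u)"
  obtains xs ys zs where "m = word_monom xs ys zs" "length xs = s" "length ys = t" "length zs = u"
proof -
  obtain xs where
    x: "\<And>i. count (mset xs) i = lookup m (Inl i)" "length xs = (\<Sum>i\<in>UNIV. lookup m (Inl i))"
    using ex_list_count[of "\<lambda>i. lookup m (Inl i)"] by blast
  obtain ys where
    y: "\<And>i. count (mset ys) i = lookup m (Inr (Inl i))" "length ys = (\<Sum>i\<in>UNIV. lookup m (Inr (Inl i)))"
    using ex_list_count[of "\<lambda>i. lookup m (Inr (Inl i))"] by blast
  obtain zs where
    z: "\<And>i. count (mset zs) i = lookup m (Inr (Inr i))" "length zs = (\<Sum>i\<in>UNIV. lookup m (Inr (Inr i)))"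
    using ex_list_count[of "\<lambda>i. lookup m (Inr (Inr i))"] by blast
  have "m = word_monom xs ys zs"
  proof (rule poly_mapping_eqI)
    fix v show "lookup m v = lookup (word_monom xs ys zs) v"
    proof (cases v)
      case (Inr w) thus ?thesis using x y z by (cases w) auto
    qed (use x in auto)
  qed
  thus ?thesis using that x y z assms by (auto simp: multideg_def)
qed

definition monoms :: "nat \<times> nat \<times> nat \<Rightarrow> ('a::finite, 'b::finite, 'c::finite) monom3 set" where
  "monoms D = {m. multideg m = D}"

lemma finite_monoms: "finite (monoms D :: ('a::finite, 'b::finite, 'c::finite) monom3 set)"
proof -
  obtain s t u where D: "D = (s, t, u)" by (cases D)
  have fin: "finite {xs :: 'x::finite list. length xs = n}" for n
    using finite_lists_length_eq[of "UNIV :: 'x set" n] by simp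
  have "(monoms D :: ('a, 'b, 'c) monom3 set) \<subseteq> (\<lambda>(xs, ys, zs). word_monom xs ys zs) `
          ({xs. length xs = s} \<times> {ys. length ys = t} \<times> {zs. length zs = u})"
  proof
    fix m :: "('a, 'b, 'c) monom3" assume "m \<in> monoms D"
    hence "multideg m = (s, t, u)" by (simp add: monoms_def D)
    then obtain xs ys zs where "m = word_monom xs ys zs" "length xs = s" "length ys = t" "length zs = u"
      by (rule monom_as_word)
    thus "m \<in> (\<lambda>(xs, ys, zs). word_monom xs ys zs) `
          ({xs. length xs = s} \<times> {ys. length ys = t} \<times> {zs. length zs = u})" by force
  qed
  thus ?thesis by (rule finite_subset) (intro finite_imageI finite_cartesian_product fin)
qed

lemma polys_of_deg_eq: "polys_of_deg s t u = supp_in (monoms (s, t, u))"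
  by (auto simp: polys_of_deg_def supp_in_def monoms_def)

lemma dim_polys_of_deg: "pm.dim (polys_of_deg s t u :: ('a::finite, 'b::finite, 'c::finite) poly3 set)
    = card (monoms (s, t, u) :: ('a, 'b, 'c) monom3 set)"
  by (simp add: polys_of_deg_eq dim_supp_in finite_monoms)

lemma multideg_0 [simp]: "multideg 0 = (0, 0, 0)"
  by (simp add: multideg_def)

lemma multideg_add:
  "multideg (m + m') = (case multideg m of (s, t, u) \<Rightarrow> case multideg m' of (s', t', u') \<Rightarrow>
     (s + s', t + t', u + u'))"
  by (simp add: multideg_def lookup_add sum.distrib)

lemma size_letters: "multideg m = (s, t, u) \<Longrightarrow> size (letters m) = s + t + u"
  by (auto elim!: monom_as_word)

text \<open>
  In a word of length \<open>s + t + u\<close>, the first \<open>s\<close> positions belong to block 0, the next \<open>t\<close> to block 1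
  and the last \<open>u\<close> to block 2, in accordance with \<open>var\<close>. Position by position, a
  monomial is a sum of variables in which the blocks play equal roles; this makes it
  possible to exchange letters between blocks.
\<close>

definition block :: "nat \<Rightarrow> nat \<Rightarrow> nat \<Rightarrow> nat" where
  "block s t k = (if k < s then 0 else if k < s + t then 1 else 2)"

lemma sum_append_nth:
  fixes F :: "nat \<Rightarrow> 'x \<Rightarrow> 'y::comm_monoid_add"
  shows "(\<Sum>k<length (xs @ ys). F k ((xs @ ys) ! k)) =
     (\<Sum>k<length xs. F k (xs ! k)) + (\<Sum>k<length ys. F (length xs + k) (ys ! k))"
proof (induction ys rule: rev_induct)
  case (snoc y ys)
  have "(\<Sum>k<length xs + length ys. F k ((xs @ ys @ [y]) ! k)) = (\<Sum>k<length xs + length ys. F k ((xs @ ys) ! k))"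
    by (intro sum.cong refl) (simp add: nth_append flip: append_assoc)
  moreover have "(\<Sum>k<length ys. F (length xs + k) ((ys @ [y]) ! k)) = (\<Sum>k<length ys. F (length xs + k) (ys ! k))"
    by (intro sum.cong refl) (simp add: nth_append)
  ultimately show ?case using snoc by (simp add: nth_append add.assoc)
qed simp

lemma sum_list_nth_lessThan: "(\<Sum>x\<leftarrow>xs. f x) = (\<Sum>k<length xs. f (xs ! k))"
  by (simp add: sum_list_sum_nth lessThan_atLeast0)

lemma word_monom_positions:
  fixes xs :: "'w list"
  shows "word_monom xs ys zs =
     (\<Sum>k<length (xs @ ys @ zs). var_monom (block (length xs) (length ys) k) ((xs @ ys @ zs) ! k))"
proof -
  let ?F = "\<lambda>k. var_monom (block (length xs) (length ys) k) :: 'w \<Rightarrow> _"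
  have "(\<Sum>k<length (xs @ ys @ zs). ?F k ((xs @ ys @ zs) ! k)) =
     (\<Sum>k<length xs. ?F k (xs ! k)) + ((\<Sum>k<length ys. ?F (length xs + k) (ys ! k)) +
       (\<Sum>k<length zs. ?F (length xs + (length ys + k)) (zs ! k)))"
    using sum_append_nth[of ?F xs "ys @ zs"] sum_append_nth[of "\<lambda>k. ?F (length xs + k)" ys zs]
    by (simp only:)
  also have "\<dots> = word_monom xs ys zs"
    by (simp add: word_monom_def sum_list_nth_lessThan block_def var_def add.assoc)
  finally show ?thesis ..
qed

definition cut_monom :: "nat \<Rightarrow> nat \<Rightarrow> 'w list \<Rightarrow> ('w, 'w, 'w) monom3" where
  "cut_monom s t w = word_monom (take s w) (take t (drop s w)) (drop (s + t) w)"

abbreviation word_poly :: "nat \<Rightarrow> nat \<Rightarrow> 'w list \<Rightarrow> ('w, 'w, 'w) poly3" where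
  "word_poly s t w \<equiv> unit_pm (cut_monom s t w)"

lemma take_drop_append3: "take s w @ take t (drop s w) @ drop (s + t) w = w"
  by (metis append_take_drop_id drop_drop add.commute)

lemma letters_cut_monom [simp]: "letters (cut_monom s t w) = mset w"
  unfolding cut_monom_def letters_word_monom take_drop_append3 ..

lemma multideg_cut_monom: "length w = s + t + u \<Longrightarrow> multideg (cut_monom s t w) = (s, t, u)"
  by (simp add: cut_monom_def)

lemma cut_monom_positions:
  assumes "length w = s + t + u"
  shows "cut_monom s t w = (\<Sum>k<length w. var_monom (block s t k) (w ! k))"
  unfolding cut_monom_def word_monom_positions take_drop_append3 using assms by simp

lemma cut_monom_append: "length xs = s \<Longrightarrow> length ys = t \<Longrightarrow> cut_monom s t (xs @ ys @ zs) = word_monom xs ys zs"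
  by (simp add: cut_monom_def)

lemma monom_as_cut_monom:
  assumes "multideg m = (s, t, u)"
  obtains w where "length w = s + t + u" "m = cut_monom s t w"
proof -
  obtain xs ys zs where "m = word_monom xs ys zs" "length xs = s" "length ys = t" "length zs = u"
    using assms by (rule monom_as_word)
  thus ?thesis using that[of "xs @ ys @ zs"] by (simp add: cut_monom_append)
qed

section \<open>The weights that define the limit ideal\<close>

definition letter_mset :: "'q option \<Rightarrow> 'q multiset" where
  "letter_mset x = (case x of None \<Rightarrow> {#} | Some a \<Rightarrow> {#a#})"

lemma letter_mset_simps [simp]: "letter_mset None = {#}" "letter_mset (Some a) = {#a#}"
  by (simp_all add: letter_mset_def)

text \<open>
  The monomial that arises when the coordinate with index 0 is put equal to 1.
\<close>

definition nonzero_letters :: "'q option multiset \<Rightarrow> 'q multiset" where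
  "nonzero_letters M = (\<Sum>x\<in>#M. letter_mset x)"

lemma nonzero_letters_simps [simp]:
  "nonzero_letters {#} = {#}"
  "nonzero_letters (add_mset x M) = letter_mset x + nonzero_letters M"
  "nonzero_letters (M + M') = nonzero_letters M + nonzero_letters M'"
  by (simp_all add: nonzero_letters_def)

lemma nonzero_letters_replicate_None [simp]: "nonzero_letters (replicate_mset n None) = {#}"
  by (induction n) auto

lemma nonzero_letters_decomp:
  "M = image_mset Some (nonzero_letters M) + replicate_mset (size M - size (nonzero_letters M)) None"
  "size (nonzero_letters M) \<le> size M"
proof -
  have "M = image_mset Some (nonzero_letters M) + replicate_mset (size M - size (nonzero_letters M)) None
     \<and> size (nonzero_letters M) \<le> size M"
  proof (induction M)
    case (add x M)
    hence le: "size (nonzero_letters M) \<le> size M" by simp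
    show ?case
    proof (cases x)
      case None
      thus ?thesis using add le by (auto simp: Suc_diff_le)
    next
      case (Some a)
      thus ?thesis using add le by auto
    qed
  qed simp
  thus "M = image_mset Some (nonzero_letters M) + replicate_mset (size M - size (nonzero_letters M)) None"
    "size (nonzero_letters M) \<le> size M" by blast+
qed

abbreviation somes :: "'q::finite cw_monom \<Rightarrow> 'q multiset" where
  "somes m \<equiv> nonzero_letters (letters m)"

text \<open>
  The functionals that extract from a polynomial in affine coordinates its constant
  term (\<open>None\<close>), the coefficient of \<open>x\<^sub>j\<close> (\<open>Some (Some j)\<close>) and the sum of the coefficients of
  all \<open>x\<^sub>a\<^sup>2\<close> (\<open>Some None\<close>), that is half its Laplacian at the origin.
\<close>

definition cw_weight :: "'q option option \<Rightarrow> 'q multiset \<Rightarrow> complex" where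
  "cw_weight i M = (case i of None \<Rightarrow> of_bool (M = {#})
     | Some None \<Rightarrow> of_bool (\<exists>a. M = {#a, a#})
     | Some (Some j) \<Rightarrow> of_bool (M = {#j#}))"

definition pivot :: "'q" where "pivot = (SOME j. True)"

text \<open>
  Monomials dual to the weights. For the Laplacian any square \<open>x\<^sub>a\<^sup>2\<close> would do; \<open>pivot\<close> singles out one.
\<close>

definition normal_letters :: "'q option option \<Rightarrow> 'q list" where
  "normal_letters i = (case i of None \<Rightarrow> [] | Some None \<Rightarrow> [pivot, pivot] | Some (Some j) \<Rightarrow> [j])"

definition normal_word :: "nat \<Rightarrow> 'q option option \<Rightarrow> 'q option list" where
  "normal_word d i = map Some (normal_letters i) @ replicate (d - length (normal_letters i)) None"

text \<open>
  In degrees 0 and 1 some of the weights vanish identically; the index set keeps those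
  whose dual monomial exists.
\<close>

definition normal_index :: "nat \<Rightarrow> 'q option option set" where
  "normal_index d = {i. length (normal_letters i) \<le> d}"

lemma nonzero_letters_normal_word [simp]:
  "nonzero_letters (mset (normal_word d i)) = mset (normal_letters i)"
  by (auto simp: normal_word_def normal_letters_def split: option.split)

lemma length_normal_word: "i \<in> normal_index d \<Longrightarrow> length (normal_word d i) = d"
  by (auto simp: normal_word_def normal_index_def)

lemma cw_weight_normal: "cw_weight i (mset (normal_letters j)) = of_bool (i = j)"
  by (auto simp: cw_weight_def normal_letters_def add_eq_conv_ex split: option.split)

lemma cw_weight_size: "size M \<noteq> length (normal_letters i) \<Longrightarrow> cw_weight i M = 0"
  by (auto simp: cw_weight_def normal_letters_def split: option.split)

section \<open>The prolongation argument\<close>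

lemma inj_matrix_if_trivial_kernel:
  fixes A :: "'a::field ^ 'n::finite ^ 'm::finite"
  assumes "\<And>z. A *v z = 0 \<Longrightarrow> z = 0"
  shows "inj ((*v) A)"
proof (rule injI)
  fix u v assume "A *v u = A *v v"
  hence "A *v (u - v) = 0" by (simp add: matrix_vector_mult_diff_distrib)
  from assms[OF this] show "u = v" by simp
qed

text \<open>
  The contraction of \<open>T_cw\<close> with a covector of coordinates \<open>(l, v)\<close>: the symmetric matrix with corner 0,
  border \<open>v\<close> and \<open>l\<close> times the identity as its remaining block.
\<close>

definition slice_comb :: "('q \<Rightarrow> complex) \<Rightarrow> complex \<Rightarrow> 'q option \<Rightarrow> 'q option \<Rightarrow> complex" where
  "slice_comb v l i j = (case i of
      None \<Rightarrow> (case j of None \<Rightarrow> 0 | Some b \<Rightarrow> v b)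
    | Some a \<Rightarrow> (case j of None \<Rightarrow> v a | Some b \<Rightarrow> l * of_bool (a = b)))"

lemma slice_comb_simps [simp]:
  "slice_comb v l None None = 0"
  "slice_comb v l None (Some b) = v b"
  "slice_comb v l (Some a) None = v a"
  "slice_comb v l (Some a) (Some b) = l * of_bool (a = b)"
  by (simp_all add: slice_comb_def)

lemma slice_comb_sum:
  "slice_comb (\<lambda>a. \<Sum>n\<in>N. c n * v n a) (\<Sum>n\<in>N. c n * l n) i j = (\<Sum>n\<in>N. c n * slice_comb (v n) (l n) i j)"
  by (cases i; cases j) (auto simp: sum_distrib_left sum_distrib_right mult.assoc)

text \<open>
  Think of \<open>F n\<close> as a basis of the annihilator in degree \<open>(2,1,0)\<close>: tensors symmetric in the first two
  arguments whose slices are combinations of the slices of \<open>T_cw\<close> and of one matrix \<open>X\<close>, the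
  coefficient of \<open>X\<close> in a matrix \<open>h\<close> being \<open>mu h\<close>. A tensor of this kind is determined by the coefficient of the
  identity block in its slice at index 0 and by the coefficients of \<open>X\<close> in all its slices. These are \<open>q + 2\<close>
  coordinates on a space of dimension \<open>q + 2\<close>, so they take arbitrary values. The tensor for which
  only the coefficient of \<open>X\<close> in slice \<open>g\<close> is nonzero shows, by symmetry, that \<open>X\<close> vanishes
  at \<open>(0, a)\<close> and is scalar away from row 0, at all rows \<open>a \<noteq> g\<close>; now vary \<open>g\<close>.
  Both this step and the variation of \<open>g\<close> need a third letter besides two given ones.
\<close>

lemma prolongation_forces_corner:
  fixes F :: "'q::finite option option \<Rightarrow> 'q option \<Rightarrow> 'q option \<Rightarrow> 'q option \<Rightarrow> complex"
    and X :: "'q option \<Rightarrow> 'q option \<Rightarrow> complex" and p :: 'q and i0 j0 :: "'q option"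
  defines "mu \<equiv> \<lambda>h :: 'q option \<Rightarrow> 'q option \<Rightarrow> complex.
             h i0 j0 - slice_comb (\<lambda>a. h (Some a) None) (h (Some p) (Some p)) i0 j0"
  assumes q: "CARD('q) > 2"
    and sym: "\<And>n i j k. F n i j k = F n j i k"
    and ind: "\<And>a. (\<And>i j k. (\<Sum>n\<in>UNIV. a n * F n i j k) = 0) \<Longrightarrow> (\<And>n. a n = 0)"
    and form: "\<And>n i j k. F n i j k =
      slice_comb (\<lambda>a. F n i (Some a) None) (F n i (Some p) (Some p)) j k + mu (F n i) * X j k"
    and X0: "\<And>a. X (Some a) None = 0" and Xp: "X (Some p) (Some p) = 0"
    and ij: "(i, j) \<noteq> (None, None)"
  shows "X i j = 0"
proof -
  note third = ex_third_letter[OF q]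
  define G where "G = (\<lambda>(a :: complex ^ 'q option option) i j k. \<Sum>n\<in>UNIV. a $ n * F n i j k)"
  have Gsym: "G a i j k = G a j i k" for a i j k
    unfolding G_def by (intro sum.cong refl) (simp add: sym[of _ i j k])
  have Gmu: "mu (G a i) = (\<Sum>n\<in>UNIV. a $ n * mu (F n i))" for a i
    by (simp add: mu_def G_def slice_comb_sum algebra_simps sum_subtractf)
  have Gform: "G a i j k = slice_comb (\<lambda>b. G a i (Some b) None) (G a i (Some p) (Some p)) j k + mu (G a i) * X j k"
    for a i j k
  proof -
    have "G a i j k = (\<Sum>n\<in>UNIV. a $ n * (slice_comb (\<lambda>a. F n i (Some a) None) (F n i (Some p) (Some p)) j k + mu (F n i) * X j k))"
      unfolding G_def by (intro sum.cong refl arg_cong2[of _ _ _ _ "(*)"]) (rule form)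
    also have "\<dots> = slice_comb (\<lambda>b. G a i (Some b) None) (G a i (Some p) (Some p)) j k + mu (G a i) * X j k"
      unfolding Gmu unfolding G_def
      by (simp add: slice_comb_sum distrib_left sum.distrib sum_distrib_right mult.assoc)
    finally show ?thesis .
  qed
  \<comment> \<open>The matrix of the \<open>q + 2\<close> coordinates in the basis \<open>F\<close>: at index \<open>None\<close> the
      coefficient of the identity block in the slice at 0, at index \<open>Some x\<close> the coefficient of \<open>X\<close> in slice \<open>x\<close>.\<close>
  define A :: "complex ^ 'q option option ^ 'q option option" where
    "A = (\<chi> i n. case i of None \<Rightarrow> F n None (Some p) (Some p)
                | Some x \<Rightarrow> mu (F n x))"
  have A: "(A *v a) $ None = G a None (Some p) (Some p)" "(A *v a) $ Some x = mu (G a x)" for a x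
    by (simp_all add: matrix_vector_mult_def A_def G_def mult.commute Gmu)
       (simp add: Gmu[unfolded G_def] mult.commute)
  have "inj ((*v) A)"
  proof (rule inj_matrix_if_trivial_kernel)
    show "a = 0" if a0: "A *v a = 0" for a
    proof -
      have l0: "G a None (Some p) (Some p) = 0" using A(1)[of a] a0 by simp
      have m0: "mu (G a x) = 0" for x using A(2)[of a x] a0 by simp
      note f = Gform[of a, unfolded m0, simplified]
      \<comment> \<open>All slices are combinations of slices of \<open>T_cw\<close>. By symmetry the entries of the slice
          at 0 and the borders of the others vanish, and then also the identity blocks.\<close>
      have c1: "G a (Some b) None None = 0" for b using f[of "Some b" None None] by simp
      have c2: "G a None j k = 0" for j k
      proof -
        have "G a None (Some b) None = 0" for b using Gsym[of a None "Some b" None] c1 by simp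
        moreover have "G a None None (Some b) = G a None (Some b) None" for b
          using f[of None None "Some b"] by simp
        moreover have "G a None None None = 0" using f[of None None None] by simp
        moreover have "G a None (Some b) (Some c) = 0" for b c
          using f[of None "Some b" "Some c"] l0 by simp
        ultimately show ?thesis by (cases j; cases k) auto
      qed
      have c3: "G a (Some b) (Some c) None = 0" for b c
        using f[of "Some b" None "Some c"] Gsym[of a "Some b" None "Some c"] c2 by simp
      have c4: "G a (Some b) (Some p) (Some p) = 0" for b
      proof -
        obtain c where c: "c \<noteq> b" using third by blast
        have "G a (Some b) (Some p) (Some p) = G a (Some b) (Some c) (Some c)"
          using f[of "Some b" "Some c" "Some c"] by simp
        also have "\<dots> = G a (Some c) (Some b) (Some c)" by (rule Gsym)
        also have "\<dots> = 0" using f[of "Some c" "Some b" "Some c"] c by simp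
        finally show ?thesis .
      qed
      have "G a i j k = 0" for i j k
        using f[of i j k] c2 c3 c4 by (cases i; cases j; cases k) auto
      hence "a $ n = 0" for n
        using ind[of "\<lambda>n. a $ n"] unfolding G_def by blast
      thus "a = 0" by (simp add: vec_eq_iff)
    qed
  qed
  hence surj: "surj ((*v) A)"
    by (intro vec.linear_inj_imp_surj matrix_vector_mul_linear_gen)
  have key: "X None (Some a) = 0 \<and> (\<forall>b. X (Some a) (Some b) = - l g * of_bool (a = b))"
    if l: "l = (\<lambda>g. G (SOME v. A *v v = axis (Some (Some g)) 1) (Some g) (Some p) (Some p))"
    and ag: "a \<noteq> g" for a g l
  proof -
    define v where "v = (SOME v. A *v v = axis (Some (Some g)) 1)"
    have v: "A *v v = axis (Some (Some g)) 1"
      unfolding v_def by (rule someI_ex) (use surj in \<open>metis surjD\<close>)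
    have l0: "G v None (Some p) (Some p) = 0" using A(1)[of v] v by (simp add: axis_def)
    have mx: "mu (G v x) = of_bool (x = Some g)" for x
      using A(2)[of v x, symmetric] v by (simp add: axis_def)
    have m: "mu (G v None) = 0" "mu (G v (Some b)) = of_bool (b = g)" for b
      by (simp_all add: mx)
    note f = Gform[of v]
    \<comment> \<open>Compare entries with their mirror images under exchange of the first two arguments, starting
        from the slice at 0, where neither \<open>X\<close> nor the identity block occurs.\<close>
    have n2: "G v None (Some b) (Some c) = 0" for b c
      using f[of None "Some b" "Some c"] l0 m(1) by simp
    have n3: "G v (Some b) None (Some c) = 0" for b c
      using Gsym[of v "Some b" None "Some c"] n2 by simp
    have n4: "G v (Some b) (Some c) None = - of_bool (b = g) * X None (Some c)" for b c
      using f[of "Some b" None "Some c"] n3 m(2)[of b] by (simp add: eq_neg_iff_add_eq_0)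
    have n5: "X None (Some a) = 0"
      using Gsym[of v "Some g" "Some a" None] n4[of g a] n4[of a g] ag by simp
    have n6: "G v (Some b) (Some c) (Some d) = 0" if "b \<noteq> g" for b c d
    proof -
      have bf: "G v (Some b') (Some c) (Some d) = G v (Some b') (Some p) (Some p) * of_bool (c = d)"
        if "b' \<noteq> g" for b' c d
        using f[of "Some b'" "Some c" "Some d"] m(2)[of b'] that by simp
      obtain e where e: "e \<noteq> b" "e \<noteq> g" using third by blast
      have "G v (Some b) (Some p) (Some p) = G v (Some b) (Some e) (Some e)" using bf[OF that, of e e] by simp
      also have "\<dots> = G v (Some e) (Some b) (Some e)" by (rule Gsym)
      also have "\<dots> = 0" using bf[OF e(2), of b e] e(1) by simp
      finally show ?thesis using bf[OF that, of c d] by simp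
    qed
    have lg: "l g = G v (Some g) (Some p) (Some p)" by (simp add: l v_def)
    have "X (Some a) (Some b) = - l g * of_bool (a = b)" for b
    proof -
      have "G v (Some g) (Some a) (Some b) = 0"
        using Gsym[of v "Some g" "Some a" "Some b"] n6[OF ag, of g b] by simp
      hence "l g * of_bool (a = b) + X (Some a) (Some b) = 0"
        using f[of "Some g" "Some a" "Some b"] m(2)[of g] by (simp add: lg)
      thus ?thesis by (simp only: add_eq_0_iff mult_minus_left)
    qed
    with n5 show ?thesis by blast
  qed
  define l where "l = (\<lambda>g. G (SOME v. A *v v = axis (Some (Some g)) 1) (Some g) (Some p) (Some p))"
  have k1: "X None (Some a) = 0" for a
  proof -
    obtain g where "a \<noteq> g" using third[of a a] by metis
    from key[OF l_def this] show ?thesis ..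
  qed
  have k2: "X (Some a) (Some b) = 0" for a b
  proof -
    obtain g where g: "g \<noteq> a" "g \<noteq> p" using third by blast
    from conjunct2[OF key[OF l_def g(2)[symmetric]], rule_format, of p] Xp
    have "- l g * of_bool (p = p) = 0" by simp
    hence "l g = 0" by simp
    moreover have "X (Some a) (Some b) = - l g * of_bool (a = b)"
      by (rule conjunct2[OF key[OF l_def g(1)[symmetric]], rule_format])
    ultimately show ?thesis by simp
  qed
  show ?thesis using ij k1 k2 X0 by (cases i; cases j) auto
qed

section \<open>The limit ideal\<close>

abbreviation normal_kernel ::
  "nat \<Rightarrow> nat \<Rightarrow> nat \<Rightarrow> ('q::finite option option \<Rightarrow> 'q multiset \<Rightarrow> complex) \<Rightarrow> 'q cw_poly set" where
  "normal_kernel s t u w \<equiv>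
     weight_kernel (normal_index (s + t + u)) (monoms (s, t, u)) (\<lambda>i m. w i (somes m))"

lemma finite_normal_index [simp]: "finite (normal_index d :: 'q::finite option option set)"
  by (rule finite_subset[OF subset_UNIV]) simp

lemma length_normal_letters_le: "length (normal_letters i) \<le> 2"
  by (auto simp: normal_letters_def split: option.split)

lemma normal_index_UNIV: "2 \<le> d \<Longrightarrow> normal_index d = UNIV"
  by (auto simp: normal_index_def intro: order_trans[OF length_normal_letters_le])

lemma normal_dual_system:
  fixes w :: "'q::finite option option \<Rightarrow> 'q multiset \<Rightarrow> complex"
  assumes "\<And>i j. w i (mset (normal_letters j)) = of_bool (i = j)"
  shows "dual_system (normal_index (s + t + u)) (monoms (s, t, u))
     (\<lambda>i. cut_monom s t (normal_word (s + t + u) i)) (\<lambda>i m. w i (somes m))"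
  unfolding dual_system_def using assms
  by (auto simp: monoms_def multideg_cut_monom length_normal_word)

lemmas cw_dual_system = normal_dual_system[of cw_weight, OF cw_weight_normal]

lemma somes_size: "multideg m = (s, t, u) \<Longrightarrow> size (somes m) \<le> s + t + u"
  using nonzero_letters_decomp(2)[of "letters m"] size_letters by metis

lemma low_degree_monoms_normal:
  assumes "s + t + u \<le> 1"
  shows "monoms (s, t, u) \<subseteq> (\<lambda>i. cut_monom s t (normal_word (s + t + u) i)) ` normal_index (s + t + u)"
    (is "_ \<subseteq> ?nm ` ?I")
proof
  fix m :: "'a cw_monom" assume "m \<in> monoms (s, t, u)"
  then obtain w where w: "length w = s + t + u" "m = cut_monom s t w"
    by (auto simp: monoms_def elim: monom_as_cut_monom)
  show "m \<in> ?nm ` ?I"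
  proof (cases w)
    case Nil
    thus ?thesis using w by (intro image_eqI[of _ _ None]) (auto simp: normal_word_def normal_letters_def normal_index_def)
  next
    case (Cons x w')
    hence "length w' = 0"
    proof -
      have "length w \<le> 1" using w(1) assms by linarith
      thus ?thesis using Cons by simp
    qed
    hence d1: "w = [x]" "s + t + u = 1" using w(1) Cons by auto
    show ?thesis
    proof (cases x)
      case None
      thus ?thesis using w d1 by (intro image_eqI[of _ _ None]) (auto simp: normal_word_def normal_letters_def normal_index_def)
    next
      case (Some a)
      thus ?thesis using w d1
        by (intro image_eqI[of _ _ "Some (Some a)"]) (auto simp: normal_word_def normal_letters_def normal_index_def)
    qed
  qed
qed

text \<open>
  The codimension prescribed by the generic Hilbert function for \<open>q + 2\<close> points is the number of normal
  monomials: in degree at least 2 there are \<open>q + 2\<close> of them, and in lower degree every monomial is normal.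
\<close>

lemma card_normal_index:
  "card (normal_index (s + t + u) :: 'q::finite option option set) =
     min (CARD('q) + 2) (card (monoms (s, t, u) :: 'q cw_monom set))"
proof -
  let ?d = "s + t + u" and ?S = "monoms (s, t, u) :: 'q cw_monom set"
  let ?I = "normal_index ?d :: 'q option option set"
  let ?nm = "\<lambda>i. cut_monom s t (normal_word ?d i) :: 'q cw_monom"
  have "dual_system ?I ?S ?nm (\<lambda>i m. cw_weight i (somes m))" by (rule cw_dual_system)
  from card_dual_complement[OF this finite_monoms] have le: "card ?I \<le> card ?S" by linarith
  have U: "card (UNIV :: 'q option option set) = CARD('q) + 2" by simp
  show ?thesis
  proof (cases "2 \<le> ?d")
    case True
    thus ?thesis using le U by (simp add: normal_index_UNIV)
  next
    case False
    have "?S \<subseteq> ?nm ` ?I" by (rule low_degree_monoms_normal) (use False in simp)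
    hence "card ?S \<le> card (?nm ` ?I)" by (intro card_mono) auto
    also have "\<dots> \<le> card ?I" by (rule card_image_le) simp
    finally have "card ?S = card ?I" using le by simp
    moreover have "card ?I \<le> card (UNIV :: 'q option option set)" by (intro card_mono) auto
    ultimately show ?thesis using U by simp
  qed
qed

lemma generic_hilbert_functionI:
  fixes J :: "'q::finite cw_poly set"
  assumes "\<And>i j. w i (mset (normal_letters j)) = of_bool (i = j)"
    and "\<And>s t u. ideal_part J s t u =
           normal_kernel s t u w"
  shows "has_generic_hilbert_function (CARD('q) + 2) J"
  unfolding has_generic_hilbert_function_def dim_polys_of_deg assms(2)
    card_normal_index[symmetric]
  using dim_weight_kernel[OF normal_dual_system[of w, OF assms(1)] finite_monoms] by blast

text \<open>
  Membership is tested in each multidegree separately, which makes the ideal homogeneous by definition.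
\<close>

definition cw_ideal :: "'q::finite cw_poly set" where
  "cw_ideal = {p. \<forall>D i. wsum p (\<lambda>m. of_bool (multideg m = D) * cw_weight i (somes m)) = 0}"

lemma ideal_part_cw_ideal:
  "ideal_part cw_ideal s t u =
     normal_kernel s t u cw_weight"
proof (intro equalityI subsetI)
  fix p :: "'a cw_poly"
  assume p: "p \<in> ideal_part cw_ideal s t u"
  hence S: "p \<in> supp_in (monoms (s, t, u))" by (simp add: ideal_part_def polys_of_deg_eq)
  have "wsum p (\<lambda>m. cw_weight i (somes m)) = 0" for i
  proof -
    have "wsum p (\<lambda>m. of_bool (multideg m = (s, t, u)) * cw_weight i (somes m)) = 0"
      using p by (auto simp: ideal_part_def cw_ideal_def)
    also have "wsum p (\<lambda>m. of_bool (multideg m = (s, t, u)) * cw_weight i (somes m)) =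
        wsum p (\<lambda>m. cw_weight i (somes m))"
      by (rule wsum_weight_cong) (use S in \<open>auto simp: supp_in_def monoms_def\<close>)
    finally show ?thesis .
  qed
  with S show "p \<in> normal_kernel s t u cw_weight"
    by (simp add: weight_kernel_def)
next
  fix p :: "'a cw_poly"
  assume p: "p \<in> normal_kernel s t u cw_weight"
  hence S: "p \<in> supp_in (monoms (s, t, u))" by (simp add: weight_kernel_def)
  have "wsum p (\<lambda>m. of_bool (multideg m = D) * cw_weight i (somes m)) = 0" for D i
  proof (cases "D = (s, t, u) \<and> i \<in> normal_index (s + t + u)")
    case True
    have "wsum p (\<lambda>m. of_bool (multideg m = D) * cw_weight i (somes m)) = wsum p (\<lambda>m. cw_weight i (somes m))"
      by (rule wsum_weight_cong) (use S True in \<open>auto simp: supp_in_def monoms_def\<close>)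
    thus ?thesis using p True by (simp add: weight_kernel_def)
  next
    case False
    have "wsum p (\<lambda>m. of_bool (multideg m = D) * cw_weight i (somes m)) = wsum p (\<lambda>m. 0 * 0)"
    proof (rule wsum_weight_cong)
      fix m assume "m \<in> keys p"
      hence m: "multideg m = (s, t, u)" using S by (auto simp: supp_in_def monoms_def)
      show "of_bool (multideg m = D) * cw_weight i (somes m) = 0 * 0"
        using False m somes_size[OF m] cw_weight_size[of "somes m" i]
        by (auto simp: normal_index_def)
    qed
    thus ?thesis by (simp add: wsum_def)
  qed
  with S show "p \<in> ideal_part cw_ideal s t u"
    by (simp add: ideal_part_def polys_of_deg_eq cw_ideal_def)
qed

lemma sum_of_singles: "p = (\<Sum>m\<in>keys p. Poly_Mapping.single m (lookup p m))"
  for p :: "'x \<Rightarrow>\<^sub>0 complex"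
proof -
  have "p = (\<Sum>m\<in>keys p. pm_scale (lookup p m) (unit_pm m))"
    by (rule pm_expand) (auto simp: supp_in_def)
  also have "\<dots> = (\<Sum>m\<in>keys p. Poly_Mapping.single m (lookup p m))"
    by (intro sum.cong refl poly_mapping_eqI) (simp add: lookup_single when_def)
  finally show ?thesis .
qed

lemma wsum_monom_mult:
  fixes p :: "('v \<Rightarrow>\<^sub>0 nat) \<Rightarrow>\<^sub>0 complex"
  shows "wsum (Poly_Mapping.single m c * p) g = c * wsum p (\<lambda>m'. g (m + m'))"
proof -
  have "Poly_Mapping.single m c * p =
      (\<Sum>m'\<in>keys p. Poly_Mapping.single (m + m') (c * lookup p m'))"
    by (subst sum_of_singles[of p]) (simp add: sum_distrib_left mult_single)
  thus ?thesis by (simp add: wsum_sum wsum_def[of p] sum_distrib_left mult.assoc)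
qed

text \<open>
  The Leibniz rule at the origin: composing one of the functionals with multiplication by a monomial
  gives again one of the functionals or zero. Therefore their common kernel is an ideal.
\<close>

lemma cw_weight_shift:
  "(\<forall>M'. cw_weight i (M + M') = 0) \<or> (\<exists>k. \<forall>M'. cw_weight i (M + M') = cw_weight k M')"
proof -
  have sum0: "M + M' = {#} \<longleftrightarrow> M = {#} \<and> M' = {#}" for M' by simp
  have sum1: "M + M' = {#a#} \<longleftrightarrow> M = {#} \<and> M' = {#a#} \<or> M = {#a#} \<and> M' = {#}" for M' a
    by (auto simp: union_is_single)
  have sum2: "(\<exists>a. M + M' = {#a, a#}) \<longleftrightarrow> M = {#} \<and> (\<exists>a. M' = {#a, a#}) \<or>
      (\<exists>a. M = {#a#} \<and> M' = {#a#}) \<or> (\<exists>a. M = {#a, a#}) \<and> M' = {#}" for M'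
  proof -
    have "M + M' = {#a, a#} \<longleftrightarrow> M = {#} \<and> M' = {#a, a#} \<or>
      (M = {#a#} \<and> M' = {#a#}) \<or> M = {#a, a#} \<and> M' = {#}" for a
    proof
      assume e: "M + M' = {#a, a#}"
      hence sz: "size M + size M' = 2" by (metis size_union size_add_mset size_empty numeral_2_eq_2)
      have sub: "set_mset M \<subseteq> {a}" "set_mset M' \<subseteq> {a}"
        using e by (metis Un_upper1 Un_upper2 set_mset_union set_mset_add_mset_insert set_mset_empty insert_absorb2)+
      have rep: "N = replicate_mset (size N) a" if "set_mset N \<subseteq> {a}" for N
        using that by (metis set_mset_subset_singletonD)
      have "size M = 0 \<or> size M = 1 \<or> size M = 2" using sz by linarith
      thus "M = {#} \<and> M' = {#a, a#} \<or> (M = {#a#} \<and> M' = {#a#}) \<or> M = {#a, a#} \<and> M' = {#}"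
      proof (elim disjE)
        assume "size M = 0"
        thus ?thesis using e by simp
      next
        assume 1: "size M = 1"
        hence "size M' = 1" using sz by simp
        thus ?thesis using rep[OF sub(1)] rep[OF sub(2)] 1 by simp
      next
        assume 2: "size M = 2"
        hence "size M' = 0" using sz by simp
        thus ?thesis using e by simp
      qed
    qed auto
    thus ?thesis by (simp only:) blast
  qed
  consider "i = None" | "i = Some None" | j where "i = Some (Some j)" by (metis not_None_eq)
  thus ?thesis
  proof cases
    case 1
    show ?thesis
    proof (cases "M = {#}")
      case True thus ?thesis by auto
    next
      case False thus ?thesis using 1 by (auto simp: cw_weight_def)
    qed
  next
    case (3 j)
    consider "M = {#}" | "M = {#j#}" | "M \<noteq> {#}" "M \<noteq> {#j#}" by blast
    thus ?thesis
    proof cases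
      case 2 thus ?thesis using 3 by (intro disjI2 exI[of _ None]) (simp add: cw_weight_def sum1)
    next
      case 1 thus ?thesis by auto
    next
      case 3
      thus ?thesis using \<open>i = Some (Some j)\<close> by (intro disjI1) (simp add: cw_weight_def sum1)
    qed
  next
    case 2
    consider "M = {#}" | j where "M = {#j#}" | j where "M = {#j, j#}" |
      "M \<noteq> {#}" "\<And>j. M \<noteq> {#j#}" "\<And>j. M \<noteq> {#j, j#}" by blast
    thus ?thesis
    proof cases
      case 1 thus ?thesis by auto
    next
      case (2 j)
      thus ?thesis using \<open>i = Some None\<close>
        by (intro disjI2 exI[of _ "Some (Some j)"]) (auto simp: cw_weight_def add_eq_conv_ex)
    next
      case (3 j)
      thus ?thesis using \<open>i = Some None\<close>
        by (intro disjI2 exI[of _ None]) (auto simp: cw_weight_def add_eq_conv_ex)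
    next
      case 4
      thus ?thesis using \<open>i = Some None\<close>
        by (intro disjI1) (simp add: cw_weight_def sum2)
    qed
  qed
qed

lemma cw_ideal_monom_mult:
  assumes "p \<in> cw_ideal"
  shows "Poly_Mapping.single m c * p \<in> cw_ideal"
proof -
  have "wsum p (\<lambda>m'. of_bool (multideg (m + m') = D) * cw_weight i (somes (m + m'))) = 0" for D i
  proof (cases "(\<forall>M'. cw_weight i (somes m + M') = 0) \<or> (\<forall>m'. multideg (m + m') \<noteq> D)")
    case True
    hence "of_bool (multideg (m + m') = D) * cw_weight i (somes (m + m')) = 0" for m'
      by auto
    hence "wsum p (\<lambda>m'. of_bool (multideg (m + m') = D) * cw_weight i (somes (m + m'))) = wsum p (\<lambda>_. 0)"
      by (intro wsum_weight_cong)
    thus ?thesis by (simp add: wsum_def)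
  next
    case False
    then obtain k m0 where k: "\<And>M'. cw_weight i (somes m + M') = cw_weight k M'"
      and m0: "multideg (m + m0) = D" using cw_weight_shift[of i "somes m"] by blast
    have "multideg (m + m') = D \<longleftrightarrow> multideg m' = multideg m0" for m'
      unfolding m0[symmetric] by (simp add: multideg_add split: prod.splits)
    hence "wsum p (\<lambda>m'. of_bool (multideg (m + m') = D) * cw_weight i (somes (m + m'))) =
       wsum p (\<lambda>m'. of_bool (multideg m' = multideg m0) * cw_weight k (somes m'))"
      by (intro wsum_weight_cong) (simp add: k)
    also have "\<dots> = 0" using assms by (simp only: cw_ideal_def mem_Collect_eq)
    finally show ?thesis .
  qed
  thus ?thesis by (simp add: cw_ideal_def wsum_monom_mult)
qed

lemma lookup_component:
  "lookup (component s t u p) m = of_bool (multideg m = (s, t, u)) * lookup p m"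
proof -
  have "lookup (component s t u p) m =
     (\<Sum>m'\<in>{m \<in> keys p. multideg m = (s, t, u)}. if m' = m then lookup p m else 0)"
    unfolding component_def lookup_sum by (intro sum.cong) (auto simp: lookup_single when_def)
  thus ?thesis by (auto simp: in_keys_iff)
qed

lemma wsum_component:
  "wsum (component s t u p) g = wsum p (\<lambda>m. of_bool (multideg m = (s, t, u)) * g m)"
proof -
  have "keys (component s t u p) \<subseteq> keys p"
    by (auto simp: in_keys_iff lookup_component)
  thus ?thesis
    by (subst wsum_superset[of "keys p"])
       (auto simp: wsum_def[of p] lookup_component intro!: sum.cong)
qed

lemma graded_ideal_cw_ideal: "graded_ideal (cw_ideal :: 'q::finite cw_poly set)"
proof -
  have add: "p + p' \<in> cw_ideal" if "p \<in> cw_ideal" "p' \<in> cw_ideal"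
    for p p' :: "'q cw_poly"
    using that by (simp add: cw_ideal_def wsum_add)
  have zero: "0 \<in> (cw_ideal :: 'q cw_poly set)" by (simp add: cw_ideal_def)
  have "f * p \<in> cw_ideal" if p: "p \<in> cw_ideal" for f p :: "'q cw_poly"
  proof -
    have "(\<Sum>m\<in>A. Poly_Mapping.single m (lookup f m)) * p \<in> cw_ideal" if "finite A" for A
      using that by (induction A) (auto simp: distrib_right zero intro!: add cw_ideal_monom_mult p)
    thus ?thesis by (subst sum_of_singles[of f]) simp
  qed
  moreover have "component s t u p \<in> cw_ideal" if "p \<in> cw_ideal"
    for s t u and p :: "'q cw_poly"
  proof -
    have "wsum p (\<lambda>m. of_bool (multideg m = (s, t, u)) * (of_bool (multideg m = D) * cw_weight i (somes m))) = 0" for D i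
    proof (cases "D = (s, t, u)")
      case True
      have "wsum p (\<lambda>m. of_bool (multideg m = D) * (of_bool (multideg m = D) * cw_weight i (somes m)))
          = wsum p (\<lambda>m. of_bool (multideg m = D) * cw_weight i (somes m))"
        by (rule wsum_weight_cong) simp
      thus ?thesis using that True by (simp add: cw_ideal_def)
    next
      case False
      have "wsum p (\<lambda>m. of_bool (multideg m = (s, t, u)) * (of_bool (multideg m = D) * cw_weight i (somes m)))
          = wsum p (\<lambda>m. 0)"
        by (rule wsum_weight_cong) (use False in auto)
      thus ?thesis by (simp add: wsum_def)
    qed
    thus ?thesis by (simp add: cw_ideal_def wsum_component)
  qed
  ultimately show ?thesis using add zero unfolding graded_ideal_def by blast
qed

lemma graded_ideal_sum:
  assumes "graded_ideal I" "\<And>a. a \<in> A \<Longrightarrow> f a \<in> I"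
  shows "sum f A \<in> I"
  using assms(2) assms(1) by (induction A rule: infinite_finite_induct) (auto simp: graded_ideal_def)

lemma graded_ideal_subset:
  assumes "graded_ideal I" "graded_ideal I'" "\<And>s t u. ideal_part I s t u \<subseteq> ideal_part I' s t u"
  shows "I \<subseteq> I'"
proof
  fix p assume p: "p \<in> I"
  have "p = (\<Sum>(s, t, u)\<in>multideg ` keys p. component s t u p)"
  proof (rule poly_mapping_eqI)
    fix m
    have "(\<Sum>D\<in>multideg ` keys p. lookup (case D of (s, t, u) \<Rightarrow> component s t u p) m)
      = (\<Sum>D\<in>multideg ` keys p. if multideg m = D then lookup p m else 0)"
      by (intro sum.cong) (auto simp: lookup_component)
    also have "\<dots> = lookup p m"
      by (auto simp: in_keys_iff)
    finally show "lookup p m = lookup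
        (\<Sum>(s, t, u)\<in>multideg ` keys p. component s t u p) m"
      by (simp add: lookup_sum)
  qed
  moreover have "component s t u p \<in> I'" for s t u
  proof -
    have "component s t u p \<in> polys_of_deg s t u"
      by (auto simp: polys_of_deg_def in_keys_iff lookup_component)
    moreover have "component s t u p \<in> I" using p assms(1) by (auto simp: graded_ideal_def)
    ultimately show ?thesis using assms(3)[of s t u] by (auto simp: ideal_part_def)
  qed
  ultimately show "p \<in> I'"
    by (metis (mono_tags, lifting) graded_ideal_sum[OF assms(2)] case_prod_beta)
qed

lemma graded_ideal_eqI:
  assumes "graded_ideal I" "graded_ideal I'" "\<And>s t u. ideal_part I s t u = ideal_part I' s t u"
  shows "I = I'"
  using graded_ideal_subset[of I I'] graded_ideal_subset[of I' I] assms by blast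

section \<open>The tensor\<close>

definition cw_coeff :: "'q option \<Rightarrow> 'q option \<Rightarrow> 'q option \<Rightarrow> complex" where
  "cw_coeff i j k = cw_weight (Some None) (letter_mset i + letter_mset j + letter_mset k)"

lemma cw_coeff_simps [simp]:
  "cw_coeff None None k = 0" "cw_coeff None j None = 0" "cw_coeff i None None = 0"
  "cw_coeff None (Some a) (Some b) = of_bool (a = b)"
  "cw_coeff (Some a) None (Some b) = of_bool (a = b)"
  "cw_coeff (Some a) (Some b) None = of_bool (a = b)"
  "cw_coeff (Some a) (Some b) (Some c) = 0"
  by (cases i; cases j; cases k;
      auto simp: cw_coeff_def cw_weight_def letter_mset_def add_eq_conv_ex)+

text \<open>
  As a symmetric tensor, \<open>T_cw\<close> is the product of \<open>e\<^sub>0\<close> with the quadric \<open>Q\<close>, which is the functional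
  with weight \<open>cw_weight (Some None)\<close> in degree \<open>(1,1,1)\<close>.
\<close>

lemma T_cw_nth: "T_cw $ i $ j $ k = cw_coeff i j k"
  by (cases i; cases j; cases k)
     (auto simp: T_cw_def tensor3_def axis_def sum.distrib if_distrib[of "(*) _"] cong: if_cong)

lemma tensor_perp_T_cw:
  "tensor_perp T_cw = {p \<in> polys_of_deg 1 1 1. wsum p (\<lambda>m. cw_weight (Some None) (somes m)) = 0}"
proof -
  have "(\<Sum>i\<in>UNIV. \<Sum>j\<in>UNIV. \<Sum>k\<in>UNIV. lookup p (word_monom [i] [j] [k]) * T_cw $ i $ j $ k)
      = wsum p (\<lambda>m. cw_weight (Some None) (somes m))" if p: "p \<in> polys_of_deg 1 1 1"
    for p :: "'a cw_poly"
  proof -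
    let ?f = "\<lambda>(i, j, k). word_monom [i] [j] [k] :: 'a cw_monom"
    have inj: "inj ?f" by (auto simp: inj_def word_monom_eq_iff)
    have "monoms (1, 1, 1) \<subseteq> range ?f"
    proof
      fix m :: "'a cw_monom"
      assume "m \<in> monoms (1, 1, 1)"
      hence "multideg m = (1, 1, 1)" by (simp add: monoms_def)
      then obtain xs ys zs where "m = word_monom xs ys zs" "length xs = 1" "length ys = 1" "length zs = 1"
        by (rule monom_as_word)
      thus "m \<in> range ?f" by (auto simp: length_Suc_conv image_iff)
    qed
    hence "wsum p (\<lambda>m. cw_weight (Some None) (somes m)) =
        (\<Sum>m\<in>range ?f. lookup p m * cw_weight (Some None) (somes m))"
      using p by (intro wsum_superset) (auto simp: polys_of_deg_eq supp_in_def)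
    also have "\<dots> = (\<Sum>(i, j, k)\<in>UNIV. lookup p (word_monom [i] [j] [k]) * cw_coeff i j k)"
      by (subst sum.reindex[OF inj]) (auto intro!: sum.cong simp: cw_coeff_def add.assoc)
    also have "\<dots> = (\<Sum>i\<in>UNIV. \<Sum>j\<in>UNIV. \<Sum>k\<in>UNIV. lookup p (word_monom [i] [j] [k]) * T_cw $ i $ j $ k)"
      by (simp add: sum.cartesian_product T_cw_nth)
    finally show ?thesis ..
  qed
  thus ?thesis by (auto simp: tensor_perp_def)
qed

section \<open>Uniqueness\<close>

lemma multideg_var_monom [simp]:
  "multideg (var_monom b i :: ('w::finite, 'w, 'w) monom3) = (of_bool (b = 0), of_bool (b = 1), of_bool (b \<noteq> 0 \<and> b \<noteq> 1))"
proof -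
  have "(\<Sum>j\<in>UNIV. 1 when v i = v j) = (1::nat)" if "inj v" for v :: "'w \<Rightarrow> 'w + 'w + 'w"
    using that by (simp add: when_def inj_eq)
  from this[of Inl] this[of "\<lambda>i. Inr (Inl i)"] this[of "\<lambda>i. Inr (Inr i)"]
  show ?thesis
    by (auto simp: multideg_def var_def lookup_single inj_def)
qed

lemmas multideg_var_monom_Suc_0 [simp] = multideg_var_monom[unfolded One_nat_def]

lemma unit_mult: "unit_pm m * unit_pm m' = (unit_pm (m + m') :: _ \<Rightarrow>\<^sub>0 complex)"
  by (simp add: mult_single)

lemma graded_ideal_mult: "graded_ideal I \<Longrightarrow> p \<in> I \<Longrightarrow> f * p \<in> I"
  by (auto simp: graded_ideal_def)

lemma graded_ideal_add: "graded_ideal I \<Longrightarrow> p \<in> I \<Longrightarrow> p' \<in> I \<Longrightarrow> p + p' \<in> I"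
  by (auto simp: graded_ideal_def)

lemma pm_scale_eq_mult:
  fixes p :: "('v \<Rightarrow>\<^sub>0 nat) \<Rightarrow>\<^sub>0 complex"
  shows "pm_scale c p = Poly_Mapping.single 0 c * p"
  unfolding pm_scale_def by (rule mult_map_scale_conv_mult)

lemma graded_ideal_scale: "graded_ideal I \<Longrightarrow> p \<in> I \<Longrightarrow> pm_scale c p \<in> I"
  by (simp add: pm_scale_eq_mult graded_ideal_mult)

lemma subspace_ideal_part: "graded_ideal I \<Longrightarrow> pm.subspace (ideal_part I s t u)"
  unfolding ideal_part_def polys_of_deg_eq
  by (intro pm.subspace_inter subspace_supp_in)
     (auto simp: pm.subspace_def graded_ideal_add graded_ideal_scale, auto simp: graded_ideal_def)

lemma ideal_part_subset: "ideal_part I s t u \<subseteq> supp_in (monoms (s, t, u))"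
  by (auto simp: ideal_part_def polys_of_deg_eq)

lemma monom_mult_ideal_part:
  assumes "graded_ideal I" "p \<in> ideal_part I s t u"
    and "multideg m = (s', t', u')" "s + s' = s2" "t + t' = t2" "u + u' = u2"
  shows "unit_pm m * p \<in> ideal_part I s2 t2 u2"
proof -
  have "multideg x = (s2, t2, u2)" if "x \<in> keys (unit_pm m * p)" for x
  proof -
    from that keys_mult[of "unit_pm m" p] obtain m' where "m' \<in> keys p" "x = m + m'"
      by auto
    thus ?thesis using assms(2-) by (auto simp: ideal_part_def polys_of_deg_def multideg_add)
  qed
  thus ?thesis using assms(1,2) by (auto simp: ideal_part_def polys_of_deg_def graded_ideal_mult)
qed

lemma var_eq_iff: "b \<le> 2 \<Longrightarrow> b' \<le> 2 \<Longrightarrow> var b i = var b' j \<longleftrightarrow> b = b' \<and> i = j"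
  by (auto simp: var_def split: if_splits)

lemma var_monom_pair_eq_iff:
  assumes "b \<le> 2" "b' \<le> 2" "b \<noteq> b'"
  shows "var_monom b i + var_monom b' j = var_monom b k + var_monom b' l \<longleftrightarrow> i = k \<and> j = l"
proof
  assume e: "var_monom b i + var_monom b' j = var_monom b k + var_monom b' l"
  have "lookup (var_monom b i + var_monom b' j) (var b i) = lookup (var_monom b k + var_monom b' l) (var b i)"
    "lookup (var_monom b i + var_monom b' j) (var b' j) = lookup (var_monom b k + var_monom b' l) (var b' j)"
    using e by simp_all
  thus "i = k \<and> j = l"
    using assms by (auto simp: lookup_add lookup_single when_def var_eq_iff split: if_splits)
qed auto

text \<open>
  The properties of a point of \<open>VSP T_cw\<close> on which uniqueness rests; \<open>hilbert\<close> expresses the generic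
  Hilbert function through \<open>card_normal_index\<close>.
\<close>

locale cw_candidate =
  fixes I :: "'q::finite cw_poly set"
  assumes q: "CARD('q) > 2"
    and graded: "graded_ideal I"
    and hilbert: "\<And>s t u. pm.dim (ideal_part I s t u) + card (normal_index (s + t + u) :: 'q option option set)
            = card (monoms (s, t, u) :: 'q cw_monom set)"
    and perp: "\<And>p. p \<in> ideal_part I 1 1 1 \<Longrightarrow> wsum p (\<lambda>m. cw_weight (Some None) (somes m)) = 0"
begin

lemma card_UNIV_qoo: "card (UNIV :: 'q option option set) = CARD('q) + 2"
  by simp

text \<open>
  The prolongation argument for two blocks \<open>b < b'\<close>, where \<open>c\<close> stands for \<open>b'\<close>; the degrees are those of \<open>x\<^sub>b x\<^sub>c\<close> and
  \<open>x\<^sub>b\<^sup>2 x\<^sub>c\<close>, and multiplication by variables of the third block \<open>b''\<close> leads from the former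
  to degree \<open>(1,1,1)\<close>. It shows that all functionals that vanish on \<open>I\<close> in the first degree are
  combinations of slices of \<open>T_cw\<close> and the corner entry, and these vanish on \<open>cw_ideal\<close>.
\<close>

lemma quadrics_in_ideal:
  fixes b b' b'' s t u :: nat
  assumes b: "(b, b', b'') \<in> {(0, 1, 2), (0, 2, 1), (1, 2, 0)}"
    and D2: "(s, t, u) = (of_bool (b = 0 \<or> b' = 0), of_bool (b = 1 \<or> b' = 1), of_bool (b = 2 \<or> b' = 2))"
  shows "ideal_part cw_ideal s t u \<subseteq> I"
proof -
  define mono :: "'q option \<Rightarrow> 'q option \<Rightarrow> 'q cw_monom" where
    "mono = (\<lambda>i j. var_monom b i + var_monom b' j)"
  have mono_eq: "mono i j = mono k l \<longleftrightarrow> i = k \<and> j = l" for i j k l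
    unfolding mono_def using b by (intro var_monom_pair_eq_iff) auto
  let ?S = "monoms (s, t, u) :: 'q cw_monom set"
  have stu: "s + t + u = 2" using b D2 by auto
  have monoS: "mono i j \<in> ?S" for i j
    using b D2 by (auto simp: monoms_def mono_def multideg_add)
  have Smono: "\<exists>i j. m = mono i j" if "m \<in> ?S" for m
  proof -
    from that have "multideg m = (s, t, u)" by (simp add: monoms_def)
    then obtain w where w: "length w = 2" "m = cut_monom s t w" using stu by (metis monom_as_cut_monom)
    then obtain i j where "w = [i, j]" by (auto simp: length_Suc_conv numeral_2_eq_2)
    hence "m = var_monom (block s t 0) i + var_monom (block s t 1) j"
      using w stu cut_monom_positions[of w s t u] by (simp add: numeral_2_eq_2)
    moreover have "block s t 0 = b" "block s t 1 = b'" using b D2 by (auto simp: block_def)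
    ultimately show ?thesis by (auto simp: mono_def)
  qed
  define U where "U = ideal_part I s t u"
  have dimU: "pm.dim U + (CARD('q) + 2) = card ?S"
    using hilbert[of s t u] stu card_UNIV_qoo by (simp add: U_def normal_index_UNIV)
  define tk :: "'q option \<Rightarrow> 'q cw_monom \<Rightarrow> complex" where
    "tk = (\<lambda>k m. cw_weight (Some None) (letter_mset k + somes m))"
  have tk_mono: "tk k (mono i j) = cw_coeff i j k" for i j k
    by (simp add: tk_def mono_def cw_coeff_def union_ac)
  have tkU: "wsum p (tk k) = 0" if "p \<in> ideal_part I' s t u"
    and "graded_ideal I'" "\<And>p. p \<in> ideal_part I' 1 1 1 \<Longrightarrow> wsum p (\<lambda>m. cw_weight (Some None) (somes m)) = 0"
    for p k I'
  proof -
    have "unit_pm (var_monom b'' k) * p \<in> ideal_part I' 1 1 1"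
      by (rule monom_mult_ideal_part[OF that(2,1) multideg_var_monom]) (use b D2 in auto)
    from that(3)[OF this] show ?thesis by (simp add: wsum_monom_mult tk_def)
  qed
  \<comment> \<open>Monomials dual to the slices \<open>tk k\<close>: on the border for \<open>v\<close>, on the diagonal for the identity block.\<close>
  define n0 :: "'q option \<Rightarrow> 'q cw_monom" where
    "n0 = (\<lambda>k. case k of None \<Rightarrow> mono (Some pivot) (Some pivot) | Some a \<Rightarrow> mono (Some a) None)"
  have n0_simps: "n0 None = mono (Some pivot) (Some pivot)" "n0 (Some a) = mono (Some a) None" for a
    by (simp_all add: n0_def)
  have tk_n0: "tk k (n0 l) = of_bool (k = l)" for k l
    by (cases k; cases l) (auto simp: n0_simps tk_mono)
  have inj_n0: "inj n0"
  proof (rule injI)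
    fix k l assume "n0 k = n0 l"
    hence "tk k (n0 k) = tk k (n0 l)" by simp
    thus "k = l" by (simp add: tk_n0)
  qed
  obtain N c where N: "range n0 \<subseteq> N" "N \<subseteq> ?S" "pm.dim U + card N = card ?S"
    "dual_system N ?S id c" "U = weight_kernel N ?S c"
  proof (rule subspace_as_weight_kernel[of ?S U "range n0"])
    show "finite ?S" by (rule finite_monoms)
    show "pm.subspace U" "U \<subseteq> supp_in ?S"
      unfolding U_def by (rule subspace_ideal_part[OF graded], rule ideal_part_subset)
    show "range n0 \<subseteq> ?S" by (auto simp: n0_def monoS split: option.split)
    fix p assume p: "p \<in> U" "p \<in> supp_in (range n0)"
    show "p = 0"
    proof (rule poly_mapping_eqI)
      fix m
      show "lookup p m = lookup 0 m"
      proof (cases "m \<in> range n0")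
        case False
        thus ?thesis using p(2) by (auto simp: supp_in_def in_keys_iff)
      next
        case True
        then obtain l where l: "m = n0 l" by blast
        have "0 = wsum p (tk l)" using tkU[OF p(1)[unfolded U_def] graded perp] by simp
        also have "\<dots> = (\<Sum>m\<in>range n0. lookup p m * tk l m)"
          by (rule wsum_superset) (use p(2) in \<open>auto simp: supp_in_def\<close>)
        also have "\<dots> = (\<Sum>k\<in>UNIV. if l = k then lookup p (n0 k) else 0)"
          by (simp add: sum.reindex[OF inj_n0] tk_n0 of_bool_def if_distrib cong: if_cong)
        also have "\<dots> = lookup p (n0 l)" by simp
        finally show ?thesis by (simp add: l)
      qed
    qed
  qed blast
  have cardN: "card N = CARD('q) + 2" using N(3) dimU by simp
  have fN: "finite N" using N(2) finite_monoms finite_subset by blast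
  \<comment> \<open>One monomial \<open>ms\<close> is left over; its weight is the additional matrix \<open>X\<close>, normalized to vanish
      at the monomials dual to the slices.\<close>
  have "card (range n0) = CARD('q) + 1" using card_image[OF inj_n0] by simp
  hence "card (N - range n0) = 1" using cardN N(1) by (simp add: card_Diff_subset)
  then obtain ms where ms: "N - range n0 = {ms}" by (auto simp: card_1_singleton_iff)
  hence Neq: "N = insert ms (range n0)" "ms \<notin> range n0" using N(1) by auto
  obtain i0 j0 where ms_mono: "ms = mono i0 j0" using Smono[of ms] Neq(1) N(2) by auto
  define X where "X = (\<lambda>i j. c ms (mono i j))"
  have cN: "c n n' = of_bool (n = n')" if "n \<in> N" "n' \<in> N" for n n'
    using N(4) that by (auto simp: dual_system_def)
  have vanish: "h m = (\<Sum>n\<in>N. h n * c n m)" if h: "\<And>p. p \<in> U \<Longrightarrow> wsum p h = 0" and m: "m \<in> ?S" for h m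
  proof -
    have "wsum (kernel_vec N id c m) h = 0"
      using kernel_vec_in_kernel[OF N(4) m] N(5) h by simp
    thus ?thesis by (simp add: kernel_vec_def wsum_diff wsum_sum wsum_scale mult.commute)
  qed
  have sumN: "(\<Sum>n\<in>N. f n) = f ms + (\<Sum>k\<in>UNIV. f (n0 k))" for f :: "_ \<Rightarrow> complex"
    using Neq by (simp add: sum.reindex[OF inj_n0])
  have tkc: "tk k m = tk k ms * c ms m + c (n0 k) m" if "m \<in> ?S" for k m
  proof -
    have "tk k m = (\<Sum>n\<in>N. tk k n * c n m)"
      by (rule vanish[OF _ that]) (use tkU[OF _ graded perp] in \<open>simp add: U_def\<close>)
    also have "\<dots> = tk k ms * c ms m + (\<Sum>l\<in>UNIV. of_bool (k = l) * c (n0 l) m)"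
      by (simp add: sumN tk_n0)
    also have "(\<Sum>l\<in>UNIV. of_bool (k = l) * c (n0 l) m) = (\<Sum>l\<in>UNIV. if k = l then c (n0 l) m else 0)"
      by (intro sum.cong) auto
    finally show ?thesis by simp
  qed
  have slice: "(\<Sum>k\<in>UNIV. h (n0 k) * tk k (mono i j)) =
       slice_comb (\<lambda>a. h (mono (Some a) None)) (h (mono (Some pivot) (Some pivot))) i j" for h i j
    unfolding sum_UNIV_option n0_simps tk_mono
    by (cases i; cases j) (simp_all add: of_bool_def if_distrib cong: if_cong)
  have form: "h (mono i j) = slice_comb (\<lambda>a. h (mono (Some a) None)) (h (mono (Some pivot) (Some pivot))) i j
       + (h (mono i0 j0) - slice_comb (\<lambda>a. h (mono (Some a) None)) (h (mono (Some pivot) (Some pivot))) i0 j0) * X i j"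
    if h: "\<And>p. p \<in> U \<Longrightarrow> wsum p h = 0" for h i j
  proof -
    have "h (mono i j) = h ms * X i j + (\<Sum>k\<in>UNIV. h (n0 k) * c (n0 k) (mono i j))"
      using vanish[OF h monoS] by (simp add: sumN X_def)
    also have "(\<Sum>k\<in>UNIV. h (n0 k) * c (n0 k) (mono i j)) =
        (\<Sum>k\<in>UNIV. h (n0 k) * tk k (mono i j) - h (n0 k) * tk k (mono i0 j0) * X i j)"
    proof (intro sum.cong refl)
      fix k :: "'q option"
      have "c (n0 k) (mono i j) = tk k (mono i j) - tk k (mono i0 j0) * X i j"
        using tkc[OF monoS, of k i j] unfolding X_def ms_mono by (metis add_diff_cancel_left')
      thus "h (n0 k) * c (n0 k) (mono i j) = h (n0 k) * tk k (mono i j) - h (n0 k) * tk k (mono i0 j0) * X i j"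
        by (simp only: right_diff_distrib mult.assoc)
    qed
    also have "\<dots> = (\<Sum>k\<in>UNIV. h (n0 k) * tk k (mono i j)) - (\<Sum>k\<in>UNIV. h (n0 k) * tk k (mono i0 j0)) * X i j"
      by (simp add: sum_subtractf sum_distrib_right)
    finally show ?thesis unfolding slice by (simp add: ms_mono algebra_simps)
  qed
  \<comment> \<open>The annihilator one degree higher: a dual system of \<open>q + 2\<close> weights, all of whose slices
      with respect to block \<open>b\<close> vanish on \<open>I\<close> in the lower degree.\<close>
  define s3 t3 u3 where "s3 = s + of_bool (b = 0)" and "t3 = t + of_bool (b = 1)" and "u3 = u + of_bool (b = 2)"
  let ?S3 = "monoms (s3, t3, u3) :: 'q cw_monom set"
  have stu3: "s3 + t3 + u3 = 3" using b D2 by (auto simp: s3_def t3_def u3_def)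
  have S3mono: "\<exists>i j k. m = var_monom b i + mono j k" if "m \<in> ?S3" for m
  proof -
    from that have "multideg m = (s3, t3, u3)" by (simp add: monoms_def)
    then obtain w where w: "length w = 3" "m = cut_monom s3 t3 w" using stu3 by (metis monom_as_cut_monom)
    then obtain i j k where "w = [i, j, k]" by (auto simp: length_Suc_conv numeral_3_eq_3)
    hence "m = var_monom (block s3 t3 0) i + var_monom (block s3 t3 1) j + var_monom (block s3 t3 2) k"
      using w stu3 cut_monom_positions[of w s3 t3 u3] by (simp add: numeral_3_eq_3 numeral_2_eq_2)
    moreover have "block s3 t3 0 = b" "block s3 t3 1 = b" "block s3 t3 2 = b'"
      using b D2 by (auto simp: block_def s3_def t3_def)
    ultimately show ?thesis by (auto simp: mono_def add.assoc)
  qed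
  obtain N3 c3 where N3: "N3 \<subseteq> ?S3" "pm.dim (ideal_part I s3 t3 u3) + card N3 = card ?S3"
    "dual_system N3 ?S3 id c3" "ideal_part I s3 t3 u3 = weight_kernel N3 ?S3 c3"
  proof (rule subspace_as_weight_kernel[of ?S3 "ideal_part I s3 t3 u3" "{}"])
    show "finite ?S3" by (rule finite_monoms)
    show "pm.subspace (ideal_part I s3 t3 u3)" "ideal_part I s3 t3 u3 \<subseteq> supp_in ?S3"
      by (rule subspace_ideal_part[OF graded], rule ideal_part_subset)
  qed (auto simp: supp_in_def)
  have "card N3 = card (UNIV :: 'q option option set)"
    using N3(2) hilbert[of s3 t3 u3] stu3 by (simp add: normal_index_UNIV)
  moreover have fN3: "finite N3" using N3(1) finite_monoms finite_subset by blast
  ultimately obtain f :: "'q option option \<Rightarrow> _" where f: "bij_betw f UNIV N3"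
    by (metis finite_same_card_bij finite)
  have fN3': "f n \<in> N3" for n using f by (auto simp: bij_betw_def)
  define F where "F = (\<lambda>n i j k. c3 (f n) (var_monom b i + mono j k))"
  have Xcorner: "X i j = 0" if ij: "(i, j) \<noteq> (None, None)" for i j
  proof (rule prolongation_forces_corner[where F = F and ?i0.0 = i0 and ?j0.0 = j0 and p = pivot and X = X])
    show "CARD('q) > 2" by (rule q)
    show "F n i j k = F n j i k" for n i j k
      by (simp add: F_def mono_def add_ac)
    show "a n = 0" if "\<And>i j k. (\<Sum>n\<in>UNIV. a n * F n i j k) = 0" for a n
    proof -
      obtain i j k where "f n = var_monom b i + mono j k" using S3mono[of "f n"] fN3' N3(1) by blast
      hence "0 = (\<Sum>l\<in>UNIV. a l * c3 (f l) (f n))" using that[of i j k] by (simp add: F_def)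
      also have "\<dots> = (\<Sum>l\<in>UNIV. if l = n then a l else 0)"
        using N3(3) fN3' f by (intro sum.cong) (auto simp: dual_system_def bij_betw_def inj_eq)
      finally show ?thesis by simp
    qed
    show "F n i j k = slice_comb (\<lambda>a. F n i (Some a) None) (F n i (Some pivot) (Some pivot)) j k +
       (F n i i0 j0 - slice_comb (\<lambda>a. F n i (Some a) None) (F n i (Some pivot) (Some pivot)) i0 j0) * X j k" for n i j k
      unfolding F_def
    proof (rule form)
      fix p assume "p \<in> U"
      hence "unit_pm (var_monom b i) * p \<in> ideal_part I s3 t3 u3"
        unfolding U_def
        by (rule monom_mult_ideal_part[OF graded _ multideg_var_monom])
           (use b in \<open>auto simp: s3_def t3_def u3_def\<close>)
      hence "wsum (unit_pm (var_monom b i) * p) (c3 (f n)) = 0"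
        using N3(4) fN3' by (simp add: weight_kernel_def)
      thus "wsum p (\<lambda>m. c3 (f n) (var_monom b i + m)) = 0" by (simp add: wsum_monom_mult)
    qed
    have Xn0: "c ms (n0 k) = 0" for k
      using cN[of ms "n0 k"] Neq by auto
    show "X (Some a) None = 0" for a
      using Xn0[of "Some a"] by (simp add: X_def n0_simps)
    show "X (Some pivot) (Some pivot) = 0"
      using Xn0[of None] by (simp add: X_def n0_simps)
    show "(i, j) \<noteq> (None, None)" by (rule ij)
  qed
  show ?thesis
  proof
    fix p assume p: "p \<in> ideal_part (cw_ideal :: 'q cw_poly set) s t u"
    hence pS: "p \<in> supp_in ?S" using ideal_part_subset by blast
    have perp_cw: "wsum p (\<lambda>m. cw_weight (Some None) (somes m)) = 0"
      if "p \<in> ideal_part cw_ideal 1 1 1" for p :: "'q cw_poly"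
      using that by (simp add: ideal_part_cw_ideal weight_kernel_def normal_index_UNIV)
    have tkp: "wsum p (tk k) = 0" for k
      by (rule tkU[OF p graded_ideal_cw_ideal perp_cw])
    have cmsp: "wsum p (c ms) = 0"
    proof -
      have "wsum p (c ms) = wsum p (\<lambda>m. X None None * cw_weight None (somes m))"
      proof (rule wsum_weight_cong)
        fix m assume "m \<in> keys p"
        then obtain i j where m: "m = mono i j" using pS Smono[of m] unfolding supp_in_def by blast
        show "c ms m = X None None * cw_weight None (somes m)"
          using Xcorner[of i j]
          by (cases i; cases j) (auto simp: m X_def mono_def cw_weight_def)
      qed
      also have "\<dots> = 0"
        using p stu by (simp add: wsum_weight_scale ideal_part_cw_ideal weight_kernel_def normal_index_UNIV)
      finally show ?thesis .
    qed
    have "wsum p (c n) = 0" if "n \<in> N" for n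
    proof (cases "n = ms")
      case True thus ?thesis using cmsp by simp
    next
      case False
      hence "n \<in> range n0" using that Neq by auto
      then obtain k where k: "n = n0 k" by blast
      have "0 = wsum p (\<lambda>m. tk k ms * c ms m + c (n0 k) m)"
        unfolding tkp[of k, symmetric]
        by (rule wsum_weight_cong) (use tkc pS in \<open>auto simp: supp_in_def\<close>)
      thus ?thesis by (simp add: wsum_weight_add wsum_weight_scale cmsp k)
    qed
    hence "p \<in> U" unfolding N(5) using pS by (simp add: weight_kernel_def)
    thus "p \<in> I" by (simp add: U_def ideal_part_def)
  qed
qed

end

lemma unit_diff_in_cw_ideal:
  assumes "multideg m = multideg m'" "\<And>i. cw_weight i (somes m) = cw_weight i (somes m')"
  shows "unit_pm m - unit_pm m' \<in> cw_ideal"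
  using assms by (simp add: cw_ideal_def wsum_diff)

lemma unit_in_cw_ideal:
  assumes "\<And>i. cw_weight i (somes m) = 0"
  shows "unit_pm m \<in> cw_ideal"
  using assms by (simp add: cw_ideal_def)

lemma cut_monom_two_positions:
  assumes "length w = s + t + u" "length w' = s + t + u" "k < s + t + u" "l < s + t + u" "k \<noteq> l"
    and "\<And>j. j < s + t + u \<Longrightarrow> j \<noteq> k \<Longrightarrow> j \<noteq> l \<Longrightarrow> w ! j = w' ! j"
  obtains R where
    "cut_monom s t w = R + (var_monom (block s t k) (w ! k) + var_monom (block s t l) (w ! l))"
    "cut_monom s t w' = R + (var_monom (block s t k) (w' ! k) + var_monom (block s t l) (w' ! l))"
proof -
  let ?f = "\<lambda>w j. var_monom (block s t j) (w ! j)"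
  have split: "(\<Sum>j<s + t + u. ?f v j) = (\<Sum>j\<in>{..<s + t + u} - {k} - {l}. ?f v j) + (?f v k + ?f v l)" for v :: "'a list"
    using assms(3-5) sum.remove[of "{..<s + t + u}" k "?f v"] sum.remove[of "{..<s + t + u} - {k}" l "?f v"]
    by (simp add: add_ac)
  have "(\<Sum>j\<in>{..<s + t + u} - {k} - {l}. ?f w j) = (\<Sum>j\<in>{..<s + t + u} - {k} - {l}. ?f w' j)"
    using assms(6) by (intro sum.cong) auto
  hence "cut_monom s t w' = (\<Sum>j\<in>{..<s + t + u} - {k} - {l}. ?f w j) + (?f w' k + ?f w' l)"
    by (simp only: cut_monom_positions[OF assms(2)] assms(2) split)
  moreover have "cut_monom s t w = (\<Sum>j\<in>{..<s + t + u} - {k} - {l}. ?f w j) + (?f w k + ?f w l)"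
    by (simp only: cut_monom_positions[OF assms(1)] assms(1) split)
  ultimately show ?thesis using that by blast
qed

lemma block_le: "block s t k \<le> 2"
  by (simp add: block_def)

context cw_candidate
begin

text \<open>
  The same for the blocks in either order, and without reference to multidegrees.
\<close>

lemma two_block_quadrics_in_ideal:
  assumes "b \<noteq> b'" "b \<le> 2" "b' \<le> 2" "p \<in> cw_ideal"
    and "p \<in> supp_in {m. \<exists>i j. m = var_monom b i + var_monom b' j}"
  shows "p \<in> I"
proof -
  have ordered: "p \<in> I" if "b < b'" "b' \<le> 2" "p \<in> cw_ideal"
    "p \<in> supp_in {m. \<exists>i j. m = var_monom b i + var_monom b' j}" for b b'
  proof -
    let ?s = "of_bool (b = 0 \<or> b' = 0)" and ?t = "of_bool (b = 1 \<or> b' = 1)"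
      and ?u = "of_bool (b = 2 \<or> b' = 2)"
    have bb: "(b, b', 3 - b - b') \<in> {(0, 1, 2), (0, 2, 1), (1, 2, 0)}"
      using that(1,2) by auto
    have "multideg (var_monom b i + var_monom b' j :: 'q cw_monom) = (?s, ?t, ?u)" for i j
      using that(1,2) by (auto simp: multideg_add)
    hence "p \<in> ideal_part cw_ideal ?s ?t ?u"
      using that(3,4) by (auto simp: ideal_part_def polys_of_deg_def supp_in_def)
    thus ?thesis using quadrics_in_ideal[OF bb refl] by blast
  qed
  have "{m :: 'q cw_monom. \<exists>i j. m = var_monom b i + var_monom b' j} = {m. \<exists>i j. m = var_monom b' i + var_monom b j}"
    by (intro Collect_cong iffI; elim exE; metis add.commute)
  with assms(5) have p': "p \<in> supp_in {m. \<exists>i j. m = var_monom b' i + var_monom b j}" by (simp only:)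
  show ?thesis
  proof (cases "b < b'")
    case True
    show ?thesis by (rule ordered[OF True assms(3-5)])
  next
    case False
    hence "b' < b" using assms(1) by simp
    thus ?thesis by (rule ordered[OF _ assms(2,4) p'])
  qed
qed

text \<open>
  Two positions in different blocks carry a quadric to which \<open>two_block_quadrics_in_ideal\<close> applies, the
  rest of the word being a common factor.
\<close>

lemma replace_two_letters:
  assumes "length w = s + t + u" "length w' = s + t + u" "k < s + t + u" "l < s + t + u"
    and "block s t k \<noteq> block s t l"
    and "\<And>j. j < s + t + u \<Longrightarrow> j \<noteq> k \<Longrightarrow> j \<noteq> l \<Longrightarrow> w ! j = w' ! j"
    and "\<And>i. cw_weight i (letter_mset (w ! k) + letter_mset (w ! l)) = cw_weight i (letter_mset (w' ! k) + letter_mset (w' ! l))"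
  shows "word_poly s t w - word_poly s t w' \<in> I"
proof -
  have "k \<noteq> l" using assms(5) by auto
  from cut_monom_two_positions[OF assms(1-4) this assms(6)] obtain R where R:
    "cut_monom s t w = R + (var_monom (block s t k) (w ! k) + var_monom (block s t l) (w ! l))"
    "cut_monom s t w' = R + (var_monom (block s t k) (w' ! k) + var_monom (block s t l) (w' ! l))"
    by blast
  let ?b = "block s t k" and ?b' = "block s t l"
  let ?m = "var_monom ?b (w ! k) + var_monom ?b' (w ! l)" and ?m' = "var_monom ?b (w' ! k) + var_monom ?b' (w' ! l)"
  have "unit_pm ?m - unit_pm ?m' \<in> I"
  proof (rule two_block_quadrics_in_ideal[OF assms(5) block_le block_le])
    show "unit_pm ?m - unit_pm ?m' \<in> cw_ideal"
      by (rule unit_diff_in_cw_ideal) (use assms(7) in \<open>simp_all add: multideg_add add.commute\<close>)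
    show "unit_pm ?m - unit_pm ?m' \<in> supp_in {m. \<exists>i j. m = var_monom ?b i + var_monom ?b' j}"
      by (intro pm.subspace_diff[OF subspace_supp_in]) auto
  qed
  hence "unit_pm R * (unit_pm ?m - unit_pm ?m') \<in> I" by (rule graded_ideal_mult[OF graded])
  thus ?thesis by (simp only: right_diff_distrib unit_mult R)
qed

lemma two_letters_vanish:
  assumes "length w = s + t + u" "k < s + t + u" "l < s + t + u" "block s t k \<noteq> block s t l"
    and "\<And>i. cw_weight i (letter_mset (w ! k) + letter_mset (w ! l)) = 0"
  shows "word_poly s t w \<in> I"
proof -
  have "k \<noteq> l" using assms(4) by auto
  from cut_monom_two_positions[OF assms(1,1-3) this] obtain R where R:
    "cut_monom s t w = R + (var_monom (block s t k) (w ! k) + var_monom (block s t l) (w ! l))"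
    by blast
  let ?b = "block s t k" and ?b' = "block s t l"
  let ?m = "var_monom ?b (w ! k) + var_monom ?b' (w ! l)"
  have "unit_pm ?m \<in> I"
  proof (rule two_block_quadrics_in_ideal[OF assms(4) block_le block_le])
    show "unit_pm ?m \<in> cw_ideal"
      by (rule unit_in_cw_ideal) (use assms(5) in \<open>simp add: add.commute\<close>)
  qed auto
  hence "unit_pm R * unit_pm ?m \<in> I" by (rule graded_ideal_mult[OF graded])
  thus ?thesis by (simp only: unit_mult R)
qed

lemma unit_diff_trans:
  "unit_pm a - unit_pm b \<in> I \<Longrightarrow> unit_pm b - unit_pm c \<in> I \<Longrightarrow> unit_pm a - unit_pm c \<in> I"
  using graded_ideal_add[OF graded, of "unit_pm a - unit_pm b" "unit_pm b - unit_pm c"] by simp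

lemma zero_in: "0 \<in> I" using graded by (simp add: graded_ideal_def)

lemma swap_letters:
  assumes w: "length w = s + t + u" and k: "k < s + t + u" and l: "l < s + t + u"
    and tr: "\<And>j. j < s + t + u \<Longrightarrow> w' ! j = w ! (Transposition.transpose k l j)" and w': "length w' = s + t + u"
  shows "word_poly s t w - word_poly s t w' \<in> I"
proof (cases "block s t k = block s t l")
  case False
  have "w' ! k = w ! l" "w' ! l = w ! k" using tr[OF k] tr[OF l] by simp_all
  hence "letter_mset (w ! k) + letter_mset (w ! l) = letter_mset (w' ! k) + letter_mset (w' ! l)" by (simp add: add.commute)
  thus ?thesis
    by (intro replace_two_letters[OF w w' k l False]) (simp_all add: tr)
next
  case True
  show ?thesis
  proof (cases "k = l")
    case True
    hence "w = w'" using tr w w' by (intro nth_equalityI) auto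
    thus ?thesis by (simp add: zero_in)
  next
    case kl: False
    have kl': "w' ! k = w ! l" "w' ! l = w ! k" using tr[OF k] tr[OF l] by simp_all
    have other: "w ! j = w' ! j" if "j < s + t + u" "j \<noteq> k" "j \<noteq> l" for j
      using tr[OF that(1)] that by simp
    obtain R where R:
      "cut_monom s t w = R + (var_monom (block s t k) (w ! k) + var_monom (block s t l) (w ! l))"
      "cut_monom s t w' = R + (var_monom (block s t k) (w' ! k) + var_monom (block s t l) (w' ! l))"
      using cut_monom_two_positions[OF w w' k l kl other] by blast
    have "cut_monom s t w = cut_monom s t w'" unfolding R kl' using True by (simp add: add.commute)
    thus ?thesis by (simp add: zero_in)
  qed
qed

text \<open>
  Within a block the order of the letters is immaterial, and across blocks two letters can be swapped modulo the
  ideal; transpositions generate all permutations of the positions.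
\<close>

lemma permute_letters:
  assumes "mset w' = mset w" "length w = s + t + u"
  shows "word_poly s t w - word_poly s t w' \<in> I"
proof -
  obtain p where p: "p permutes {..<length w}" "permute_list p w = w'"
    using assms(1) by (rule mset_eq_permutation)
  have "\<forall>w. length w = s + t + u \<longrightarrow> word_poly s t w - word_poly s t (permute_list p w) \<in> I"
    if "p permutes {..<s + t + u}" for p
    using that finite_lessThan
  proof (induction p rule: permutes_induct)
    case id
    show ?case by (simp add: zero_in)
  next
    case (swap a b p)
    show ?case
    proof (intro allI impI)
      fix w :: "'q option list" assume w: "length w = s + t + u"
      let ?w = "permute_list (Transposition.transpose a b) w"
      have tr: "Transposition.transpose a b permutes {..<length w}"
        using swap(1,2) w by (intro permutes_swap_id) auto
      have "word_poly s t w - word_poly s t ?w \<in> I"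
        by (rule swap_letters[OF w, of a b]) (use swap(1,2) w permute_list_nth[OF tr] in auto)
      moreover have "word_poly s t ?w - word_poly s t (permute_list p ?w) \<in> I"
        using swap.IH w by simp
      moreover have "permute_list p ?w = permute_list (Transposition.transpose a b \<circ> p) w"
        using permute_list_compose[of p w "Transposition.transpose a b"] swap.hyps(4) w by simp
      ultimately show "word_poly s t w - word_poly s t (permute_list (Transposition.transpose a b \<circ> p) w) \<in> I"
        using unit_diff_trans by metis
    qed
  qed
  thus ?thesis using p assms(2) by metis
qed

text \<open>
  The first and the last position lie in different blocks as soon as two blocks occur at all, so two letters
  that are to be handled by a quadric are moved there.
\<close>

lemma ends_word:
  assumes "{#x, y#} \<subseteq># mset w" "length w = d"
  obtains R where "mset (x # R @ [y]) = mset w" "length (x # R @ [y]) = d" "mset R = mset w - {#x, y#}"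
proof -
  obtain R where R: "mset R = mset w - {#x, y#}" using ex_mset by blast
  have "mset (x # R @ [y]) = mset w" 
  proof -
    have "mset w = {#x, y#} + (mset w - {#x, y#})" using assms(1) by (metis subset_mset.add_diff_inverse)
    thus ?thesis using R by simp
  qed
  thus ?thesis using that R assms(2) by (metis mset_eq_length)
qed

lemma distinct_letters_vanish:
  assumes "length w = s + t + u" "{#Some a, Some b#} \<subseteq># mset w" "a \<noteq> b"
    and d: "block s t 0 \<noteq> block s t (s + t + u - 1)"
  shows "word_poly s t w \<in> I"
proof -
  obtain R where R: "mset (Some a # R @ [Some b]) = mset w" "length (Some a # R @ [Some b]) = s + t + u"
    using ends_word[OF assms(2,1)] by blast
  let ?w = "Some a # R @ [Some b]"
  have last: "?w ! (s + t + u - 1) = Some b" using R(2) by (simp add: nth_append flip: R(2))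
  have "word_poly s t ?w \<in> I"
  proof (rule two_letters_vanish[OF R(2) _ _ d])
    show "cw_weight i (letter_mset (?w ! 0) + letter_mset (?w ! (s + t + u - 1))) = 0" for i
      unfolding last using assms(3) by (auto simp: cw_weight_def add_eq_conv_ex split: option.split)
  qed (use R(2) in auto)
  moreover have "word_poly s t w - word_poly s t ?w \<in> I"
    by (rule permute_letters[OF R(1) assms(1)])
  ultimately show ?thesis using graded_ideal_add[OF graded] by fastforce
qed

lemma replace_equal_pair:
  assumes "length w = s + t + u" "{#Some a, Some a#} \<subseteq># mset w"
    and d: "block s t 0 \<noteq> block s t (s + t + u - 1)"
  obtains w' where "length w' = s + t + u" "mset w' = {#Some c, Some c#} + (mset w - {#Some a, Some a#})"
    "word_poly s t w - word_poly s t w' \<in> I"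
proof -
  obtain R where R: "mset (Some a # R @ [Some a]) = mset w" "length (Some a # R @ [Some a]) = s + t + u"
     "mset R = mset w - {#Some a, Some a#}"
    using ends_word[OF assms(2,1)] by blast
  let ?w = "\<lambda>c. Some c # R @ [Some c]"
  have last: "?w c ! (s + t + u - 1) = Some c" for c using R(2) by (simp add: nth_append flip: R(2))
  have "word_poly s t (?w a) - word_poly s t (?w c) \<in> I"
  proof (rule replace_two_letters[OF _ _ _ _ d])
    show "cw_weight i (letter_mset (?w a ! 0) + letter_mset (?w a ! (s + t + u - 1))) =
        cw_weight i (letter_mset (?w c ! 0) + letter_mset (?w c ! (s + t + u - 1)))" for i
      unfolding last by (auto simp: cw_weight_def add_eq_conv_ex split: option.split)
    show "?w a ! j = ?w c ! j" if "j < s + t + u" "j \<noteq> 0" "j \<noteq> s + t + u - 1" for j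
      using that R(2) by (auto simp: nth_Cons nth_append split: nat.split)
  qed (use R(2) in auto)
  moreover have "word_poly s t w - word_poly s t (?w a) \<in> I"
    by (rule permute_letters[OF R(1) assms(1)])
  ultimately have "word_poly s t w - word_poly s t (?w c) \<in> I" by (rule unit_diff_trans[rotated])
  thus ?thesis using that[of "?w c"] R by simp
qed


text \<open>
  The weights of a word are those of its multiset of nonzero letters. If this has two different
  elements, the word lies in the ideal; a pair of equal letters can be replaced by any other
  pair, so three equal letters \<open>a, a, a\<close> turn into \<open>c, c, a\<close> and the word lies in the ideal, too. All other
  words are equivalent to a normal word.
\<close>

lemma normal_form_mod_ideal:
  assumes w: "length w = s + t + u" and d: "block s t 0 \<noteq> block s t (s + t + u - 1)"
  shows "word_poly s t w - (\<Sum>i\<in>UNIV. pm_scale (cw_weight i (somes (cut_monom s t w)))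
           (word_poly s t (normal_word (s + t + u) i))) \<in> I"
proof -
  let ?ms = "nonzero_letters (mset w)" and ?d = "s + t + u"
  let ?N = "\<lambda>i. word_poly s t (normal_word ?d i) :: 'q cw_poly"
  have d2: "2 \<le> ?d" using d by (auto simp: block_def split: if_splits)
  have dec: "mset w = image_mset Some ?ms + replicate_mset (?d - size ?ms) None"
    using nonzero_letters_decomp(1)[of "mset w"] w by simp
  have sum_one: "(\<Sum>i\<in>UNIV. pm_scale (of_bool (i = j)) (?N i)) = ?N j" for j
  proof -
    have "(\<Sum>i\<in>UNIV. pm_scale (of_bool (i = j)) (?N i)) = (\<Sum>i\<in>UNIV. if i = j then ?N j else 0)"
      by (intro sum.cong refl) auto
    thus ?thesis by simp
  qed
  consider (normal) i where "?ms = mset (normal_letters i)" | (pair) a where "?ms = {#a, a#}" |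
    (other) "\<And>i. ?ms \<noteq> mset (normal_letters i)" "\<And>a. ?ms \<noteq> {#a, a#}" by blast
  thus ?thesis
  proof cases
    case (normal i)
    have "mset (normal_word ?d i) = mset w"
      by (subst dec) (simp add: normal normal_word_def)
    from permute_letters[OF this w] show ?thesis
      by (simp add: normal cw_weight_normal sum_one del: of_bool_eq_iff)
  next
    case (pair a)
    have "{#Some a, Some a#} \<subseteq># mset w" by (subst dec) (simp add: pair)
    then obtain w' where w': "length w' = ?d"
        "mset w' = {#Some pivot, Some pivot#} + (mset w - {#Some a, Some a#})"
        "word_poly s t w - word_poly s t w' \<in> I"
      using replace_equal_pair[OF w _ d] by blast
    have "mset w' = mset (normal_word ?d (Some None))"
      unfolding w'(2) by (subst dec) (simp add: pair normal_word_def normal_letters_def)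
    hence "word_poly s t w' - ?N (Some None) \<in> I"
      using permute_letters[OF _ w'(1)] by metis
    from unit_diff_trans[OF w'(3) this]
    have "word_poly s t w - ?N (Some None) \<in> I" .
    moreover have "cw_weight i ?ms = of_bool (i = Some None)" for i
      unfolding pair by (auto simp: cw_weight_def split: option.split)
    ultimately show ?thesis by (simp add: sum_one)
  next
    case other
    have e: "?ms \<noteq> {#}" "?ms \<noteq> {#a#}" "?ms \<noteq> {#a, a#}" for a
      using other(1)[of None] other(1)[of "Some (Some a)"] other(2)[of a] by (auto simp: normal_letters_def)
    have z: "cw_weight i ?ms = 0" for i
      using e by (auto simp: cw_weight_def split: option.split)
    have "word_poly s t w \<in> I"
    proof (cases "\<exists>a b. a \<noteq> b \<and> {#a, b#} \<subseteq># ?ms")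
      case True
      then obtain a b where ab: "a \<noteq> b" "{#a, b#} \<subseteq># ?ms" by blast
      have "{#Some a, Some b#} \<subseteq># image_mset Some ?ms" using image_mset_subseteq_mono[OF ab(2), of Some] by simp
      hence "{#Some a, Some b#} \<subseteq># mset w" by (subst dec) (metis mset_subset_eq_add_left subset_mset.order_trans)
      thus ?thesis using distinct_letters_vanish[OF w _ ab(1) d] by blast
    next
      case False
      obtain a M where aM: "?ms = add_mset a M" using e(1) by (metis multiset_cases)
      obtain b M' where bM: "M = add_mset b M'" using e(2)[of a] aM by (metis multiset_cases)
      have "b = a" using False aM bM by force
      obtain c M'' where cM: "M' = add_mset c M''" using e(3)[of a] aM bM \<open>b = a\<close> by (metis multiset_cases)
      have "c = a" using False aM bM cM by force
      have ms: "?ms = {#a, a, a#} + M''" using aM bM cM \<open>b = a\<close> \<open>c = a\<close> by simp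
      have dec': "mset w = {#Some a, Some a, Some a#} + (image_mset Some M'' + replicate_mset (?d - size ?ms) None)"
        by (subst dec) (subst (1) ms, simp)
      obtain c where c: "c \<noteq> a" using ex_third_letter[OF q] by blast
      have "{#Some a, Some a#} \<subseteq># mset w" by (subst dec') simp
      then obtain w' where w': "length w' = ?d"
        "mset w' = {#Some c, Some c#} + (mset w - {#Some a, Some a#})"
        "word_poly s t w - word_poly s t w' \<in> I"
        using replace_equal_pair[OF w _ d] by blast
      have "{#Some c, Some a#} \<subseteq># mset w'" unfolding w'(2) by (subst dec') simp
      hence "word_poly s t w' \<in> I" using distinct_letters_vanish[OF w'(1) _ c d] by blast
      from graded_ideal_add[OF graded w'(3) this] show ?thesis by simp
    qed
    thus ?thesis by (simp add: z)
  qed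
qed

lemma cw_part_subset:
  assumes d: "block s t 0 \<noteq> block s t (s + t + u - 1)"
  shows "ideal_part cw_ideal s t u \<subseteq> ideal_part I s t u"
proof
  fix p :: "'q cw_poly"
  assume p: "p \<in> ideal_part cw_ideal s t u"
  let ?S = "monoms (s, t, u) :: 'q cw_monom set"
  let ?nm = "\<lambda>i. cut_monom s t (normal_word (s + t + u) i)"
  let ?c = "\<lambda>i (m :: 'q cw_monom). cw_weight i (somes m)"
  have d2: "2 \<le> s + t + u" using d by (auto simp: block_def split: if_splits)
  have "p = (\<Sum>m\<in>?S. pm_scale (lookup p m) (kernel_vec (normal_index (s + t + u)) ?nm ?c m))"
    by (rule kernel_vec_expansion[OF cw_dual_system finite_monoms p[unfolded ideal_part_cw_ideal]])
  also have "\<dots> \<in> I"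
  proof (intro graded_ideal_sum[OF graded] graded_ideal_scale[OF graded])
    fix m assume "m \<in> ?S"
    then obtain w where "length w = s + t + u" "m = cut_monom s t w"
      by (auto simp: monoms_def elim: monom_as_cut_monom)
    with normal_form_mod_ideal[OF this(1) d]
    show "kernel_vec (normal_index (s + t + u)) ?nm ?c m \<in> I"
      by (simp add: kernel_vec_def normal_index_UNIV[OF d2])
  qed
  finally show "p \<in> ideal_part I s t u" using p by (simp add: ideal_part_def)
qed

lemma dim_parts_eq: "pm.dim (ideal_part I s t u) = pm.dim (ideal_part (cw_ideal :: 'q cw_poly set) s t u)"
proof -
  have "pm.dim (ideal_part (cw_ideal :: 'q cw_poly set) s t u) + card (normal_index (s + t + u) :: 'q option option set)
            = card (monoms (s, t, u) :: 'q cw_monom set)"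
    unfolding ideal_part_cw_ideal by (rule dim_weight_kernel[OF cw_dual_system finite_monoms])
  with hilbert[of s t u] show ?thesis by simp
qed

lemma parts_eq_if_subset:
  "ideal_part cw_ideal s t u \<subseteq> ideal_part I s t u \<Longrightarrow> ideal_part I s t u = ideal_part cw_ideal s t u"
  by (rule sym, rule subspace_dim_eq[OF finite_monoms subspace_ideal_part[OF graded_ideal_cw_ideal]
        subspace_ideal_part[OF graded] _ ideal_part_subset dim_parts_eq[symmetric]])

lemma parts_eq_if_supset:
  "ideal_part I s t u \<subseteq> ideal_part cw_ideal s t u \<Longrightarrow> ideal_part I s t u = ideal_part cw_ideal s t u"
  by (rule subspace_dim_eq[OF finite_monoms subspace_ideal_part[OF graded]
        subspace_ideal_part[OF graded_ideal_cw_ideal] _ ideal_part_subset dim_parts_eq])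

text \<open>
  A variable of index 0 has no nonzero letters, hence multiplication by it does not change the
  weights, whereas it moves the degree to one where \<open>I\<close> and \<open>cw_ideal\<close> are known to agree.
\<close>

lemma var_None_colon:
  assumes p: "p \<in> ideal_part I s t u" and m: "multideg (var_monom b None :: 'q cw_monom) = (s', t', u')"
    and d: "block (s + s') (t + t') 0 \<noteq> block (s + s') (t + t') (s + s' + (t + t') + (u + u') - 1)"
    and d2: "2 \<le> s + t + u"
  shows "p \<in> ideal_part cw_ideal s t u"
proof -
  have "unit_pm (var_monom b None) * p \<in> ideal_part I (s + s') (t + t') (u + u')"
    by (rule monom_mult_ideal_part[OF graded p m]) auto
  hence "unit_pm (var_monom b None) * p \<in> ideal_part cw_ideal (s + s') (t + t') (u + u')"
    using parts_eq_if_subset[OF cw_part_subset[OF d]] by simp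
  hence "wsum p (\<lambda>m. cw_weight i (somes m)) = 0" for i
    using d2 by (simp add: ideal_part_cw_ideal weight_kernel_def normal_index_UNIV wsum_monom_mult)
  thus ?thesis
    using subsetD[OF ideal_part_subset p] by (simp add: ideal_part_cw_ideal weight_kernel_def)
qed

lemma parts_eq: "ideal_part I s t u = ideal_part cw_ideal s t u"
proof -
  consider "s + t + u \<le> 1" | "2 \<le> s + t + u" "block s t 0 \<noteq> block s t (s + t + u - 1)" |
    "2 \<le> s" "t = 0" "u = 0" | "s = 0" "2 \<le> t" "u = 0" | "s = 0" "t = 0" "2 \<le> u"
    by (cases "s = 0"; cases "t = 0"; cases "u = 0") (auto simp: block_def, linarith+)
  thus ?thesis
  proof cases
    case 1
    show ?thesis
    proof (rule parts_eq_if_subset, rule subsetI)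
      fix p :: "'q cw_poly"
      assume p: "p \<in> ideal_part cw_ideal s t u"
      let ?c = "\<lambda>i (m :: 'q cw_monom). cw_weight i (somes m)"
      have "p = (\<Sum>m\<in>monoms (s, t, u). pm_scale (lookup p m)
          (kernel_vec (normal_index (s + t + u)) (\<lambda>i. cut_monom s t (normal_word (s + t + u) i)) ?c m))"
        by (rule kernel_vec_expansion[OF cw_dual_system finite_monoms p[unfolded ideal_part_cw_ideal]])
      also have "\<dots> = 0"
      proof (rule sum.neutral, rule ballI)
        fix m :: "'q cw_monom" assume "m \<in> monoms (s, t, u)"
        then obtain i where i: "i \<in> normal_index (s + t + u)" "m = cut_monom s t (normal_word (s + t + u) i)"
          using low_degree_monoms_normal[OF 1] by blast
        have "kernel_vec (normal_index (s + t + u)) (\<lambda>i. cut_monom s t (normal_word (s + t + u) i)) ?c m = 0"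
          using kernel_vec_nm[OF cw_dual_system i(1)] i(2) by simp
        thus "pm_scale (lookup p m) (kernel_vec (normal_index (s + t + u))
            (\<lambda>i. cut_monom s t (normal_word (s + t + u) i)) ?c m) = 0" by simp
      qed
      finally show "p \<in> ideal_part I s t u"
        by (simp add: pm.subspace_0 subspace_ideal_part[OF graded])
    qed
  next
    case 2
    thus ?thesis by (intro parts_eq_if_subset cw_part_subset)
  next
    case 3
    thus ?thesis
      by (intro parts_eq_if_supset subsetI) (rule var_None_colon[of _ _ _ _ 1 0 1 0], auto simp: block_def)
  next
    case 4
    thus ?thesis
      by (intro parts_eq_if_supset subsetI) (rule var_None_colon[of _ _ _ _ 0 1 0 0], auto simp: block_def)
  next
    case 5
    thus ?thesis
      by (intro parts_eq_if_supset subsetI) (rule var_None_colon[of _ _ _ _ 0 1 0 0], auto simp: block_def)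
  qed
qed

lemma eq_cw_ideal: "I = cw_ideal"
  by (rule graded_ideal_eqI[OF graded graded_ideal_cw_ideal parts_eq])

end

section \<open>Existence\<close>

definition chart_point :: "('q \<Rightarrow> complex) \<Rightarrow> complex ^ ('q::finite) option" where
  "chart_point \<xi> = (\<chi> i. case i of None \<Rightarrow> 1 | Some a \<Rightarrow> \<xi> a)"

text \<open>
  The evaluation at the point \<open>\<xi>\<close> of the affine chart, as a weight on multisets of nonzero letters.
\<close>

definition chart_weight :: "('q \<Rightarrow> complex) \<Rightarrow> 'q multiset \<Rightarrow> complex" where
  "chart_weight \<xi> M = (\<Prod>a\<in>#M. \<xi> a)"

lemma chart_weight_simps [simp]:
  "chart_weight \<xi> {#} = 1"
  "chart_weight \<xi> (add_mset a M) = \<xi> a * chart_weight \<xi> M"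
  "chart_weight \<xi> (M + M') = chart_weight \<xi> M * chart_weight \<xi> M'"
  by (simp_all add: chart_weight_def)

lemma chart_weight_letter_mset: "chart_weight \<xi> (letter_mset i) = chart_point \<xi> $ i"
  by (cases i) (simp_all add: chart_point_def)

definition monom_eval :: "('v \<Rightarrow> complex) \<Rightarrow> ('v::finite \<Rightarrow>\<^sub>0 nat) \<Rightarrow> complex" where
  "monom_eval v m = (\<Prod>x\<in>UNIV. v x ^ lookup m x)"

lemma monom_eval_0: "monom_eval v 0 = 1"
  by (simp add: monom_eval_def)

lemma monom_eval_add: "monom_eval v (m + m') = monom_eval v m * monom_eval v m'"
  by (simp add: monom_eval_def lookup_add power_add prod.distrib)

lemma monom_eval_single: "monom_eval v (Poly_Mapping.single x 1) = v x"
proof -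
  have "monom_eval v (Poly_Mapping.single x 1) = (\<Prod>y\<in>UNIV. if y = x then v x else 1)"
    unfolding monom_eval_def by (intro prod.cong) (auto simp: lookup_single when_def)
  thus ?thesis by simp
qed

lemma monom_eval_sum_list:
  "monom_eval v (\<Sum>i\<leftarrow>xs. Poly_Mapping.single (f i) 1) = (\<Prod>i\<leftarrow>xs. v (f i))"
  by (induction xs) (simp_all add: monom_eval_0 monom_eval_add monom_eval_single[unfolded One_nat_def])

lemma eval3_eq_wsum:
  "eval3 p a b c = wsum p (monom_eval (\<lambda>x. case x of Inl i \<Rightarrow> a $ i | Inr (Inl j) \<Rightarrow> b $ j | Inr (Inr k) \<Rightarrow> c $ k))"
proof -
  have "(\<Prod>x\<in>keys m. v x ^ lookup m x) = monom_eval v m" for v and m :: "('a, 'b, 'c) monom3"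
    unfolding monom_eval_def by (rule prod.mono_neutral_left) (auto simp: in_keys_iff)
  thus ?thesis by (simp add: eval3_def wsum_def)
qed

lemma prod_list_scale: "(\<Prod>i\<leftarrow>xs. k * g i) = k ^ length xs * (\<Prod>i\<leftarrow>xs. g i)" for k :: complex
  by (induction xs) (auto simp: algebra_simps)

lemma prod_list_chart_point: "(\<Prod>i\<leftarrow>xs. chart_point \<xi> $ i) = chart_weight \<xi> (nonzero_letters (mset xs))"
  by (induction xs) (simp_all add: chart_weight_letter_mset)

lemma eval3_chart_point:
  fixes p :: "'q::finite cw_poly"
  assumes p: "p \<in> polys_of_deg s t u"
  shows "eval3 p (k *s chart_point \<xi>) (k' *s chart_point \<xi>) (k'' *s chart_point \<xi>) =
           k ^ s * k' ^ t * k'' ^ u * wsum p (\<lambda>m. chart_weight \<xi> (somes m))"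
proof -
  let ?v = "\<lambda>x. case x of Inl i \<Rightarrow> (k *s chart_point \<xi>) $ i | Inr (Inl j) \<Rightarrow> (k' *s chart_point \<xi>) $ j
     | Inr (Inr l) \<Rightarrow> (k'' *s chart_point \<xi>) $ l"
  have "wsum p (monom_eval ?v) = wsum p (\<lambda>m. (k ^ s * k' ^ t * k'' ^ u) * chart_weight \<xi> (somes m))"
  proof (rule wsum_weight_cong)
    fix m assume "m \<in> keys p"
    hence "multideg m = (s, t, u)" using p by (auto simp: polys_of_deg_def)
    then obtain xs ys zs where m: "m = word_monom xs ys zs" "length xs = s" "length ys = t" "length zs = u"
      by (rule monom_as_word)
    have "monom_eval ?v m = (\<Prod>i\<leftarrow>xs. k * chart_point \<xi> $ i) * (\<Prod>i\<leftarrow>ys. k' * chart_point \<xi> $ i) *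
        (\<Prod>i\<leftarrow>zs. k'' * chart_point \<xi> $ i)"
      unfolding m(1) word_monom_def monom_eval_add
      by (simp only: monom_eval_sum_list sum.case vector_smult_component)
    also have "\<dots> = (k ^ s * k' ^ t * k'' ^ u) * chart_weight \<xi> (somes m)"
      by (simp add: prod_list_scale prod_list_chart_point m(2-4)) (simp add: m(1))
    finally show "monom_eval ?v m = (k ^ s * k' ^ t * k'' ^ u) * chart_weight \<xi> (somes m)" .
  qed
  thus ?thesis by (simp add: eval3_eq_wsum wsum_weight_scale)
qed

definition cw_point :: "complex \<Rightarrow> 'q option option \<Rightarrow> 'q \<Rightarrow> complex" where
  "cw_point e i a = (case i of None \<Rightarrow> 0 | Some None \<Rightarrow> e\<^sup>2 | Some (Some j) \<Rightarrow> (if a = j then e else 0))"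

text \<open>
  Let \<open>L l\<close> be the value of a functional at \<open>cw_point e l\<close>. The sum of the first differences in
  the coordinate directions, multiplied by \<open>e\<close>, and the difference for the last point have the same terms of
  first order \<open>e\<^sup>2\<close>; what remains are the pure second order terms of size \<open>e\<^sup>3\<close> and terms of size \<open>e\<^sup>4\<close>. The
  denominator \<open>e\<^sup>3 - e\<^sup>4\<close> instead of \<open>e\<^sup>3\<close> gives exactly 1 on a pure square, not merely in the limit.
\<close>

definition second_diff :: "complex \<Rightarrow> ('q::finite option option \<Rightarrow> complex) \<Rightarrow> complex" where
  "second_diff e L = (L None + (\<Sum>a\<in>UNIV. e * (L (Some (Some a)) - L None)) - L (Some None)) / (e ^ 3 - e ^ 4)"

text \<open>
  The correction at \<open>pivot\<close> cancels the contribution of the square of that variable to the first difference.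
  Thereby the functionals are dual to the normal monomials for every \<open>e\<close>, as a
  convergent frame requires.
\<close>

definition divided_diff :: "complex \<Rightarrow> ('q::finite option option \<Rightarrow> complex) \<Rightarrow> 'q option option \<Rightarrow> complex" where
  "divided_diff e L i = (case i of None \<Rightarrow> L None
      | Some None \<Rightarrow> second_diff e L
      | Some (Some j) \<Rightarrow> (L (Some (Some j)) - L None) / e - of_bool (j = pivot) * e * second_diff e L)"

lemma divided_diff_simps [simp]:
  "divided_diff e L None = L None"
  "divided_diff e L (Some None) = second_diff e L"
  "divided_diff e L (Some (Some j)) = (L (Some (Some j)) - L None) / e - of_bool (j = pivot) * e * second_diff e L"
  by (simp_all add: divided_diff_def)

definition eps_weight :: "complex \<Rightarrow> 'q::finite option option \<Rightarrow> 'q multiset \<Rightarrow> complex" where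
  "eps_weight e i M = divided_diff e (\<lambda>l. chart_weight (cw_point e l) M) i"

lemma wsum_divided_diff:
  "wsum p (\<lambda>m. divided_diff e (\<lambda>l. f l m) i) = divided_diff e (\<lambda>l. wsum p (f l)) i"
proof -
  have diff: "wsum p (\<lambda>m. g m - h m) = wsum p g - wsum p h" for g h
    by (simp add: wsum_def algebra_simps sum_subtractf)
  have div: "wsum p (\<lambda>m. g m / c) = wsum p g / c" for g c
    by (simp add: wsum_def sum_divide_distrib)
  have 2: "wsum p (\<lambda>m. second_diff e (\<lambda>l. f l m)) = second_diff e (\<lambda>l. wsum p (f l))"
    unfolding second_diff_def div
    by (simp add: diff wsum_weight_add wsum_weight_sum wsum_weight_scale)
  consider "i = None" | "i = Some None" | j where "i = Some (Some j)" by (metis not_None_eq)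
  thus ?thesis
    by cases (simp_all add: 2 diff div wsum_weight_scale mult.assoc)
qed

lemma divided_diff_eq_0_iff:
  assumes e: "e \<noteq> 0" "e \<noteq> 1"
  shows "(\<forall>i. divided_diff e L i = 0) \<longleftrightarrow> (\<forall>i. L i = 0)"
proof
  assume d: "\<forall>i. divided_diff e L i = 0"
  have L0: "L None = 0" and s: "second_diff e L = 0" using d[rule_format, of None] d[rule_format, of "Some None"] by auto
  have Lj: "L (Some (Some j)) = 0" for j using d[rule_format, of "Some (Some j)"] L0 s e by simp
  have "e ^ 3 - e ^ 4 = e ^ 3 * (1 - e)" by (simp add: algebra_simps power_eq_if)
  hence "e ^ 3 - e ^ 4 \<noteq> 0" using e by simp
  hence LQ: "L (Some None) = 0" using s L0 Lj by (simp add: second_diff_def)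
  show "\<forall>i. L i = 0" using L0 Lj LQ by (metis not_None_eq)
next
  assume "\<forall>i. L i = 0"
  thus "\<forall>i. divided_diff e L i = 0"
    by (auto simp: divided_diff_def second_diff_def split: option.split)
qed

lemma chart_weight_cw_point_None: "chart_weight (cw_point e None) M = of_bool (M = {#})"
  by (cases M) (simp_all add: cw_point_def)

lemma chart_weight_const: "chart_weight (cw_point e (Some None)) M = e ^ (2 * size M)"
  by (induction M) (simp_all add: cw_point_def power2_eq_square)

lemma chart_weight_axis:
  "chart_weight (cw_point e (Some (Some j))) M = of_bool (M = replicate_mset (size M) j) * e ^ size M"
proof (induction M)
  case (add x M)
  show ?case
  proof (cases "x = j")
    case True
    thus ?thesis using add by (simp add: cw_point_def)
  next
    case False
    hence nr: "add_mset x M \<noteq> replicate_mset n j" for n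
      by (metis in_replicate_mset union_single_eq_member)
    hence "of_bool (add_mset x M = replicate_mset (size (add_mset x M)) j) = (0 :: complex)"
      by (simp only: nr of_bool_eq)
    thus ?thesis using False by (simp only: chart_weight_simps) (simp add: cw_point_def)
  qed
qed simp

lemma replicate_mset_inj: "n \<noteq> 0 \<Longrightarrow> replicate_mset n a = replicate_mset n b \<longleftrightarrow> a = b"
  by (metis count_replicate_mset)

lemma second_diff_small:
  assumes "size M \<le> 1"
  shows "second_diff e (\<lambda>l. chart_weight (cw_point e l) M) = 0"
proof (cases M)
  case empty
  thus ?thesis by (simp add: second_diff_def)
next
  case (add k M')
  hence M: "M = {#k#}" using assms by simp
  have "(\<Sum>a\<in>UNIV. e * (if k = a then e else 0)) = e * e"
    by (simp add: if_distrib cong: if_cong)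
  thus ?thesis by (simp add: M second_diff_def cw_point_def power2_eq_square)
qed

abbreviation "pure_power M \<equiv> (\<exists>a. M = replicate_mset (size M) a)"

lemma second_diff_large:
  assumes "size M \<ge> 2" "e \<noteq> 0" "e \<noteq> 1"
  shows "second_diff e (\<lambda>l. chart_weight (cw_point e l) M) =
     (of_bool (pure_power M) * e ^ (size M - 2) - e ^ (2 * size M - 3)) / (1 - e)"
proof -
  obtain n where n: "size M = n + 2" using assms(1) by (metis add.commute le_Suc_ex)
  have Mne: "M \<noteq> {#}" using n by auto
  have s: "(\<Sum>a\<in>UNIV. e * (of_bool (M = replicate_mset (size M) a) * e ^ size M)) =
     e * (of_bool (pure_power M) * e ^ size M)"
  proof (cases "pure_power M")
    case True
    then obtain a where a: "M = replicate_mset (size M) a" by blast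
    have "M = replicate_mset (size M) b \<longleftrightarrow> b = a" for b
      using a n replicate_mset_inj[of "size M" a b] by auto
    hence "(\<Sum>b\<in>UNIV. e * (of_bool (M = replicate_mset (size M) b) * e ^ size M)) = (\<Sum>b\<in>UNIV. if b = a then e * e ^ size M else 0)"
      by (intro sum.cong refl) (simp add: of_bool_def)
    thus ?thesis using True by simp
  next
    case False
    thus ?thesis by simp
  qed
  have "second_diff e (\<lambda>l. chart_weight (cw_point e l) M) =
     ((\<Sum>a\<in>UNIV. e * (of_bool (M = replicate_mset (size M) a) * e ^ size M)) - e ^ (2 * size M)) / (e ^ 3 - e ^ 4)"
    unfolding second_diff_def chart_weight_cw_point_None chart_weight_const chart_weight_axis
    by (simp only: Mne of_bool_eq simp_thms diff_0_right add_0_left)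
  also have "\<dots> = (e * (of_bool (pure_power M) * e ^ size M) - e ^ (2 * size M)) / (e ^ 3 - e ^ 4)"
    by (simp only: s)
  also have "\<dots> = (e ^ 3 * (of_bool (pure_power M) * e ^ n - e ^ (2 * n + 1))) / (e ^ 3 * (1 - e))"
    by (simp only: n) (simp add: algebra_simps power_add eval_nat_numeral)
  also have "\<dots> = (of_bool (pure_power M) * e ^ n - e ^ (2 * n + 1)) / (1 - e)"
    using assms by simp
  finally show ?thesis by (simp add: n add.commute)
qed

lemma eps_weight_normal:
  assumes "e \<noteq> 0" "e \<noteq> 1"
  shows "eps_weight e i (mset (normal_letters j)) = of_bool (i = j)"
proof -
  have pp: "second_diff e (\<lambda>l. chart_weight (cw_point e l) {#pivot, pivot#}) = 1"
  proof -
    have "{#pivot, pivot#} = replicate_mset (size {#pivot, pivot#}) pivot" by (simp add: numeral_2_eq_2)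
    hence t: "(\<exists>a. {#pivot, pivot#} = replicate_mset (size {#pivot, pivot#}) a) = True" by blast
    show ?thesis using assms second_diff_large[of "{#pivot, pivot#}" e, unfolded t]
      by (simp del: chart_weight_simps)
  qed
  have kk: "second_diff e (\<lambda>l. chart_weight (cw_point e l) {#k#}) = 0"
    "second_diff e (\<lambda>l. chart_weight (cw_point e l) {#}) = 0" for k
    by (rule second_diff_small, simp)+
  note vals = pp kk chart_weight_cw_point_None
  show ?thesis
    unfolding eps_weight_def using assms
    by (cases i; cases j; cases "the i"; cases "the j")
       (simp_all add: normal_letters_def vals cw_point_def del: chart_weight_simps, auto simp: cw_point_def)
qed

lemma eps_weight_size:
  assumes "size M < length (normal_letters i)"
  shows "eps_weight e i M = 0"
proof -
  consider "i = None" | "i = Some None" | k where "i = Some (Some k)" by (metis not_None_eq)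
  thus ?thesis
  proof cases
    case 2
    thus ?thesis using assms by (simp add: eps_weight_def normal_letters_def second_diff_small)
  next
    case (3 k)
    hence "M = {#}" using assms by (simp add: normal_letters_def)
    thus ?thesis using 3 by (simp add: eps_weight_def second_diff_small del: chart_weight_simps) simp
  qed (use assms in \<open>simp add: normal_letters_def\<close>)
qed

lemma eps_weight_tendsto:
  assumes e: "e \<longlonglongrightarrow> 0" "\<And>n. e n \<noteq> 0" "\<And>n. e n \<noteq> 1"
  shows "(\<lambda>n. eps_weight (e n) i M) \<longlonglongrightarrow> cw_weight i M"
proof -
  have 2: "(\<lambda>n. second_diff (e n) (\<lambda>l. chart_weight (cw_point (e n) l) M)) \<longlonglongrightarrow> cw_weight (Some None) M"
  proof (cases "size M \<le> 1")
    case True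
    hence "cw_weight (Some None) M = 0" by (auto simp: cw_weight_def)
    thus ?thesis using True by (simp add: second_diff_small)
  next
    case False
    hence s: "size M \<ge> 2" by simp
    have "(\<lambda>n. (of_bool (pure_power M) * e n ^ (size M - 2) - e n ^ (2 * size M - 3)) / (1 - e n))
        \<longlonglongrightarrow> (of_bool (pure_power M) * 0 ^ (size M - 2) - 0 ^ (2 * size M - 3)) / (1 - 0)"
      by (intro tendsto_intros e) auto
    also have "(of_bool (pure_power M) * 0 ^ (size M - 2) - 0 ^ (2 * size M - 3)) / (1 - 0)
       = cw_weight (Some None) M"
    proof (cases "size M = 2")
      case True
      thus ?thesis by (simp add: cw_weight_def numeral_2_eq_2)
    next
      case False
      hence "\<nexists>a. M = {#a, a#}" by auto
      moreover have "size M - 2 \<noteq> 0" "2 * size M - 3 \<noteq> 0" using False s by auto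
      ultimately show ?thesis by (simp add: cw_weight_def power_0_left)
    qed
    finally show ?thesis using second_diff_large[OF s e(2,3)] by simp
  qed
  consider "i = None" | "i = Some None" | j where "i = Some (Some j)" by (metis not_None_eq)
  thus ?thesis
  proof cases
    case 1
    thus ?thesis by (simp add: eps_weight_def cw_weight_def chart_weight_cw_point_None)
  next
    case 2
    thus ?thesis using \<open>(\<lambda>n. second_diff _ _) \<longlonglongrightarrow> _\<close> by (simp add: eps_weight_def)
  next
    case (3 j)
    have "(\<lambda>n. (chart_weight (cw_point (e n) (Some (Some j))) M - chart_weight (cw_point (e n) None) M) / e n)
        \<longlonglongrightarrow> of_bool (M = {#j#})"
    proof (cases "size M")
      case 0
      thus ?thesis by simp
    next
      case (Suc k)
      hence Mne: "M \<noteq> {#}" by auto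
      have "(chart_weight (cw_point (e n) (Some (Some j))) M - chart_weight (cw_point (e n) None) M) / e n =
          of_bool (M = replicate_mset (size M) j) * e n ^ k" for n
        using Suc Mne e(2)[of n] by (simp add: chart_weight_axis chart_weight_cw_point_None)
      moreover have "(\<lambda>n. of_bool (M = replicate_mset (size M) j) * e n ^ k) \<longlonglongrightarrow> of_bool (M = replicate_mset (size M) j) * 0 ^ k"
        by (intro tendsto_intros e)
      moreover have "of_bool (M = replicate_mset (size M) j) * 0 ^ k = (of_bool (M = {#j#}) :: complex)"
      proof (cases k)
        case 0 thus ?thesis using Suc by simp
      next
        case (Suc k') thus ?thesis using \<open>size M = Suc k\<close> by auto
      qed
      ultimately show ?thesis by simp
    qed
    moreover have "(\<lambda>n. of_bool (j = pivot) * e n * second_diff (e n) (\<lambda>l. chart_weight (cw_point (e n) l) M)) \<longlonglongrightarrow>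
        of_bool (j = pivot) * 0 * cw_weight (Some None) M"
      by (intro tendsto_intros e 2)
    ultimately have "(\<lambda>n. (chart_weight (cw_point (e n) (Some (Some j))) M - chart_weight (cw_point (e n) None) M) / e n
       - of_bool (j = pivot) * e n * second_diff (e n) (\<lambda>l. chart_weight (cw_point (e n) l) M)) \<longlonglongrightarrow>
       of_bool (M = {#j#}) - of_bool (j = pivot) * 0 * cw_weight (Some None) M"
      by (rule tendsto_diff)
    thus ?thesis using 3 by (simp add: eps_weight_def cw_weight_def)
  qed
qed

definition cw_line :: "complex \<Rightarrow> 'q::finite option option \<Rightarrow> (complex ^ 'q option) set" where
  "cw_line e i = vec.span {chart_point (cw_point e i)}"

definition cw_points ::
  "complex \<Rightarrow> ((complex ^ 'q::finite option) set \<times> (complex ^ 'q option) set \<times> (complex ^ 'q option) set) set" where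
  "cw_points e = range (\<lambda>i. (cw_line e i, cw_line e i, cw_line e i))"

lemma cw_line_eq: "cw_line e i = range (\<lambda>k. k *s chart_point (cw_point e i))"
  unfolding cw_line_def by (rule vec.span_singleton)

lemma cw_line_proj: "cw_line e i \<in> proj_space"
proof -
  have "chart_point (cw_point e i) $ None \<noteq> 0" by (simp add: chart_point_def)
  hence "chart_point (cw_point e i) \<noteq> 0" by (metis zero_index)
  thus ?thesis by (simp add: proj_space_def cw_line_def vec.dim_singleton)
qed

lemma inj_cw_line:
  assumes e: "e \<noteq> 0" and q: "CARD('q::finite) > 2"
  shows "inj (cw_line e :: 'q option option \<Rightarrow> _)"
proof (rule injI)
  fix i j :: "'q option option"
  assume "cw_line e i = cw_line e j"
  hence "chart_point (cw_point e i) \<in> cw_line e j" unfolding cw_line_def using vec.span_base by blast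
  then obtain k where k: "chart_point (cw_point e i) = k *s chart_point (cw_point e j)" by (auto simp: cw_line_eq)
  have "k = 1" using arg_cong[OF k, of "\<lambda>v. v $ None"] by (simp add: chart_point_def)
  hence eq: "cw_point e i a = cw_point e j a" for a
    using arg_cong[OF k, of "\<lambda>v. v $ Some a"] by (simp add: chart_point_def)
  have ne: "cw_point e (Some (Some l)) \<noteq> cw_point e None" "cw_point e (Some None) \<noteq> (cw_point e None :: 'q \<Rightarrow> _)"
    "cw_point e (Some None) \<noteq> cw_point e (Some (Some l))" for l :: 'q
  proof -
    obtain c where c: "c \<noteq> l" using ex_third_letter[OF q] by blast
    show "cw_point e (Some (Some l)) \<noteq> cw_point e None" using e by (auto simp: cw_point_def fun_eq_iff)
    show "cw_point e (Some None) \<noteq> (cw_point e None :: 'q \<Rightarrow> _)" using e by (auto simp: cw_point_def fun_eq_iff)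
    show "cw_point e (Some None) \<noteq> cw_point e (Some (Some l))"
      using e c by (auto simp: cw_point_def fun_eq_iff)
  qed
  have ll: "l = l'" if "cw_point e (Some (Some l)) = cw_point e (Some (Some l'))" for l l' :: 'q
    using fun_cong[OF that, of l] e by (auto simp: cw_point_def split: if_splits)
  have eq': "cw_point e i = cw_point e j" by (rule ext, rule eq)
  have jc: "j = None \<or> j = Some None \<or> (\<exists>l. j = Some (Some l))" by (metis not_None_eq)
  consider "i = None" | "i = Some None" | l where "i = Some (Some l)" by (metis not_None_eq)
  thus "i = j"
  proof cases
    case 1
    thus ?thesis using jc eq' ne(1,2) by metis
  next
    case 2
    thus ?thesis using jc eq' ne(2,3) by metis
  next
    case (3 l)
    thus ?thesis using jc eq' ne(1,3) ll by metis
  qed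
qed

lemma ideal_part_cw_points:
  assumes e: "e \<noteq> 0" "e \<noteq> 1"
  shows "ideal_part (ideal_of_points (cw_points e)) s t u =
     (normal_kernel s t u (eps_weight e) :: 'q::finite cw_poly set)"
proof -
  have "p \<in> ideal_part (ideal_of_points (cw_points e)) s t u \<longleftrightarrow>
     p \<in> normal_kernel s t u (eps_weight e)"
    for p :: "'q cw_poly"
  proof (cases "p \<in> polys_of_deg s t u")
    case False
    thus ?thesis by (auto simp: ideal_part_def weight_kernel_def polys_of_deg_eq)
  next
    case True
    let ?L = "\<lambda>i. wsum p (\<lambda>m. chart_weight (cw_point e i) (somes m))"
    have "p \<in> ideal_part (ideal_of_points (cw_points e)) s t u \<longleftrightarrow>
       (\<forall>i k k' k''. eval3 p (k *s chart_point (cw_point e i)) (k' *s chart_point (cw_point e i)) (k'' *s chart_point (cw_point e i)) = 0)"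
      using True by (auto simp: ideal_part_def ideal_of_points_def cw_points_def cw_line_eq)
    also have "\<dots> \<longleftrightarrow> (\<forall>i k k' k''. k ^ s * k' ^ t * k'' ^ u * ?L i = 0)"
      by (simp only: eval3_chart_point[OF True])
    also have "\<dots> \<longleftrightarrow> (\<forall>i. ?L i = 0)"
      by (metis mult_zero_right mult_1 power_one)
    also have "\<dots> \<longleftrightarrow> (\<forall>i. divided_diff e ?L i = 0)"
      by (rule divided_diff_eq_0_iff[OF e, symmetric])
    also have "\<dots> \<longleftrightarrow> (\<forall>i. wsum p (\<lambda>m. eps_weight e i (somes m)) = 0)"
      by (simp only: eps_weight_def wsum_divided_diff)
    also have "\<dots> \<longleftrightarrow> (\<forall>i\<in>normal_index (s + t + u). wsum p (\<lambda>m. eps_weight e i (somes m)) = 0)"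
    proof -
      have "wsum p (\<lambda>m. eps_weight e i (somes m)) = 0" if "i \<notin> normal_index (s + t + u)" for i
      proof -
        have "wsum p (\<lambda>m. eps_weight e i (somes m)) = wsum p (\<lambda>_. 0)"
        proof (rule wsum_weight_cong)
          fix m assume "m \<in> keys p"
          hence "multideg m = (s, t, u)" using True by (auto simp: polys_of_deg_def)
          hence "size (somes m) \<le> s + t + u" by (rule somes_size)
          thus "eps_weight e i (somes m) = 0"
            using that by (intro eps_weight_size) (simp add: normal_index_def)
        qed
        thus ?thesis by (simp add: wsum_def)
      qed
      thus ?thesis by blast
    qed
    also have "\<dots> \<longleftrightarrow> p \<in> normal_kernel s t u (eps_weight e)"
      using True by (simp add: weight_kernel_def polys_of_deg_eq)
    finally show ?thesis .
  qed
  thus ?thesis by blast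
qed

lemma cw_points_generic:
  assumes e: "e \<noteq> 0" "e \<noteq> 1" and q: "CARD('q::finite) > 2"
  shows "(ideal_of_points (cw_points e) :: 'q cw_poly set)
     \<in> generic_point_ideals (CARD('q) + 2)"
proof -
  let ?Z = "cw_points e :: ((complex ^ 'q option) set \<times> (complex ^ 'q option) set \<times> (complex ^ 'q option) set) set"
  have "inj (\<lambda>i :: 'q option option. (cw_line e i, cw_line e i, cw_line e i))"
    using inj_cw_line[OF e(1) q] by (simp add: inj_def)
  hence "card ?Z = card (UNIV :: 'q option option set)" unfolding cw_points_def by (rule card_image)
  hence "card ?Z = CARD('q) + 2" by simp
  moreover have "?Z \<subseteq> proj_space \<times> proj_space \<times> proj_space"
    using cw_line_proj by (auto simp: cw_points_def)
  moreover have "finite ?Z" by (simp add: cw_points_def)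
  moreover have "has_generic_hilbert_function (CARD('q) + 2) (ideal_of_points ?Z)"
    by (rule generic_hilbert_functionI[of "eps_weight e"]) (simp_all only: eps_weight_normal[OF e] ideal_part_cw_points[OF e])
  ultimately show ?thesis unfolding generic_point_ideals_def by blast
qed

lemma cw_ideal_in_VSP:
  assumes q: "CARD('q::finite) > 2"
    and br: "border_rank (T_cw :: 'q cw_space) = CARD('q) + 2"
  shows "cw_ideal \<in> VSP (T_cw :: 'q cw_space)"
proof -
  define e :: "nat \<Rightarrow> complex" where "e n = inverse (of_nat (n + 2))" for n
  have e0: "e n \<noteq> 0" for n unfolding e_def by (metis inverse_nonzero_iff_nonzero of_nat_eq_0_iff add_is_0 zero_neq_numeral)
  have e1: "e n \<noteq> 1" for n
  proof
    assume "e n = 1"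
    hence "(of_nat (n + 2) :: complex) = of_nat 1" unfolding e_def by (simp only: inverse_eq_1_iff of_nat_1)
    hence "n + 2 = 1" by (simp only: of_nat_eq_iff)
    thus False by simp
  qed
  have "e = (\<lambda>n. inverse (of_nat (n + 2)))" by (simp add: fun_eq_iff e_def)
  hence lim: "e \<longlonglongrightarrow> 0"
    using LIMSEQ_ignore_initial_segment[OF lim_inverse_n[where 'a=complex], of 2] by (simp only:)
  let ?J = "\<lambda>n. ideal_of_points (cw_points (e n)) :: 'q cw_poly set"
  have "grassmann_tendsto (\<lambda>n. ideal_part (?J n) s t u) (ideal_part cw_ideal s t u)" for s t u
    unfolding ideal_part_cw_points[OF e0 e1] ideal_part_cw_ideal
    by (rule grassmann_tendsto_weight_kernel[OF normal_dual_system cw_dual_system finite_monoms])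
       (simp_all only: eps_weight_normal[OF e0 e1] eps_weight_tendsto[OF lim e0 e1])
  moreover have "?J n \<in> generic_point_ideals (border_rank (T_cw :: 'q cw_space))" for n
    unfolding br by (rule cw_points_generic[OF e0 e1 q])
  moreover have "ideal_part cw_ideal 1 1 1 \<subseteq> tensor_perp (T_cw :: 'q cw_space)"
    by (auto simp: tensor_perp_T_cw ideal_part_cw_ideal weight_kernel_def normal_index_UNIV polys_of_deg_eq)
  ultimately show ?thesis
    unfolding VSP_def using graded_ideal_cw_ideal by (intro CollectI conjI exI[of _ ?J]) auto
qed

text \<open>
  Frames of subspaces in a convergent sequence have the length of the limit frame, so the Hilbert
  function of the ideals of points is that of the limit.
\<close>

lemma VSP_is_cw_candidate:
  assumes q: "CARD('q::finite) > 2"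
    and br: "border_rank (T_cw :: 'q cw_space) = CARD('q) + 2"
    and I: "I \<in> VSP (T_cw :: 'q cw_space)"
  shows "cw_candidate I"
proof
  show "CARD('q) > 2" by (rule q)
  show "graded_ideal I" using I by (simp add: VSP_def)
  show "wsum p (\<lambda>m. cw_weight (Some None) (somes m)) = 0" if "p \<in> ideal_part I 1 1 1" for p
    using I that unfolding VSP_def tensor_perp_T_cw by blast
  obtain J where J: "\<And>n. J n \<in> generic_point_ideals (CARD('q) + 2)"
    "\<And>s t u. grassmann_tendsto (\<lambda>n. ideal_part (J n) s t u) (ideal_part I s t u)"
    using I unfolding VSP_def br by blast
  show "pm.dim (ideal_part I s t u) + card (normal_index (s + t + u) :: 'q option option set)
            = card (monoms (s, t, u) :: 'q cw_monom set)" for s t u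
  proof -
    have "has_generic_hilbert_function (CARD('q) + 2) (J 0)"
      using J(1)[of 0] by (auto simp: generic_point_ideals_def)
    hence "pm.dim (ideal_part (J 0) s t u) + card (normal_index (s + t + u) :: 'q option option set)
            = card (monoms (s, t, u) :: 'q cw_monom set)"
      unfolding has_generic_hilbert_function_def dim_polys_of_deg card_normal_index by blast
    thus ?thesis using grassmann_tendsto_dim[OF J(2)] by simp
  qed
qed

section \<open>The border rank\<close>

lemma second_diff_linear:
  "second_diff e L = (\<Sum>l\<in>UNIV. (case l of None \<Rightarrow> 1 - of_nat CARD('q) * e | Some None \<Rightarrow> -1 | Some (Some a) \<Rightarrow> e) / (e ^ 3 - e ^ 4) * L l)"
  for L :: "'q::finite option option \<Rightarrow> complex"
proof -
  have opt: "(\<Sum>l\<in>UNIV. f l) = f None + f (Some None) + (\<Sum>a\<in>UNIV. f (Some (Some a)))" for f :: "'q option option \<Rightarrow> complex"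
    by (simp add: sum_UNIV_option add.assoc)
  have "second_diff e L = ((1 - of_nat CARD('q) * e) * L None + (-1) * L (Some None) + (\<Sum>a\<in>UNIV. e * L (Some (Some a)))) / (e ^ 3 - e ^ 4)"
    by (simp add: second_diff_def right_diff_distrib sum_subtractf algebra_simps)
  also have "\<dots> = (\<Sum>l\<in>UNIV. (case l of None \<Rightarrow> 1 - of_nat CARD('q) * e | Some None \<Rightarrow> -1 | Some (Some a) \<Rightarrow> e) * L l) / (e ^ 3 - e ^ 4)"
    unfolding opt by simp
  finally show ?thesis by (simp add: sum_divide_distrib)
qed

text \<open>
  Up to the factor \<open>1 - e\<close> this is the approximation of \<open>T_cw\<close> by \<open>q + 2\<close> rank one tensors due to
  Coppersmith and Winograd; convergence is a case of \<open>eps_weight_tendsto\<close>.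
\<close>

definition cw_approx :: "complex \<Rightarrow> complex ^ ('q::finite) option ^ 'q option ^ 'q option" where
  "cw_approx e = (\<chi> i j k. second_diff e (\<lambda>l. chart_weight (cw_point e l) (letter_mset i + letter_mset j + letter_mset k)))"

lemma cw_approx_rank:
  assumes e: "e \<noteq> 0" "e \<noteq> 1" "of_nat CARD('q) * e \<noteq> 1"
  shows "(cw_approx e :: complex ^ ('q::finite) option ^ 'q option ^ 'q option) \<in> sums_of_rank_one (CARD('q) + 2)"
proof -
  define c :: "'q option option \<Rightarrow> complex" where
    "c l = (case l of None \<Rightarrow> 1 - of_nat CARD('q) * e | Some None \<Rightarrow> -1 | Some (Some a) \<Rightarrow> e) / (e ^ 3 - e ^ 4)" for l
  define S where "S l = tensor3 (c l *s chart_point (cw_point e l)) (chart_point (cw_point e l)) (chart_point (cw_point e l))" for l :: "'q option option"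
  have "e ^ 3 - e ^ 4 = e ^ 3 * (1 - e)" by (simp add: algebra_simps power_eq_if)
  hence "e ^ 3 - e ^ 4 \<noteq> 0" using e by simp
  hence c0: "c l \<noteq> 0" for l using e by (auto simp: c_def split: option.split)
  have p0: "chart_point \<xi> $ None = 1" for \<xi> :: "'q \<Rightarrow> complex" by (simp add: chart_point_def)
  have "S l \<in> rank_one_tensors" for l
  proof -
    have "(c l *s chart_point (cw_point e l)) $ None \<noteq> 0" using c0 p0 by simp
    hence "c l *s chart_point (cw_point e l) \<noteq> 0" by (metis zero_index)
    moreover have "chart_point (cw_point e l) \<noteq> 0" using p0 by (metis zero_index zero_neq_one)
    ultimately show ?thesis unfolding rank_one_tensors_def S_def by blast
  qed
  moreover have "cw_approx e = (\<Sum>l\<in>UNIV. S l)"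
    by (simp add: vec_eq_iff cw_approx_def second_diff_linear S_def tensor3_def chart_weight_letter_mset c_def mult.assoc)
  moreover obtain f where f: "bij_betw f {..<CARD('q) + 2} (UNIV :: 'q option option set)"
  proof -
    have "card (UNIV :: 'q option option set) = CARD('q) + 2" by simp
    thus ?thesis using that ex_bij_betw_nat_finite[of "UNIV :: 'q option option set"] by (metis finite lessThan_atLeast0)
  qed
  moreover have "(\<Sum>l\<in>UNIV. S l) = (\<Sum>i<CARD('q) + 2. S (f i))"
    by (rule sum.reindex_bij_betw[OF f, symmetric])
  ultimately show ?thesis unfolding sums_of_rank_one_def by (intro CollectI exI[of _ "\<lambda>i. S (f i)"]) auto
qed

lemma T_cw_border_rank_le:
  assumes q: "CARD('q::finite) > 2"
  shows "(T_cw :: 'q cw_space) \<in> closure (sums_of_rank_one (CARD('q) + 2))"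
proof -
  define N where "N n = n + CARD('q) + 2" for n :: nat
  define e :: "nat \<Rightarrow> complex" where "e n = inverse (of_nat (N n))" for n
  have N: "N n \<noteq> 0" "N n \<noteq> 1" "N n \<noteq> CARD('q)" for n by (auto simp: N_def)
  have e0: "e n \<noteq> 0" for n unfolding e_def using N(1)[of n] by simp
  have e1: "e n \<noteq> 1" for n unfolding e_def inverse_eq_1_iff using N(2)[of n] by (metis of_nat_1 of_nat_eq_iff)
  have e2: "of_nat CARD('q) * e n \<noteq> 1" for n
  proof
    assume "of_nat CARD('q) * e n = 1"
    hence "(of_nat CARD('q) :: complex) = of_nat (N n)" using N(1)[of n] by (simp add: e_def field_simps)
    thus False using N(3)[of n] by (metis of_nat_eq_iff)
  qed
  have "e = (\<lambda>n. inverse (of_nat (n + (CARD('q) + 2))))" by (simp add: fun_eq_iff e_def N_def add_ac)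
  hence lim: "e \<longlonglongrightarrow> 0"
    using LIMSEQ_ignore_initial_segment[OF lim_inverse_n[where 'a=complex], of "CARD('q) + 2"] by (simp only:)
  have "(\<lambda>n. cw_approx (e n)) \<longlonglongrightarrow> (T_cw :: 'q cw_space)"
  proof (intro vec_tendstoI)
    fix i j k :: "'q option"
    have "(\<lambda>n. eps_weight (e n) (Some None) (letter_mset i + letter_mset j + letter_mset k)) \<longlonglongrightarrow> cw_weight (Some None) (letter_mset i + letter_mset j + letter_mset k)"
      by (rule eps_weight_tendsto[OF lim e0 e1])
    thus "(\<lambda>n. cw_approx (e n) $ i $ j $ k) \<longlonglongrightarrow> T_cw $ i $ j $ k"
      by (simp add: cw_approx_def T_cw_nth cw_coeff_def eps_weight_def del: chart_weight_simps)
  qed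
  moreover have "(cw_approx (e n) :: 'q cw_space) \<in> sums_of_rank_one (CARD('q) + 2)" for n
    by (rule cw_approx_rank[OF e0 e1 e2])
  ultimately show ?thesis
    unfolding closure_sequential by (intro exI[of _ "\<lambda>n. cw_approx (e n)"]) auto
qed

definition contract3 :: "complex ^ 'n ^ 'n ^ 'n \<Rightarrow> ('n::finite \<Rightarrow> complex) \<Rightarrow> complex ^ 'n ^ 'n" where
  "contract3 T g = (\<chi> i j. \<Sum>k\<in>UNIV. g k * T $ i $ j $ k)"

text \<open>
  With at most as many summands as the dimension, all contractions factor as \<open>A D B\<close> with \<open>A\<close> and \<open>B\<close> square
  and independent of the covector and \<open>D\<close> diagonal. If one contraction \<open>P\<close> is
  invertible, then \<open>X P\<^sup>-\<^sup>1 Y = Y P\<^sup>-\<^sup>1 X\<close> for all contractions \<open>X\<close> and \<open>Y\<close>, because diagonal matrices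
  commute. The inverse is avoided by naming the solutions \<open>z1\<close> and \<open>z2\<close> of \<open>P z1 = Y w\<close> and \<open>P z2 = X w\<close>.
\<close>

lemma slices_commute:
  fixes a b c :: "'n::finite \<Rightarrow> complex ^ 'n"
  assumes T: "T = (\<Sum>x\<in>UNIV. tensor3 (a x) (b x) (c x))"
    and det: "det (contract3 T g) \<noteq> 0"
    and z1: "contract3 T g *v z1 = contract3 T g'' *v w"
    and z2: "contract3 T g *v z2 = contract3 T g' *v w"
  shows "contract3 T g' *v z1 = contract3 T g'' *v z2"
proof -
  define d where "d g x = (\<Sum>k\<in>UNIV. g k * c x $ k)" for g x
  define \<beta> where "\<beta> z x = (\<Sum>j\<in>UNIV. b x $ j * z $ j)" for z :: "complex ^ 'n" and x
  define A where "A = (\<chi> i x. a x $ i)"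
  define Q where "Q g = (\<chi> x j. d g x * b x $ j)" for g
  have Tn: "T $ i $ j $ k = (\<Sum>x\<in>UNIV. a x $ i * b x $ j * c x $ k)" for i j k
    by (simp add: T tensor3_def)
  have AQ: "contract3 T g = A ** Q g" for g
  proof -
    have "contract3 T g $ i $ j = (A ** Q g) $ i $ j" for i j
    proof -
      have "contract3 T g $ i $ j = (\<Sum>k\<in>UNIV. \<Sum>x\<in>UNIV. a x $ i * (g k * c x $ k * b x $ j))"
        by (simp add: contract3_def Tn sum_distrib_left mult_ac)
      also have "\<dots> = (\<Sum>x\<in>UNIV. \<Sum>k\<in>UNIV. a x $ i * (g k * c x $ k * b x $ j))"
        by (rule sum.swap)
      also have "\<dots> = (A ** Q g) $ i $ j"
        by (simp add: matrix_matrix_mult_def A_def Q_def d_def sum_distrib_left sum_distrib_right)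
      finally show ?thesis .
    qed
    thus ?thesis by (simp add: vec_eq_iff)
  qed
  have Qv: "Q g *v z = (\<chi> x. d g x * \<beta> z x)" for g z
    by (simp add: vec_eq_iff matrix_vector_mult_def Q_def \<beta>_def sum_distrib_left mult.assoc)
  have dets: "det A \<noteq> 0" "det (Q g) \<noteq> 0" using det by (simp_all add: AQ det_mul)
  have injA: "u = v" if "A *v u = A *v v" for u v
  proof -
    obtain A' where "A' ** A = mat 1" using dets(1) by (metis invertible_det_nz invertible_left_inverse)
    thus ?thesis using that by (metis matrix_vector_mul_assoc matrix_vector_mul_lid)
  qed
  have d0: "d g x \<noteq> 0" for x
  proof
    assume "d g x = 0"
    hence "row x (Q g) = 0" by (simp add: row_def Q_def vec_eq_iff)
    thus False using dets(2) det_zero_row(2) by blast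
  qed
  have "Q g *v z1 = Q g'' *v w" "Q g *v z2 = Q g' *v w"
    using z1 z2 unfolding AQ by (simp_all add: injA flip: matrix_vector_mul_assoc)
  hence e: "d g x * \<beta> z1 x = d g'' x * \<beta> w x" "d g x * \<beta> z2 x = d g' x * \<beta> w x" for x
    by (simp_all add: Qv vec_eq_iff)
  have "d g' x * \<beta> z1 x = d g'' x * \<beta> z2 x" for x
  proof -
    have "d g x * (d g' x * \<beta> z1 x) = d g' x * (d g x * \<beta> z1 x)" by simp
    also have "\<dots> = d g'' x * (d g x * \<beta> z2 x)" by (simp only: e) simp
    also have "\<dots> = d g x * (d g'' x * \<beta> z2 x)" by simp
    finally show ?thesis using d0[of x] by simp
  qed
  hence "Q g' *v z1 = Q g'' *v z2" by (simp add: Qv vec_eq_iff)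
  thus ?thesis unfolding AQ by (simp flip: matrix_vector_mul_assoc)
qed

definition cramer_solution :: "complex ^ 'n ^ 'n \<Rightarrow> complex ^ 'n \<Rightarrow> complex ^ ('n::finite)" where
  "cramer_solution P v = (\<chi> k. det (\<chi> i j. if j = k then v $ i else P $ i $ j) / det P)"

lemma cramer_solution_iff: "det P \<noteq> 0 \<Longrightarrow> P *v z = v \<longleftrightarrow> z = cramer_solution P v"
  unfolding cramer_solution_def by (rule cramer)

lemma tendsto_det:
  fixes P :: "'z \<Rightarrow> complex ^ 'n ^ ('n::finite)"
  assumes "\<And>i j. ((\<lambda>z. P z $ i $ j) \<longlongrightarrow> P' $ i $ j) F"
  shows "((\<lambda>z. det (P z)) \<longlongrightarrow> det P') F"
  unfolding det_def by (intro tendsto_intros assms)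

lemma tendsto_cramer_solution:
  fixes P :: "nat \<Rightarrow> complex ^ 'n ^ ('n::finite)"
  assumes P: "P \<longlonglongrightarrow> P'" and v: "v \<longlonglongrightarrow> v'" and "det P' \<noteq> 0"
  shows "(\<lambda>n. cramer_solution (P n) (v n)) \<longlonglongrightarrow> cramer_solution P' v'"
proof (rule vec_tendstoI)
  fix k
  have Pc: "(\<lambda>n. P n $ i $ j) \<longlonglongrightarrow> P' $ i $ j" and vc: "(\<lambda>n. v n $ i) \<longlonglongrightarrow> v' $ i" for i j
    by (intro tendsto_vec_nth P v)+
  show "(\<lambda>n. cramer_solution (P n) (v n) $ k) \<longlonglongrightarrow> cramer_solution P' v' $ k"
    unfolding cramer_solution_def vec_lambda_beta
    by (intro tendsto_divide tendsto_det assms Pc) (auto intro: Pc vc)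
qed

lemma tendsto_matrix_vector_mult:
  fixes P :: "nat \<Rightarrow> complex ^ 'n ^ ('n::finite)"
  assumes "P \<longlonglongrightarrow> P'" "v \<longlonglongrightarrow> v'"
  shows "(\<lambda>n. P n *v v n) \<longlonglongrightarrow> P' *v v'"
  unfolding matrix_vector_mult_def by (intro vec_tendstoI) (simp, intro tendsto_intros assms)

lemma sums_of_rank_one_padded:
  fixes T :: "complex ^ 'c ^ 'b ^ 'a"
  assumes "T \<in> sums_of_rank_one r" "r \<le> CARD('n::finite)"
  obtains a :: "'n::finite \<Rightarrow> complex ^ 'a" and b :: "'n \<Rightarrow> complex ^ 'b" and c :: "'n \<Rightarrow> complex ^ 'c" where "T = (\<Sum>x\<in>UNIV. tensor3 (a x) (b x) (c x))"
proof -
  obtain S where S: "T = (\<Sum>i<r. S i)" "\<And>i. i < r \<Longrightarrow> S i \<in> rank_one_tensors"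
    using assms(1) by (auto simp: sums_of_rank_one_def)
  have "\<exists>a b c. S i = tensor3 a b c" if "i < r" for i
    using S(2)[OF that] by (auto simp: rank_one_tensors_def)
  then obtain a b c where abc: "\<And>i. i < r \<Longrightarrow> S i = tensor3 (a i) (b i) (c i)" by metis
  obtain h where h: "bij_betw h (UNIV :: 'n set) {..<CARD('n)}"
    by (metis ex_bij_betw_finite_nat finite lessThan_atLeast0)
  let ?a = "\<lambda>i. if i < r then a i else 0"
  have z: "tensor3 0 b c = 0" for b c by (simp add: tensor3_def vec_eq_iff)
  have "(\<Sum>x\<in>UNIV. tensor3 (?a (h x)) (b (h x)) (c (h x))) = (\<Sum>i<CARD('n). tensor3 (?a i) (b i) (c i))"
    by (rule sum.reindex_bij_betw[OF h])
  also have "\<dots> = (\<Sum>i<r. tensor3 (?a i) (b i) (c i))"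
    by (rule sum.mono_neutral_right) (use assms(2) in \<open>auto simp: z\<close>)
  also have "\<dots> = T" unfolding S(1) by (intro sum.cong) (auto simp: abc)
  finally show ?thesis using that[of "\<lambda>x. ?a (h x)" "\<lambda>x. b (h x)" "\<lambda>x. c (h x)"] by simp
qed

text \<open>
  Cramer's rule makes the solutions depend continuously on the tensor, so commutation survives the limit.
\<close>

lemma closure_slices_commute:
  fixes T :: "complex ^ 'n ^ 'n ^ ('n::finite)"
  assumes T: "T \<in> closure (sums_of_rank_one r)" and r: "r \<le> CARD('n)"
    and det: "det (contract3 T g) \<noteq> 0"
    and z1: "contract3 T g *v z1 = contract3 T g'' *v w"
    and z2: "contract3 T g *v z2 = contract3 T g' *v w"
  shows "contract3 T g' *v z1 = contract3 T g'' *v z2"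
proof -
  obtain S where S: "\<And>n. S n \<in> sums_of_rank_one r" "S \<longlonglongrightarrow> T"
    using T unfolding closure_sequential by blast
  have lim: "(\<lambda>n. contract3 (S n) g) \<longlonglongrightarrow> contract3 T g" for g
    unfolding contract3_def
    by (intro vec_tendstoI) (simp, intro tendsto_intros S(2))
  have ev: "\<forall>\<^sub>F n in sequentially. det (contract3 (S n) g) \<noteq> 0"
    by (rule tendsto_imp_eventually_ne[OF tendsto_det det]) (intro tendsto_vec_nth lim)
  let ?z1 = "\<lambda>n. cramer_solution (contract3 (S n) g) (contract3 (S n) g'' *v w)"
  let ?z2 = "\<lambda>n. cramer_solution (contract3 (S n) g) (contract3 (S n) g' *v w)"
  have z12: "z1 = cramer_solution (contract3 T g) (contract3 T g'' *v w)"
    "z2 = cramer_solution (contract3 T g) (contract3 T g' *v w)"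
    using z1 z2 by (simp_all only: cramer_solution_iff[OF det])
  have l1: "?z1 \<longlonglongrightarrow> z1" and l2: "?z2 \<longlonglongrightarrow> z2"
    unfolding z12 by (rule tendsto_cramer_solution[OF lim tendsto_matrix_vector_mult[OF lim tendsto_const] det])+
  have "\<forall>\<^sub>F n in sequentially. contract3 (S n) g' *v ?z1 n = contract3 (S n) g'' *v ?z2 n"
    using ev
  proof eventually_elim
    case (elim n)
    obtain a b c :: "'n \<Rightarrow> complex ^ 'n" where "S n = (\<Sum>x\<in>UNIV. tensor3 (a x) (b x) (c x))"
      using sums_of_rank_one_padded[OF S(1) r] by blast
    thus ?case by (rule slices_commute[OF _ elim]) (simp_all add: cramer_solution_iff[OF elim])
  qed
  hence "(\<lambda>n. contract3 (S n) g'' *v ?z2 n) \<longlonglongrightarrow> contract3 T g' *v z1"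
    by (rule Lim_transform_eventually[OF tendsto_matrix_vector_mult[OF lim l1]])
  thus ?thesis
    by (rule LIMSEQ_unique[OF _ tendsto_matrix_vector_mult[OF lim l2]])
qed

text \<open>
  Commutation fails for the contractions \<open>P\<close> with \<open>e\<^sub>0 + e\<^sub>a\<close>, \<open>X\<close> with \<open>e\<^sub>b\<close> and \<open>Y\<close> with \<open>e\<^sub>c\<close>, where \<open>a\<close>,
  \<open>b\<close>, \<open>c\<close> are different: at \<open>e\<^sub>c\<close>, the matrix \<open>X P\<^sup>-\<^sup>1 Y\<close> takes the value \<open>- e\<^sub>b\<close>, and \<open>Y P\<^sup>-\<^sup>1 X\<close> the value 0.
\<close>

lemma T_cw_border_rank_ge:
  assumes q: "CARD('q::finite) > 2"
    and T: "(T_cw :: 'q cw_space) \<in> closure (sums_of_rank_one r)"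
  shows "CARD('q) + 2 \<le> r"
proof (rule ccontr)
  assume "\<not> CARD('q) + 2 \<le> r"
  hence r: "r \<le> CARD('q option)" by simp
  obtain a b c :: 'q where abc: "a \<noteq> b" "a \<noteq> c" "b \<noteq> c"
  proof -
    obtain B where "B \<subseteq> (UNIV :: 'q set)" "card B = 3"
      using obtain_subset_with_card_n[of 3 "UNIV :: 'q set"] q by auto
    thus ?thesis using that by (auto simp: card_3_iff)
  qed
  let ?T = "T_cw :: 'q cw_space"
  have sl: "contract3 ?T g $ i $ j = slice_comb (\<lambda>b. g (Some b)) (g None) i j" for g i j
    unfolding contract3_def vec_lambda_beta T_cw_nth sum_UNIV_option
    by (cases i; cases j) (simp_all add: of_bool_def if_distrib cong: if_cong)
  have mv: "(contract3 ?T g *v z) $ None = (\<Sum>b\<in>UNIV. g (Some b) * z $ Some b)"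
    "(contract3 ?T g *v z) $ Some x = g (Some x) * z $ None + g None * z $ Some x" for g z x
    unfolding matrix_vector_mult_def vec_lambda_beta sl sum_UNIV_option
    by (simp_all add: of_bool_def if_distrib if_distribR cong: if_cong)
  let ?gP = "\<lambda>k. of_bool (k = None) + of_bool (k = Some a) :: complex"
  let ?gX = "\<lambda>k. of_bool (k = Some b) :: complex" and ?gY = "\<lambda>k. of_bool (k = Some c) :: complex"
  let ?w = "axis (Some c) 1 :: complex ^ 'q option"
  let ?z1 = "axis (Some a) 1 - axis None 1 :: complex ^ 'q option"
  have single: "(\<Sum>x\<in>UNIV. of_bool (x = y) * h x) = h y" for y :: 'q and h :: "'q \<Rightarrow> complex"
    by (simp add: of_bool_def if_distrib if_distribR cong: if_cong)
  have vec_opt: "u = v \<longleftrightarrow> u $ None = v $ None \<and> (\<forall>x. u $ Some x = v $ Some x)" for u v :: "complex ^ 'q option"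
    unfolding vec_eq_iff by (metis not_None_eq)
  have det: "det (contract3 ?T ?gP) \<noteq> 0"
  proof -
    have "z = 0" if "contract3 ?T ?gP *v z = 0" for z
    proof -
      have 1: "z $ Some a = 0"
        using arg_cong[OF that, of "\<lambda>v. v $ None"] by (simp add: mv single)
      have 2: "of_bool (x = a) * z $ None + z $ Some x = 0" for x
        using arg_cong[OF that, of "\<lambda>v. v $ Some x"] by (simp add: mv)
      have 3: "z $ None = 0" using 2[of a] 1 by simp
      show ?thesis using 2 3 by (simp add: vec_opt)
    qed
    hence "inj ((*v) (contract3 ?T ?gP))" by (rule inj_matrix_if_trivial_kernel)
    thus ?thesis unfolding invertible_det_nz[symmetric] invertible_left_inverse matrix_left_invertible_injective .
  qed
  have "contract3 ?T ?gX *v ?z1 = contract3 ?T ?gY *v 0"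
  proof (rule closure_slices_commute[OF T r det, of _ _ ?w])
    show "contract3 ?T ?gP *v ?z1 = contract3 ?T ?gY *v ?w"
      by (simp add: vec_opt mv single axis_def)
    show "contract3 ?T ?gP *v 0 = contract3 ?T ?gX *v ?w"
      using abc by (simp add: vec_opt mv single axis_def)
  qed
  hence "(contract3 ?T ?gX *v ?z1) $ Some b = 0" by simp
  thus False by (simp add: mv axis_def)
qed

lemma border_rank_T_cw:
  assumes "CARD('q::finite) > 2"
  shows "border_rank (T_cw :: 'q cw_space) = CARD('q) + 2"
  unfolding border_rank_def
  by (rule Least_equality) (rule T_cw_border_rank_le[OF assms], rule T_cw_border_rank_ge[OF assms])

section \<open>The annihilator\<close>

definition cw_tensor :: "nat \<Rightarrow> 'q::finite option option \<Rightarrow> 'q option tensor" where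
  "cw_tensor d i = (case i of
      None \<Rightarrow> unit_pm (replicate d None)
    | Some (Some \<alpha>) \<Rightarrow> \<Sum>k<d. unit_pm ((replicate d None)[k := Some \<alpha>])
    | Some None \<Rightarrow> \<Sum>\<alpha>\<in>UNIV. \<Sum>(k, l)\<in>{(k, l). k < l \<and> l < d}.
        unit_pm ((replicate d None)[k := Some \<alpha>, l := Some \<alpha>]))"

lemma nonzero_letters_eq_empty: "nonzero_letters (mset w) = {#} \<longleftrightarrow> w = replicate (length w) None"
proof (induction w)
  case (Cons x w)
  thus ?case by (cases x) auto
qed simp

lemma lookup_unit: "lookup (unit_pm v) w = (of_bool (v = w) :: complex)"
  by (simp add: lookup_single when_def)

lemma lookup_cw_tensor_None:
  "lookup (cw_tensor d None) w = of_bool (length w = d) * cw_weight None (nonzero_letters (mset w))"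
  by (auto simp: cw_tensor_def lookup_unit cw_weight_def nonzero_letters_eq_empty)

lemma cw_weight_letter_mset_add:
  "cw_weight (Some (Some \<alpha>)) (letter_mset x + M) =
     of_bool (x = Some \<alpha>) * cw_weight None M + of_bool (x = None) * cw_weight (Some (Some \<alpha>)) M"
  "cw_weight (Some None) (letter_mset x + M) =
     (\<Sum>\<alpha>\<in>UNIV. of_bool (x = Some \<alpha>) * cw_weight (Some (Some \<alpha>)) M) + of_bool (x = None) * cw_weight (Some None) M"
  for \<alpha> :: "'q::finite"
proof -
  show "cw_weight (Some (Some \<alpha>)) (letter_mset x + M) =
     of_bool (x = Some \<alpha>) * cw_weight None M + of_bool (x = None) * cw_weight (Some (Some \<alpha>)) M"
    by (cases x) (auto simp: cw_weight_def)
  show "cw_weight (Some None) (letter_mset x + M) =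
     (\<Sum>\<alpha>\<in>UNIV. of_bool (x = Some \<alpha>) * cw_weight (Some (Some \<alpha>)) M) + of_bool (x = None) * cw_weight (Some None) M"
  proof (cases x)
    case (Some \<beta>)
    have "(\<exists>a. add_mset \<beta> M = {#a, a#}) \<longleftrightarrow> M = {#\<beta>#}" by (auto simp: add_eq_conv_ex)
    moreover have "(\<Sum>\<alpha>\<in>UNIV. of_bool (\<beta> = \<alpha>) * of_bool (M = {#\<alpha>#})) =
        (\<Sum>\<alpha>\<in>UNIV. if \<beta> = \<alpha> then of_bool (M = {#\<alpha>#}) else 0 :: complex)"
      by (intro sum.cong) auto
    ultimately show ?thesis by (simp add: Some cw_weight_def)
  qed (simp add: cw_weight_def)
qed

lemma lookup_cw_tensor_Some:
  "lookup (cw_tensor d (Some (Some \<alpha>))) w =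
     of_bool (length w = d) * cw_weight (Some (Some \<alpha>)) (nonzero_letters (mset w))"
proof (induction d arbitrary: w)
  case 0
  thus ?case by (simp add: cw_tensor_def cw_weight_def)
next
  case (Suc d)
  show ?case
  proof (cases w)
    case Nil
    have ne: "(replicate (Suc d) None)[k := Some \<alpha>] \<noteq> []" for k
      by (metis length_list_update length_replicate list.size(3) nat.distinct(1))
    have "lookup (cw_tensor (Suc d) (Some (Some \<alpha>))) [] = 0"
      unfolding cw_tensor_def option.case lookup_sum lookup_unit
      by (intro sum.neutral ballI) (simp only: ne of_bool_eq)
    thus ?thesis by (simp add: Nil)
  next
    case (Cons x v)
    have "lookup (cw_tensor (Suc d) (Some (Some \<alpha>))) w =
        of_bool (Some \<alpha> # replicate d None = x # v) +
        (\<Sum>k<d. of_bool (None # (replicate d None)[k := Some \<alpha>] = x # v))"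
      by (simp add: cw_tensor_def lookup_sum lookup_add lookup_unit sum.lessThan_Suc_shift Cons del: sum.lessThan_Suc)
    also have "\<dots> = of_bool (x = Some \<alpha>) * lookup (cw_tensor d None) v +
        of_bool (x = None) * lookup (cw_tensor d (Some (Some \<alpha>))) v"
      by (auto simp: cw_tensor_def lookup_sum lookup_unit sum_distrib_left intro!: sum.cong)
    also have "\<dots> = of_bool (length v = d) * cw_weight (Some (Some \<alpha>)) (letter_mset x + nonzero_letters (mset v))"
      by (simp add: cw_weight_letter_mset_add Suc lookup_cw_tensor_None algebra_simps)
    finally show ?thesis by (simp add: Cons)
  qed
qed

lemma lookup_cw_tensor_pair:
  "lookup (cw_tensor d (Some None)) w =
     of_bool (length w = d) * cw_weight (Some None) (nonzero_letters (mset w))"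
proof (induction d arbitrary: w)
  case 0
  thus ?case by (simp add: cw_tensor_def cw_weight_def)
next
  case (Suc d)
  let ?P = "\<lambda>d. {(k, l). k < l \<and> l < (d::nat)}"
  have fin: "finite (?P d)" for d
    by (rule finite_subset[of _ "{..<d} \<times> {..<d}"]) auto
  have P_Suc: "?P (Suc d) = (\<lambda>l. (0, Suc l)) ` {..<d} \<union> map_prod Suc Suc ` ?P d"
  proof (intro equalityI subsetI)
    fix x assume "x \<in> ?P (Suc d)"
    then obtain k l where x: "x = (k, l)" "k < l" "l < Suc d" by auto
    then obtain l' where l': "l = Suc l'" by (cases l) auto
    show "x \<in> (\<lambda>l. (0, Suc l)) ` {..<d} \<union> map_prod Suc Suc ` ?P d"
      using x l' by (cases k) (auto simp: image_iff)
  qed auto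
  have sum_P: "(\<Sum>(k, l)\<in>?P (Suc d). f k l) = (\<Sum>l<d. f 0 (Suc l)) + (\<Sum>(k, l)\<in>?P d. f (Suc k) (Suc l))"
    for f :: "nat \<Rightarrow> nat \<Rightarrow> complex"
  proof -
    have "(\<Sum>(k, l)\<in>?P (Suc d). f k l) = (\<Sum>(k, l)\<in>(\<lambda>l. (0, Suc l)) ` {..<d}. f k l) + (\<Sum>(k, l)\<in>map_prod Suc Suc ` ?P d. f k l)"
      unfolding P_Suc by (rule sum.union_disjoint) (use fin in auto)
    moreover have "(\<Sum>(k, l)\<in>(\<lambda>l. (0, Suc l)) ` {..<d}. f k l) = (\<Sum>l<d. f 0 (Suc l))"
      by (subst sum.reindex) (auto simp: inj_on_def)
    moreover have "(\<Sum>(k, l)\<in>map_prod Suc Suc ` ?P d. f k l) = (\<Sum>(k, l)\<in>?P d. f (Suc k) (Suc l))"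
      by (subst sum.reindex) (auto simp: inj_on_def intro!: sum.cong)
    ultimately show ?thesis by simp
  qed
  have lk: "lookup (cw_tensor d (Some None)) w = (\<Sum>\<alpha>\<in>UNIV. \<Sum>(k, l)\<in>?P d.
      of_bool ((replicate d None)[k := Some \<alpha>, l := Some \<alpha>] = w))" for d and w :: "'a option list"
    by (simp add: cw_tensor_def lookup_sum lookup_unit case_prod_beta)
  show ?case
  proof (cases w)
    case Nil
    have ne: "(replicate (Suc d) None)[k := Some \<alpha>, l := Some \<alpha>] \<noteq> []" for k l and \<alpha> :: 'a
      by (metis length_list_update length_replicate list.size(3) nat.distinct(1))
    have "lookup (cw_tensor (Suc d) (Some None)) ([] :: 'a option list) = 0"
      unfolding lk by (intro sum.neutral ballI) (simp only: ne of_bool_eq case_prod_beta)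
    thus ?thesis by (simp add: Nil)
  next
    case (Cons x v)
    have "lookup (cw_tensor (Suc d) (Some None)) w =
        (\<Sum>\<alpha>\<in>UNIV. (\<Sum>l<d. of_bool (Some \<alpha> # (replicate d None)[l := Some \<alpha>] = x # v)) +
          (\<Sum>(k, l)\<in>?P d. of_bool (None # (replicate d None)[k := Some \<alpha>, l := Some \<alpha>] = x # v)))"
      unfolding lk sum_P by (simp add: Cons)
    also have "\<dots> = (\<Sum>\<alpha>\<in>UNIV. of_bool (x = Some \<alpha>) * lookup (cw_tensor d (Some (Some \<alpha>))) v) +
        of_bool (x = None) * lookup (cw_tensor d (Some None)) v"
      unfolding lk sum.distrib sum_distrib_left
      by (intro arg_cong2[of _ _ _ _ "(+)"] sum.cong refl)
         (auto simp: cw_tensor_def lookup_sum lookup_unit sum_distrib_left intro!: sum.cong)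
    also have "\<dots> = of_bool (length v = d) * cw_weight (Some None) (letter_mset x + nonzero_letters (mset v))"
      by (simp add: cw_weight_letter_mset_add Suc lookup_cw_tensor_Some distrib_left sum_distrib_left mult_ac)
    finally show ?thesis by (simp add: Cons)
  qed
qed

text \<open>
  The spanning tensors of \<open>L\<^sup>d\<close>, \<open>L\<^sup>d\<^sup>-\<^sup>1 M\<close> and \<open>L\<^sup>d\<^sup>-\<^sup>2 Q\<close> are the functionals \<open>cw_weight\<close>, as functions on
  words of length \<open>d\<close>. The induction behind this removes the first letter of the word, the tensors
  and the weights satisfying the same recursion (\<open>cw_weight_letter_mset_add\<close>).
\<close>

lemma lookup_cw_tensor:
  "lookup (cw_tensor d i) w = of_bool (length w = d) * cw_weight i (nonzero_letters (mset w))"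
proof -
  consider "i = None" | "i = Some None" | j where "i = Some (Some j)" by (metis not_None_eq)
  thus ?thesis
    by cases (simp_all only: lookup_cw_tensor_None lookup_cw_tensor_Some lookup_cw_tensor_pair)
qed

lemma cw_tensor_part_sym: "cw_tensor (s + t + u) i \<in> part_sym_tensors s t u"
proof -
  have "length w = s + t + u" if "w \<in> keys (cw_tensor (s + t + u) i)" for w
    using that by (auto simp: in_keys_iff lookup_cw_tensor)
  moreover have "lookup (cw_tensor (s + t + u) i) (xs' @ ys' @ zs') = lookup (cw_tensor (s + t + u) i) (xs @ ys @ zs)"
    if "mset xs' = mset xs \<and> mset ys' = mset ys \<and> mset zs' = mset zs" for xs ys zs xs' ys' zs'
    using that mset_eq_length[of xs' xs] mset_eq_length[of ys' ys] mset_eq_length[of zs' zs]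
    by (simp add: lookup_cw_tensor)
  ultimately show ?thesis unfolding part_sym_tensors_def by blast
qed

lemma subspace_part_sym: "pm.subspace (part_sym_tensors s t u :: 'a tensor set)"
proof -
  have ps: "\<tau> \<in> part_sym_tensors s t u \<longleftrightarrow>
      (\<forall>w. length w \<noteq> s + t + u \<longrightarrow> lookup \<tau> w = 0) \<and>
      (\<forall>xs ys zs xs' ys' zs'. length xs = s \<and> length ys = t \<and> length zs = u \<and>
         mset xs' = mset xs \<and> mset ys' = mset ys \<and> mset zs' = mset zs \<longrightarrow>
         lookup \<tau> (xs' @ ys' @ zs') - lookup \<tau> (xs @ ys @ zs) = 0)"
    for \<tau> :: "'a tensor"
  proof -
    have "(\<forall>w\<in>keys \<tau>. length w = s + t + u) \<longleftrightarrow>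
        (\<forall>w. length w \<noteq> s + t + u \<longrightarrow> lookup \<tau> w = 0)"
      by (auto simp: in_keys_iff)
    thus ?thesis unfolding part_sym_tensors_def mem_Collect_eq right_minus_eq by (simp only:)
  qed
  show ?thesis
    unfolding pm.subspace_def
  proof (intro conjI ballI allI)
    show "0 \<in> (part_sym_tensors s t u :: 'a tensor set)" unfolding ps by simp
    fix \<tau> :: "'a tensor" assume \<tau>: "\<tau> \<in> part_sym_tensors s t u"
    show "pm_scale c \<tau> \<in> part_sym_tensors s t u" for c
      using \<tau> unfolding ps lookup_pm_scale right_diff_distrib[symmetric] mult_eq_0_iff by blast
    fix \<sigma> :: "'a tensor" assume \<sigma>: "\<sigma> \<in> part_sym_tensors s t u"
    show "\<tau> + \<sigma> \<in> part_sym_tensors s t u"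
      using \<tau> \<sigma> unfolding ps lookup_add add_diff_add by (metis add_0)
  qed
qed

text \<open>
  The polarization spreads a monomial evenly over its words, and a partially symmetric tensor is constant on
  these, so the pairing is evaluation at any one of them.
\<close>

lemma pairing_unit:
  fixes xs ys zs :: "'w::finite list"
  assumes \<tau>: "\<tau> \<in> part_sym_tensors s t u" and len: "length xs = s" "length ys = t" "length zs = u"
  shows "pairing s t u (unit_pm (word_monom xs ys zs)) \<tau> = lookup \<tau> (xs @ ys @ zs)"
proof -
  let ?C = "\<lambda>xs. {xs'. mset xs' = mset xs} :: 'w list set"
  let ?K = "lookup \<tau> (xs @ ys @ zs) / (of_nat (card (?C xs)) * of_nat (card (?C ys)) * of_nat (card (?C zs)))"
  have fin: "finite {xs :: 'w list. length xs = n}" for n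
    using finite_lists_length_eq[of "UNIV :: 'w set" n] by simp
  have C: "?C vs \<subseteq> {vs'. length vs' = length vs}" for vs by (auto dest: mset_eq_length)
  have card0: "card (?C vs) \<noteq> 0" for vs
    using finite_subset[OF C fin, of vs] by (auto simp: card_eq_0_iff)
  have cnt: "(\<Sum>vs'\<in>{vs'. length vs' = length vs}. of_bool (mset vs' = mset vs)) = (of_nat (card (?C vs)) :: complex)" for vs
  proof -
    have "{vs' \<in> {vs'. length vs' = length vs}. mset vs' = mset vs} = ?C vs" using C by auto
    thus ?thesis using fin[of "length vs"] by (simp add: of_bool_def sum.If_cases Int_def)
  qed
  have term_eq: "polarize (unit_pm (word_monom xs ys zs)) xs' ys' zs' * lookup \<tau> (xs' @ ys' @ zs') =
      of_bool (mset xs' = mset xs) * (of_bool (mset ys' = mset ys) * (of_bool (mset zs' = mset zs) * ?K))"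
    for xs' ys' zs'
  proof (cases "mset xs' = mset xs \<and> mset ys' = mset ys \<and> mset zs' = mset zs")
    case True
    have "lookup \<tau> (xs' @ ys' @ zs') = lookup \<tau> (xs @ ys @ zs)"
      using \<tau> len True unfolding part_sym_tensors_def by blast
    moreover have "word_monom xs ys zs = word_monom xs' ys' zs'" using True by (simp add: word_monom_eq_iff)
    ultimately show ?thesis using True by (simp add: polarize_def)
  next
    case False
    hence "word_monom xs ys zs \<noteq> word_monom xs' ys' zs'" by (auto simp: word_monom_eq_iff)
    hence "polarize (unit_pm (word_monom xs ys zs)) xs' ys' zs' = 0" by (simp add: polarize_def lookup_single_not_eq)
    thus ?thesis using False by auto
  qed
  have "pairing s t u (unit_pm (word_monom xs ys zs)) \<tau> =
     (\<Sum>xs'\<in>{xs'. length xs' = length xs}. of_bool (mset xs' = mset xs)) *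
     ((\<Sum>ys'\<in>{ys'. length ys' = length ys}. of_bool (mset ys' = mset ys)) *
     ((\<Sum>zs'\<in>{zs'. length zs' = length zs}. of_bool (mset zs' = mset zs)) * ?K))"
    unfolding pairing_def term_eq len by (simp only: flip: sum_distrib_left sum_distrib_right)
  also have "\<dots> = lookup \<tau> (xs @ ys @ zs)"
    unfolding cnt using card0[of xs] card0[of ys] card0[of zs] by simp
  finally show ?thesis .
qed

lemma pairing_cut_monom:
  assumes "\<tau> \<in> part_sym_tensors s t u" "length w = s + t + u"
  shows "pairing s t u (word_poly s t w) \<tau> = lookup \<tau> w"
  unfolding cut_monom_def using pairing_unit[OF assms(1), of "take s w" "take t (drop s w)" "drop (s + t) w"] assms(2)
  by (simp only: take_drop_append3) simp

lemma pairing_eq_wsum: "pairing s t u p \<tau> = wsum p (\<lambda>m. pairing s t u (unit_pm m) \<tau>)"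
proof -
  have "polarize p xs ys zs = (\<Sum>m\<in>keys p. lookup p m * polarize (unit_pm m) xs ys zs)" for xs ys zs
  proof -
    have "lookup p m0 = (\<Sum>m\<in>keys p. lookup p m * lookup (unit_pm m) m0)" for m0
    proof -
      have "(\<Sum>m\<in>keys p. lookup p m * lookup (unit_pm m) m0) =
        (\<Sum>m\<in>keys p. if m = m0 then lookup p m else 0)"
        by (intro sum.cong) (auto simp: lookup_unit)
      thus ?thesis by (simp add: in_keys_iff)
    qed
    from this[of "word_monom xs ys zs"] show ?thesis
      unfolding polarize_def by (simp only: sum_divide_distrib times_divide_eq_right)
  qed
  thus ?thesis
    unfolding pairing_def wsum_def
    by (simp add: sum_distrib_left sum_distrib_right mult.assoc sum.swap[of _ "keys p"])
qed

lemma pairing_add_right: "pairing s t u p (\<tau> + \<sigma>) = pairing s t u p \<tau> + pairing s t u p \<sigma>"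
  by (simp add: pairing_def lookup_add distrib_left sum.distrib)

lemma pairing_scale_right: "pairing s t u p (pm_scale c \<tau>) = c * pairing s t u p \<tau>"
  by (simp add: pairing_def sum_distrib_left mult_ac)

lemma subspace_annihilator: "pm.subspace (annihilator I s t u)"
  using subspace_part_sym[of s t u] unfolding pm.subspace_def annihilator_def
  by (auto simp: pairing_add_right pairing_scale_right) (simp add: pairing_def)

lemma cw_tensor_in_annihilator: "cw_tensor (s + t + u) i \<in> annihilator cw_ideal s t u"
proof -
  have "pairing s t u p (cw_tensor (s + t + u) i) = 0" if p: "p \<in> ideal_part cw_ideal s t u" for p
  proof -
    have "pairing s t u p (cw_tensor (s + t + u) i) =
        wsum p (\<lambda>m. of_bool (multideg m = (s, t, u)) * cw_weight i (somes m))"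
    proof (subst pairing_eq_wsum, rule wsum_weight_cong)
      fix m assume "m \<in> keys p"
      hence md: "multideg m = (s, t, u)" using p by (auto simp: ideal_part_def polys_of_deg_def)
      then obtain w where w: "length w = s + t + u" "m = cut_monom s t w" by (rule monom_as_cut_monom)
      show "pairing s t u (unit_pm m) (cw_tensor (s + t + u) i) = of_bool (multideg m = (s, t, u)) * cw_weight i (somes m)"
        using pairing_cut_monom[OF cw_tensor_part_sym w(1)] w md by (simp add: lookup_cw_tensor)
    qed
    also have "\<dots> = 0" using p unfolding ideal_part_def cw_ideal_def by blast
    finally show ?thesis .
  qed
  thus ?thesis using cw_tensor_part_sym by (auto simp: annihilator_def)
qed

text \<open>
  A tensor that kills the ideal kills the projection of every monomial to it, which is the difference of the monomial
  and a combination of normal monomials. Hence it is determined by its values at the normal words.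
\<close>

lemma annihilator_expansion:
  fixes \<tau> :: "'q::finite option tensor"
  assumes \<tau>: "\<tau> \<in> annihilator cw_ideal s t u"
  obtains c where "\<tau> = (\<Sum>i\<in>UNIV. pm_scale (c i) (cw_tensor (s + t + u) i))"
proof -
  let ?d = "s + t + u"
  let ?c = "\<lambda>i. of_bool (i \<in> normal_index ?d) * lookup \<tau> (normal_word ?d i)"
  have ps: "\<tau> \<in> part_sym_tensors s t u" using \<tau> by (simp add: annihilator_def)
  have "\<tau> = (\<Sum>i\<in>UNIV. pm_scale (?c i) (cw_tensor ?d i))"
  proof (rule poly_mapping_eqI)
    fix w
    have rhs: "lookup (\<Sum>i\<in>UNIV. pm_scale (?c i) (cw_tensor ?d i)) w =
        of_bool (length w = ?d) * (\<Sum>i\<in>normal_index ?d. cw_weight i (nonzero_letters (mset w)) * lookup \<tau> (normal_word ?d i))"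
    proof -
      have "(\<Sum>i\<in>normal_index ?d. cw_weight i (nonzero_letters (mset w)) * lookup \<tau> (normal_word ?d i)) =
        (\<Sum>i\<in>UNIV. of_bool (i \<in> normal_index ?d) * (cw_weight i (nonzero_letters (mset w)) * lookup \<tau> (normal_word ?d i)))"
        by (rule sum.mono_neutral_cong_left) auto
      thus ?thesis by (simp add: lookup_sum lookup_cw_tensor sum_distrib_left mult_ac)
    qed
    show "lookup \<tau> w = lookup (\<Sum>i\<in>UNIV. pm_scale (?c i) (cw_tensor ?d i)) w"
    proof (cases "length w = ?d")
      case False
      thus ?thesis using ps unfolding rhs by (auto simp: part_sym_tensors_def in_keys_iff)
    next
      case True
      let ?nm = "\<lambda>i. cut_monom s t (normal_word ?d i)" and ?w = "\<lambda>i (m :: 'q cw_monom). cw_weight i (somes m)"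
      have "cut_monom s t w \<in> monoms (s, t, u)" using True by (simp add: monoms_def multideg_cut_monom)
      hence "kernel_vec (normal_index ?d) ?nm ?w (cut_monom s t w) \<in> ideal_part cw_ideal s t u"
        unfolding ideal_part_cw_ideal by (rule kernel_vec_in_kernel[OF cw_dual_system])
      hence "0 = pairing s t u (kernel_vec (normal_index ?d) ?nm ?w (cut_monom s t w)) \<tau>"
        using \<tau> by (simp add: annihilator_def)
      also have "\<dots> = pairing s t u (word_poly s t w) \<tau> -
          (\<Sum>i\<in>normal_index ?d. cw_weight i (nonzero_letters (mset w)) * pairing s t u (unit_pm (?nm i)) \<tau>)"
        by (subst pairing_eq_wsum) (simp add: kernel_vec_def wsum_diff wsum_sum wsum_scale)
      also have "\<dots> = lookup \<tau> w -
          (\<Sum>i\<in>normal_index ?d. cw_weight i (nonzero_letters (mset w)) * lookup \<tau> (normal_word ?d i))"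
        using pairing_cut_monom[OF ps True] pairing_cut_monom[OF ps length_normal_word] by simp
      finally show ?thesis unfolding rhs using True by simp
    qed
  qed
  thus ?thesis by (rule that)
qed

lemma cw_tensor_independent:
  assumes "(\<Sum>i\<in>UNIV. pm_scale (c i) (cw_tensor d i)) = 0"
  shows "pm_scale (c i) (cw_tensor d i) = 0"
proof (cases "i \<in> normal_index d")
  case True
  have "0 = lookup (\<Sum>i\<in>UNIV. pm_scale (c i) (cw_tensor d i)) (normal_word d i)"
    using assms by simp
  also have "\<dots> = (\<Sum>j\<in>UNIV. if j = i then c i else 0)"
    unfolding lookup_sum
    by (intro sum.cong) (auto simp: lookup_cw_tensor length_normal_word[OF True] cw_weight_normal)
  finally show ?thesis by simp
next
  case False
  have "lookup (cw_tensor d i) w = 0" for w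
  proof -
    have "cw_weight i (nonzero_letters (mset w)) = 0" if "length w = d"
      using False nonzero_letters_decomp(2)[of "mset w"] that
      by (intro cw_weight_size) (auto simp: normal_index_def)
    thus ?thesis by (simp add: lookup_cw_tensor)
  qed
  hence "cw_tensor d i = 0" by (intro poly_mapping_eqI) simp
  thus ?thesis by simp
qed

lemma span_range:
  fixes g :: "'i::finite \<Rightarrow> 'x \<Rightarrow>\<^sub>0 complex"
  shows "pm.span (range g) = {\<Sum>a\<in>UNIV. pm_scale (c a) (g a) | c. True}" (is "_ = ?R")
proof
  show "pm.span (range g) \<subseteq> ?R"
  proof (rule pm.span_minimal)
    have "g b = (\<Sum>a\<in>UNIV. pm_scale (of_bool (a = b)) (g a))" for b
    proof -
      have "(\<Sum>a\<in>UNIV. pm_scale (of_bool (a = b)) (g a)) = (\<Sum>a\<in>UNIV. if a = b then g b else 0)"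
        by (intro sum.cong) auto
      thus ?thesis by simp
    qed
    hence "g b \<in> ?R" for b
      by (intro CollectI exI[of _ "\<lambda>a. of_bool (a = b)"] conjI TrueI)
    thus "range g \<subseteq> ?R" by blast
    show "pm.subspace ?R"
      unfolding pm.subspace_def
    proof (intro conjI ballI allI)
      show "0 \<in> ?R" by (intro CollectI exI[of _ "\<lambda>_. 0"]) simp
      fix x assume "x \<in> ?R"
      then obtain c where x: "x = (\<Sum>a\<in>UNIV. pm_scale (c a) (g a))" by blast
      show "pm_scale k x \<in> ?R" for k
        by (intro CollectI exI[of _ "\<lambda>a. k * c a"]) (simp add: x pm.scale_sum_right)
      fix y assume "y \<in> ?R"
      then obtain c' where y: "y = (\<Sum>a\<in>UNIV. pm_scale (c' a) (g a))" by blast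
      show "x + y \<in> ?R"
        by (intro CollectI exI[of _ "\<lambda>a. c a + c' a"]) (simp add: x y pm.scale_left_distrib sum.distrib)
    qed
  qed
  show "?R \<subseteq> pm.span (range g)"
    by (auto intro!: pm.span_sum pm.span_scale intro: pm.span_base)
qed

text \<open>
  The sum is direct because of duality with the normal words. If \<open>d < 2\<close>, some of the spanning
  tensors are zero, which is why independence is expressed by vanishing of the summands, not of the coefficients.
\<close>

lemma annihilator_cw_ideal_direct_sum:
  assumes "s + t + u = d"
  shows "is_direct_sum3 (annihilator (cw_ideal :: 'q::finite cw_poly set) s t u)
           (space_L d) (space_LM d) (space_LQ d)"
proof -
  let ?g = "cw_tensor d :: 'q option option \<Rightarrow> _"
  have L: "(space_L d :: 'q option tensor set) = {pm_scale k (?g None) | k. True}"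
    using span_range[of "\<lambda>_ :: unit. ?g None"] by (auto simp: space_L_def cw_tensor_def UNIV_unit)
  have LQ: "(space_LQ d :: 'q option tensor set) = {pm_scale k (?g (Some None)) | k. True}"
    using span_range[of "\<lambda>_ :: unit. ?g (Some None)"] by (auto simp: space_LQ_def cw_tensor_def UNIV_unit)
  have LM: "(space_LM d :: 'q option tensor set) = {\<Sum>a\<in>UNIV. pm_scale (c a) (?g (Some (Some a))) | c. True}"
    unfolding span_range[symmetric] space_LM_def cw_tensor_def by (simp add: image_def)
  have split: "(\<Sum>i\<in>UNIV. pm_scale (c i) (?g i)) = pm_scale (c None) (?g None) +
      (\<Sum>a\<in>UNIV. pm_scale (c (Some (Some a))) (?g (Some (Some a)))) + pm_scale (c (Some None)) (?g (Some None))" for c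
    by (simp add: sum_UNIV_option add_ac)
  have "annihilator (cw_ideal :: 'q cw_poly set) s t u =
     {x + y + z | x y z. x \<in> space_L d \<and> y \<in> space_LM d \<and> z \<in> space_LQ d}" (is "?A = ?B")
  proof (intro equalityI subsetI)
    fix \<tau> assume "\<tau> \<in> ?A"
    then obtain c where "\<tau> = (\<Sum>i\<in>UNIV. pm_scale (c i) (cw_tensor (s + t + u) i))"
      by (rule annihilator_expansion)
    hence \<tau>: "\<tau> = (\<Sum>i\<in>UNIV. pm_scale (c i) (?g i))" by (simp only: assms)
    have "pm_scale (c None) (?g None) \<in> space_L d" unfolding L by blast
    moreover have "(\<Sum>a\<in>UNIV. pm_scale (c (Some (Some a))) (?g (Some (Some a)))) \<in> space_LM d"
      unfolding LM by (intro CollectI exI[of _ "\<lambda>a. c (Some (Some a))"]) simp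
    moreover have "pm_scale (c (Some None)) (?g (Some None)) \<in> space_LQ d" unfolding LQ by blast
    ultimately show "\<tau> \<in> ?B" unfolding \<tau> split by blast
  next
    fix \<tau> assume "\<tau> \<in> ?B"
    then obtain x y z where xyz: "\<tau> = x + y + z" "x \<in> space_L d" "y \<in> space_LM d" "z \<in> space_LQ d" by blast
    obtain k where "x = pm_scale k (?g None)" using xyz(2) unfolding L by blast
    moreover obtain c where "y = (\<Sum>a\<in>UNIV. pm_scale (c a) (?g (Some (Some a))))" using xyz(3) unfolding LM by blast
    moreover obtain l where "z = pm_scale l (?g (Some None))" using xyz(4) unfolding LQ by blast
    ultimately have \<tau>: "\<tau> = pm_scale k (?g None) + (\<Sum>a\<in>UNIV. pm_scale (c a) (?g (Some (Some a)))) + pm_scale l (?g (Some None))"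
      using xyz(1) by simp
    have "?g i \<in> ?A" for i using cw_tensor_in_annihilator[of s t u i] assms by simp
    thus "\<tau> \<in> ?A" unfolding \<tau>
      by (intro pm.subspace_add pm.subspace_sum pm.subspace_scale subspace_annihilator)
  qed
  moreover have "x = 0 \<and> y = 0 \<and> z = 0"
    if "x \<in> space_L d" "y \<in> space_LM d" "z \<in> space_LQ d" "x + y + z = 0" for x y z :: "'q option tensor"
  proof -
    have "\<exists>k. x = pm_scale k (?g None)" "\<exists>c. y = (\<Sum>a\<in>UNIV. pm_scale (c a) (?g (Some (Some a))))"
      "\<exists>l. z = pm_scale l (?g (Some None))"
      using that(1-3) unfolding L LM LQ by blast+
    then obtain k c l where xyz: "x = pm_scale k (?g None)" "y = (\<Sum>a\<in>UNIV. pm_scale (c a) (?g (Some (Some a))))" "z = pm_scale l (?g (Some None))"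
      by blast
    let ?c = "\<lambda>i. case i of None \<Rightarrow> k | Some None \<Rightarrow> l | Some (Some a) \<Rightarrow> c a"
    have "(\<Sum>i\<in>UNIV. pm_scale (?c i) (?g i)) = 0" unfolding split using that(4) by (simp add: xyz)
    hence z: "pm_scale (?c i) (?g i) = 0" for i by (rule cw_tensor_independent)
    show ?thesis
    proof (intro conjI)
      show "x = 0" using z[of None] by (simp only: xyz option.case)
      show "z = 0" using z[of "Some None"] by (simp only: xyz option.case)
      show "y = 0" unfolding xyz using z[of "Some (Some _)"] by (intro sum.neutral ballI) (simp only: option.case)
    qed
  qed
  ultimately show ?thesis unfolding is_direct_sum3_def by blast
qed

section \<open>The unique point\<close>

theorem theorem6p1:
  assumes "CARD('q::finite) > 2"
  shows "\<exists>I. VSP (T_cw :: complex ^ 'q option ^ 'q option ^ 'q option) = {I} \<and>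
           (\<forall>s t u d. s + t + u = d \<longrightarrow>
              is_direct_sum3 (annihilator I s t u) (space_L d) (space_LM d) (space_LQ d))"
proof -
  note br = border_rank_T_cw[OF assms]
  have "VSP (T_cw :: complex ^ 'q option ^ 'q option ^ 'q option) = {cw_ideal}"
    using cw_ideal_in_VSP[OF assms br] cw_candidate.eq_cw_ideal[OF VSP_is_cw_candidate[OF assms br]] by blast
  thus ?thesis using annihilator_cw_ideal_direct_sum by blast
qed

end
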